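(* Let $f:\mathbb{B}^n\to\mathbb{R}^n$ be a $K$-quasiregular mapping and let $u$ be a non-negative function on $\mathbb{B}^n$ satisfying the Harnack inequality $$u(x)\simeq u(y)\quad\text{for all }x\in\mathbb{B}^n\text{ and }y\in\tfrac12B_x,$$ with comparison constant independent of $x$ and $y$. Then for any $\lambda_2'\in(1,2)$ and for some $\lambda_1'\in(0,1)$ we have that for any $q\in(0,n]$ and $p\ge q$ it holds $$\int_{\mathbb{B}^n}|Df|^q\,\mathrm{a}_f^{p-q}\,u\,d\mathcal{L}^n\lesssim\int_{\mathbb{B}^n}\mathrm{a}_{f,\lambda_2'}^p\,u\,d\mathcal{L}^n,$$ $$\int_{\mathbb{B}^n}\mathrm{a}_{f,\lambda_1'}^p\,u\,d\mathcal{L}^n\lesssim\int_{\mathbb{B}^n}|Df|^q\,\mathrm{a}_f^{p-q}\,u\,d\mathcal{L}^n.$$ Here the comparison constants depend on $K,n,q$ and $u$.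
   Context: $\mathbb{B}^n$ is the open unit ball of $\mathbb{R}^n$; for $x\in\mathbb{B}^n$, $B_x:=B(x,\tfrac12(1-|x|))$ and $\lambda B_x:=B(x,\tfrac\lambda2(1-|x|))$. A continuous map $f$ is $K$-quasiregular ($K\ge1$) if $f\in W^{1,n}_{loc}$ and $|Df|^n\le KJ_f$ a.e. ($|Df|$ operator norm, $J_f$ Jacobian determinant). For $0<\lambda<2$, $\mathrm{a}_{f,\lambda}(x):=\Big(\frac{1}{|2B_x|}\int_{\lambda B_x}|Df|^n\,d\mathcal{L}^n\Big)^{1/n}$, and $\mathrm{a}_f:=\mathrm{a}_{f,1}$. $A\lesssim B$ means $A\le cB$ for a constant $c>0$; $A\simeq B$ means $A\lesssim B\lesssim A$.
   Formalization: The dimension is assumed to be n ≥ 2, since for n = 1 the second inequality fails (take f' = 1/ε on (0,ε), p = q < 1, u = 1); u is assumed measurable; the comparison constant may also depend on the prescribed λ₂', but not on p or f. *)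

theory Defs
  imports "HOL-Analysis.Analysis"
begin

section \<open>Sobolev functions\<close>

primrec Ck :: "nat \<Rightarrow> ('a::euclidean_space \<Rightarrow> real) \<Rightarrow> bool" where
  "Ck 0 \<phi> \<longleftrightarrow> continuous_on UNIV \<phi>"
| "Ck (Suc k) \<phi> \<longleftrightarrow> (\<forall>x. \<phi> differentiable (at x)) \<and>
     (\<forall>b\<in>Basis. Ck k (\<lambda>x. frechet_derivative \<phi> (at x) b))"

definition test_fun :: "'a::euclidean_space set \<Rightarrow> ('a \<Rightarrow> real) \<Rightarrow> bool" where
  "test_fun U \<phi> \<longleftrightarrow> (\<forall>k. Ck k \<phi>) \<and>
     compact (closure {x. \<phi> x \<noteq> 0}) \<and> closure {x. \<phi> x \<noteq> 0} \<subseteq> U"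

definition Lp_loc :: "real \<Rightarrow> 'a::euclidean_space set \<Rightarrow> ('a \<Rightarrow> 'b::euclidean_space) \<Rightarrow> bool" where
  "Lp_loc p U g \<longleftrightarrow> g \<in> borel_measurable (lebesgue_on U) \<and>
     (\<forall>C. compact C \<and> C \<subseteq> U \<longrightarrow> set_integrable lebesgue C (\<lambda>x. norm (g x) powr p))"

text \<open>The entry \<open>D x $ i $ j\<close> is the weak \<open>j\<close>-th partial derivative of the \<open>i\<close>-th component.\<close>

definition has_weak_deriv ::
    "(real^'n) set \<Rightarrow> (real^'n \<Rightarrow> real^'m) \<Rightarrow> (real^'n \<Rightarrow> real^'n^'m) \<Rightarrow> bool" where
  "has_weak_deriv U f D \<longleftrightarrow> Lp_loc 1 U f \<and> Lp_loc 1 U D \<and>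
     (\<forall>\<phi> i j. test_fun U \<phi> \<longrightarrow>
        (LINT x:U|lebesgue. f x $ i * frechet_derivative \<phi> (at x) (axis j 1)) =
        - (LINT x:U|lebesgue. D x $ i $ j * \<phi> x))"

text \<open>Weak derivatives are determined up to null sets only; \<open>weak_deriv\<close> picks a representative.
  It is used below only under integrals over subsets of \<open>U\<close> and in almost-everywhere statements.\<close>

definition weak_deriv ::
    "(real^'n) set \<Rightarrow> (real^'n \<Rightarrow> real^'m) \<Rightarrow> real^'n \<Rightarrow> real^'n^'m" where
  "weak_deriv U f = (SOME D. has_weak_deriv U f D)"

definition W1p_loc :: "real \<Rightarrow> (real^'n) set \<Rightarrow> (real^'n \<Rightarrow> real^'m) \<Rightarrow> bool" where
  "W1p_loc p U f \<longleftrightarrow> (\<exists>D. has_weak_deriv U f D) \<and>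
     Lp_loc p U f \<and> Lp_loc p U (weak_deriv U f)"


section \<open>Quasiregular maps\<close>

definition deriv_opnorm :: "(real^'n) set \<Rightarrow> (real^'n \<Rightarrow> real^'m) \<Rightarrow> real^'n \<Rightarrow> real" where
  "deriv_opnorm U f x = onorm ((*v) (weak_deriv U f x))"

definition quasiregular_on ::
    "real \<Rightarrow> (real^'n) set \<Rightarrow> (real^'n \<Rightarrow> real^'n) \<Rightarrow> bool" where
  "quasiregular_on K U f \<longleftrightarrow> 1 \<le> K \<and> continuous_on U f \<and> W1p_loc (real CARD('n)) U f \<and>
     (AE x in lebesgue_on U. deriv_opnorm U f x ^ CARD('n) \<le> K * det (weak_deriv U f x))"


section \<open>Averaged derivatives on the unit ball\<close>

definition wball :: "real \<Rightarrow> 'a::euclidean_space \<Rightarrow> 'a set" where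
  "wball s x = ball x (s / 2 * (1 - norm x))"

text \<open>The integral is over \<open>sB\<^sub>x\<close>, but the normalisation is the volume of \<open>2B\<^sub>x\<close> for every \<open>s\<close>.\<close>

definition avg_deriv :: "(real^'n \<Rightarrow> real^'n) \<Rightarrow> real \<Rightarrow> real^'n \<Rightarrow> real" where
  "avg_deriv f s x = root CARD('n)
     (1 / measure lebesgue (wball 2 x) *
      (LINT y:wball s x|lebesgue. deriv_opnorm (ball 0 1) f y ^ CARD('n)))"

definition harnack :: "('a::euclidean_space \<Rightarrow> real) \<Rightarrow> bool" where
  "harnack u \<longleftrightarrow> (\<exists>c>0. \<forall>x\<in>ball 0 1. \<forall>y\<in>wball (1/2) x. u x \<le> c * u y \<and> u y \<le> c * u x)"

text \<open>For \<open>p = q\<close> the factor \<open>avg_deriv f 1 x powr 0\<close> is \<open>0\<close>, not \<open>1\<close>, where \<open>avg_deriv f 1\<close>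
  vanishes. This does not change the integral: at such \<open>x\<close> the derivative vanishes a.e. on
  \<open>wball 1 x\<close>, and countably many of these balls cover all such \<open>x\<close>, so \<open>deriv_opnorm\<close>
  is \<open>0\<close> at almost all of them.\<close>

definition mixed_integral ::
    "(real^'n \<Rightarrow> real) \<Rightarrow> real \<Rightarrow> real \<Rightarrow> (real^'n \<Rightarrow> real^'n) \<Rightarrow> ennreal" where
  "mixed_integral u p q f = (\<integral>\<^sup>+x\<in>ball 0 1.
     ennreal (deriv_opnorm (ball 0 1) f x powr q * avg_deriv f 1 x powr (p - q) * u x) \<partial>lebesgue)"

definition avg_integral ::
    "(real^'n \<Rightarrow> real) \<Rightarrow> real \<Rightarrow> real \<Rightarrow> (real^'n \<Rightarrow> real^'n) \<Rightarrow> ennreal" where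
  "avg_integral u p s f = (\<integral>\<^sup>+x\<in>ball 0 1. ennreal (avg_deriv f s x powr p * u x) \<partial>lebesgue)"

end

theory Submission
  imports Defs "HOL-Probability.Probability_Measure"
begin

text \<open>
  Integrating by parts, \<open>\<integral> \<phi> det Df\<close> only involves \<open>Df\<close> where \<open>\<nabla>\<phi> \<noteq> 0\<close>; this gives a Caccioppoli inequality
  first for smooth maps, and for Sobolev maps by mollification. Combined with an estimate
  \<open>\<parallel>f - c\<parallel>\<^sub>n \<le> C (\<delta> \<parallel>Df\<parallel>\<^sub>n + C(\<delta>) \<parallel>Df\<parallel>\<^sub>1)\<close> on balls, quasiregularity yields a reverse Hoelder inequality
  with arbitrarily small exponent and, by filling the hole, \<open>\<integral>\<^bsub>B\<^esub> |Df|\<^sup>n \<le> \<theta> \<integral>\<^bsub>3B\<^esub> |Df|\<^sup>n\<close> with \<open>\<theta> < 1\<close>.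
  The two integral inequalities then follow from Fubini's theorem applied to averages over small
  Whitney regions. The comparison of the averages \<open>a\<^sub>f\<close> at neighbouring points must have constant \<open>1\<close>
  as it is raised to the power \<open>p\<close>, while the final constant does not depend on \<open>p\<close>. In the first
  inequality this is achieved by averaging only over points farther from the origin, in the second
  one by choosing \<open>s1\<close> so small that the factor \<open>\<theta>\<close> absorbs the ratio of the volumes.
\<close>


section \<open>Null Lagrangians\<close>

text \<open>The estimate of f minus a constant takes the place of the Sobolev-Poincare inequality.
  Averaging over balls of a fixed radius leaves a term with the top power of the derivative on a
  larger ball, but its factor tends to 0 with that radius, so it can be absorbed; the other term
  contains only the first power, which interpolation lowers further to an exponent q. A second free
  parameter \<open>t\<close> weights the integral over the annulus. Hole filling takes
  \<open>t\<close> large: the other terms carry \<open>1 / t ^ (n - 1)\<close>, small since n is at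
  least 2, and the annulus is a difference of two balls, one of which moves to the left side. The
  reverse Hoelder inequality takes \<open>t\<close> proportional to the gap between the radii and
  iterates over growing radii. Both arguments see only a scalar function, the operator norm of the
  derivative, through the predicate \<open>caccioppoli_weight\<close>. Its constant is K times a
  number depending on n, so \<theta> depends on K and n alone, and s1 can be fixed before s2, q and
  p.\<close>

lemma compact_support_integrable:
  fixes h :: "'a::euclidean_space \<Rightarrow> real"
  assumes "continuous_on UNIV h" and "\<And>x. norm x \<ge> \<rho> \<Longrightarrow> h x = 0"
  shows "integrable lborel h"
proof -
  have "integrable lborel (\<lambda>x. indicator (cball 0 \<rho>) x *\<^sub>R h x)"
    by (rule borel_integrable_compact) (auto intro: continuous_on_subset[OF assms(1)])
  moreover have "(\<lambda>x. indicator (cball 0 \<rho>) x *\<^sub>R h x) = h"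
    using assms(2) by (auto simp: fun_eq_iff indicator_def)
  ultimately show ?thesis by simp
qed

lemma integral_lborel_translation:
  fixes h :: "'a::euclidean_space \<Rightarrow> 'b::{banach,second_countable_topology}"
  assumes "h \<in> borel_measurable borel"
  shows "(LINT x|lborel. h (x + v)) = (LINT x|lborel. h x)"
proof -
  have "(LINT x|lborel. h x) = (LINT x|distr lborel borel ((+) v). h x)"
    by (simp add: lborel_distr_plus)
  also have "\<dots> = (LINT x|lborel. h (v + x))"
    by (rule integral_distr) (auto simp: assms)
  finally show ?thesis by (simp add: add.commute)
qed

lemma compact_support_bounded:
  fixes h :: "'a::euclidean_space \<Rightarrow> real"
  assumes "continuous_on UNIV h" and "\<And>x. norm x \<ge> \<rho> \<Longrightarrow> h x = 0"
  obtains B where "B > 0" "\<And>x. \<bar>h x\<bar> \<le> B"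
proof -
  have "compact (h ` cball 0 \<rho>)"
    by (intro compact_continuous_image continuous_on_subset[OF assms(1)]) auto
  then obtain B where B: "B > 0" "\<And>x. x \<in> cball 0 \<rho> \<Longrightarrow> \<bar>h x\<bar> \<le> B"
    by (auto dest!: compact_imp_bounded simp: bounded_pos)
  have "\<bar>h x\<bar> \<le> B" for x
    using B(2)[of x] assms(2)[of x] B(1) by (cases "norm x \<le> \<rho>") auto
  with B(1) show ?thesis using that by blast
qed

text \<open>By translation invariance every difference quotient of \<open>h\<close> has integral
  zero, and dominated convergence carries this over to the derivative. Thus continuous
  differentiability is enough and no iterated integrals occur.\<close>

lemma integral_directional_derivative_zero:
  fixes h :: "'a::euclidean_space \<Rightarrow> real"
  assumes der: "\<And>x. (h has_derivative h' x) (at x)"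
    and cont: "continuous_on UNIV (\<lambda>x. h' x e)"
    and supp: "\<And>x. norm x \<ge> \<rho> \<Longrightarrow> h x = 0" "\<And>x. norm x \<ge> \<rho> \<Longrightarrow> h' x e = 0"
  shows "(LINT x|lborel. h' x e) = 0"
proof -
  have conth: "continuous_on UNIV h"
    using der by (meson continuous_at_imp_continuous_on has_derivative_continuous)
  then have hb: "h \<in> borel_measurable borel" by (rule borel_measurable_continuous_onI)
  have inth: "integrable lborel h" using conth supp(1) by (rule compact_support_integrable)
  obtain B where B: "B > 0" "\<And>x. \<bar>h' x e\<bar> \<le> B"
    using compact_support_bounded[OF cont supp(2)] by blast
  have along: "((\<lambda>s. h (x + s *\<^sub>R e)) has_real_derivative h' (x + t *\<^sub>R e) e) (at t)" for x t
  proof -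
    have "((\<lambda>s. h (x + s *\<^sub>R e)) has_derivative (\<lambda>s. h' (x + t *\<^sub>R e) (s *\<^sub>R e))) (at t)"
      by (rule has_derivative_compose[where g = h and f = "\<lambda>s. x + s *\<^sub>R e", OF _ der])
        (auto intro!: derivative_eq_intros)
    moreover have "h' (x + t *\<^sub>R e) (s *\<^sub>R e) = h' (x + t *\<^sub>R e) e * s" for s
      using linear_scale[OF has_derivative_linear[OF der[of "x + t *\<^sub>R e"]], of s e]
      by (simp add: mult.commute)
    ultimately show ?thesis by (simp add: has_field_derivative_def)
  qed
  define q where "q k x = real (Suc k) * (h (x + (1 / real (Suc k)) *\<^sub>R e) - h x)" for k x
  have q0: "(LINT x|lborel. q k x) = 0" for k
  proof -
    have "integrable lborel (\<lambda>x. h (x + (1 / real (Suc k)) *\<^sub>R e))"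
    proof (rule compact_support_integrable[where \<rho> = "\<rho> + norm e"])
      show "continuous_on UNIV (\<lambda>x. h (x + (1 / real (Suc k)) *\<^sub>R e))"
        by (intro continuous_on_compose2[OF conth] continuous_intros) auto
      fix x :: 'a assume x: "norm x \<ge> \<rho> + norm e"
      have "norm ((1 / real (Suc k)) *\<^sub>R e) \<le> norm e"
        by (auto simp: divide_simps mult_le_cancel_left1)
      with x have "norm (x + (1 / real (Suc k)) *\<^sub>R e) \<ge> \<rho>"
        using norm_diff_ineq[of x "(1 / real (Suc k)) *\<^sub>R e"] by linarith
      then show "h (x + (1 / real (Suc k)) *\<^sub>R e) = 0" by (rule supp)
    qed
    then show ?thesis
      unfolding q_def using inth integral_lborel_translation[OF hb]
      by (simp del: of_nat_Suc)
  qed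
  \<comment> \<open>The steps have length at most \<open>norm e\<close>, so all quotients vanish
    outside \<open>cball 0 (\<rho> + norm e)\<close>; inside, the mean value theorem on the segment
    bounds them by \<open>B\<close>.\<close>
  have "(\<lambda>k. LINT x|lborel. q k x) \<longlonglongrightarrow> (LINT x|lborel. h' x e)"
  proof (rule integral_dominated_convergence[where w = "\<lambda>x. indicator (cball 0 (\<rho> + norm e)) x *\<^sub>R B"])
    show "(\<lambda>x. h' x e) \<in> borel_measurable lborel"
      using borel_measurable_continuous_onI[OF cont] by simp
    show "q k \<in> borel_measurable lborel" for k
      unfolding q_def using hb by measurable
    show "integrable lborel (\<lambda>x::'a. indicator (cball 0 (\<rho> + norm e)) x *\<^sub>R B)"
      by (rule borel_integrable_compact) auto
    show "AE x in lborel. (\<lambda>k. q k x) \<longlonglongrightarrow> h' x e"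
    proof (rule AE_I2)
      fix x
      have "((\<lambda>s. (h (x + s *\<^sub>R e) - h x) / s) \<longlongrightarrow> h' x e) (at 0)"
        using along[of x 0] by (simp add: has_field_derivative_iff)
      moreover have "filterlim (\<lambda>k. 1 / real (Suc k)) (at 0) sequentially"
        by (rule filterlim_atI) (use LIMSEQ_inverse_real_of_nat in \<open>auto simp: inverse_eq_divide\<close>)
      ultimately have "(\<lambda>k. (h (x + (1 / real (Suc k)) *\<^sub>R e) - h x) / (1 / real (Suc k))) \<longlonglongrightarrow> h' x e"
        by (rule filterlim_compose)
      then show "(\<lambda>k. q k x) \<longlonglongrightarrow> h' x e" by (simp add: q_def mult.commute del: of_nat_Suc)
    qed
    show "AE x in lborel. norm (q k x) \<le> indicator (cball 0 (\<rho> + norm e)) x *\<^sub>R B" for k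
    proof (rule AE_I2)
      fix x
      let ?s = "1 / real (Suc k)"
      have ns: "norm (?s *\<^sub>R e) \<le> norm e"
        by (auto simp: divide_simps mult_le_cancel_left1)
      have pos: "0 < ?s" by simp
      obtain z where "h (x + ?s *\<^sub>R e) - h (x + 0 *\<^sub>R e) = (?s - 0) * h' (x + z *\<^sub>R e) e"
        using MVT2[OF pos, of "\<lambda>s. h (x + s *\<^sub>R e)" "\<lambda>s. h' (x + s *\<^sub>R e) e"] along by auto
      then have "q k x = h' (x + z *\<^sub>R e) e" by (simp add: q_def del: of_nat_Suc)
      then have b: "\<bar>q k x\<bar> \<le> B" using B(2) by simp
      have "q k x = 0" if x: "norm x > \<rho> + norm e"
      proof -
        have "h (x + ?s *\<^sub>R e) = 0"
          by (rule supp) (use x ns norm_diff_ineq[of x "?s *\<^sub>R e"] in linarith)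
        moreover have "h x = 0" by (rule supp) (use x norm_ge_zero[of e] in linarith)
        ultimately show ?thesis by (simp add: q_def)
      qed
      then show "norm (q k x) \<le> indicator (cball 0 (\<rho> + norm e)) x *\<^sub>R B"
        using b by (auto simp: indicator_def)
    qed
  qed
  then show ?thesis using q0 LIMSEQ_unique[OF _ tendsto_const] by simp
qed

text \<open>In the expansion of the determinant the terms with second derivatives cancel in pairs, under
  exchanging the images of \<open>k0\<close> and \<open>k\<close>.\<close>

lemma null_Lagrangian:
  fixes w :: "real^'n \<Rightarrow> real" and W :: "real^'n \<Rightarrow> real^'n" and A :: "real^'n \<Rightarrow> real^'n^'n"
  assumes dw: "\<And>x. (w has_derivative (\<lambda>v. W x \<bullet> v)) (at x)" and cW: "continuous_on UNIV W"
    and supp: "\<And>x. norm x \<ge> \<rho> \<Longrightarrow> w x = 0" "\<And>x. norm x \<ge> \<rho> \<Longrightarrow> W x = 0"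
    and dA: "\<And>i j x. ((\<lambda>x. A x $ i $ j) has_derivative (\<lambda>v. H i j x \<bullet> v)) (at x)"
    and cH: "\<And>i j. continuous_on UNIV (H i j)"
    and sym: "\<And>i j l x. H i j x $ l = H i l x $ j"
  shows "(LINT x|lborel. det (\<chi> i. if i = k0 then W x else A x $ i)) = 0"
proof -
  let ?P = "{p. p permutes (UNIV :: 'n set)}"
  let ?I = "UNIV - {k0}"
  have finP: "finite ?P" by simp
  \<comment> \<open>Differentiating \<open>h p\<close> in direction \<open>axis (p k0) 1\<close>
    produces the summand of the determinant that belongs to \<open>p\<close>, plus
    \<open>w x\<close> times the terms \<open>R p x k\<close> in which the factor of row
    \<open>k\<close> has been differentiated.\<close>
  define h where "h p x = w x * (\<Prod>i\<in>?I. A x $ i $ p i)" for p x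
  define R where "R p x k = H k (p k) x $ (p k0) * (\<Prod>i\<in>?I - {k}. A x $ i $ p i)" for p x k
  define h' where "h' p x v = W x \<bullet> v * (\<Prod>i\<in>?I. A x $ i $ p i) +
      w x * (\<Sum>k\<in>?I. (H k (p k) x \<bullet> v) * (\<Prod>i\<in>?I - {k}. A x $ i $ p i))" for p x v
  have dh: "(h p has_derivative h' p x) (at x)" for p x
    unfolding h_def h'_def
    by (rule has_derivative_eq_rhs, rule has_derivative_mult[OF dw has_derivative_prod[OF dA]])
       (auto simp: fun_eq_iff algebra_simps)
  have cA: "continuous_on UNIV (\<lambda>x. A x $ i $ j)" for i j
    using dA by (meson continuous_at_imp_continuous_on has_derivative_continuous)
  have cw: "continuous_on UNIV w"
    using dw by (meson continuous_at_imp_continuous_on has_derivative_continuous)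
  have ch: "continuous_on UNIV (\<lambda>x. h' p x v)" for p v
    unfolding h'_def by (intro continuous_intros cW cA cw cH)
  have zero: "(LINT x|lborel. h' p x (axis (p k0) 1)) = 0" for p
    by (rule integral_directional_derivative_zero[OF dh ch, where \<rho> = \<rho>])
       (auto simp: h_def h'_def supp)
  have inth: "integrable lborel (\<lambda>x. h' p x (axis (p k0) 1))" for p
    by (rule compact_support_integrable[OF ch, where \<rho> = \<rho>]) (auto simp: h'_def supp)
  have cancel: "(\<Sum>p\<in>?P. of_int (sign p) * R p x k) = 0" if k: "k \<in> ?I" for x k
  proof -
    let ?\<tau> = "Transposition.transpose k0 k"
    have tp: "?\<tau> permutes UNIV" by (simp add: permutes_swap_id)
    \<comment> \<open>The transposition exchanges the roles of \<open>p k0\<close> and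
      \<open>p k\<close>. These occur only in the second derivative
      \<open>H k (p k) x $ p k0\<close>, which is symmetric in them; the product runs over the other
      rows.\<close>
    have R': "R (p \<circ> ?\<tau>) x k = R p x k" for p
    proof -
      have "(\<Prod>i\<in>?I - {k}. A x $ i $ (p \<circ> ?\<tau>) i) = (\<Prod>i\<in>?I - {k}. A x $ i $ p i)"
        by (rule prod.cong) (auto simp: Transposition.transpose_def)
      then show ?thesis unfolding R_def using sym[of k "p k0" x "p k"] by simp
    qed
    have sg: "sign (p \<circ> ?\<tau>) = - sign p" if "p permutes UNIV" for p :: "'n \<Rightarrow> 'n"
    proof -
      have "permutation p" "permutation ?\<tau>"
        using that tp by (auto simp: permutation_permutes intro!: exI[of _ UNIV])
      moreover have "k0 \<noteq> k" using k by auto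
      ultimately show ?thesis by (simp add: sign_compose sign_swap_id)
    qed
    have "(\<Sum>p\<in>?P. of_int (sign p) * R p x k) = (\<Sum>p\<in>?P. of_int (sign (p \<circ> ?\<tau>)) * R (p \<circ> ?\<tau>) x k)"
      by (rule sum.reindex_bij_witness[of _ "\<lambda>p. p \<circ> ?\<tau>" "\<lambda>p. p \<circ> ?\<tau>"])
         (auto simp: comp_assoc permutes_compose[OF tp])
    also have "\<dots> = - (\<Sum>p\<in>?P. of_int (sign p) * R p x k)"
      unfolding R' sum_negf[symmetric] by (rule sum.cong) (auto simp: sg)
    finally show ?thesis by simp
  qed
  have "det (\<chi> i. if i = k0 then W x else A x $ i) = (\<Sum>p\<in>?P. of_int (sign p) * h' p x (axis (p k0) 1))" for x
  proof -
    have "(\<Prod>i\<in>UNIV. (\<chi> i. if i = k0 then W x else A x $ i) $ i $ p i) =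
        W x $ p k0 * (\<Prod>i\<in>?I. A x $ i $ p i)" for p
      by (subst prod.remove[of _ k0]) (auto intro!: prod.cong)
    moreover have "h' p x (axis (p k0) 1) = W x $ p k0 * (\<Prod>i\<in>?I. A x $ i $ p i) + w x * (\<Sum>k\<in>?I. R p x k)" for p
      by (simp add: h'_def R_def inner_axis)
    moreover have "(\<Sum>p\<in>?P. of_int (sign p) * (w x * (\<Sum>k\<in>?I. R p x k))) = 0"
    proof -
      have "(\<Sum>p\<in>?P. of_int (sign p) * (w x * (\<Sum>k\<in>?I. R p x k))) =
          (\<Sum>p\<in>?P. \<Sum>k\<in>?I. w x * (of_int (sign p) * R p x k))"
        by (simp only: sum_distrib_left mult.left_commute)
      also have "\<dots> = (\<Sum>k\<in>?I. w x * (\<Sum>p\<in>?P. of_int (sign p) * R p x k))"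
        by (subst sum.swap) (simp add: sum_distrib_left)
      also have "\<dots> = 0" using cancel by simp
      finally show ?thesis .
    qed
    ultimately show ?thesis
      unfolding det_def by (simp only: distrib_left sum.distrib add_0_right)
  qed
  then have "(LINT x|lborel. det (\<chi> i. if i = k0 then W x else A x $ i)) =
      (LINT x|lborel. (\<Sum>p\<in>?P. of_int (sign p) * h' p x (axis (p k0) 1)))" by simp
  also have "\<dots> = (\<Sum>p\<in>?P. LINT x|lborel. of_int (sign p) * h' p x (axis (p k0) 1))"
    by (rule Bochner_Integration.integral_sum) (auto intro: integrable_mult_right inth)
  also have "\<dots> = 0" using zero by simp
  finally show ?thesis .
qed


section \<open>The Caccioppoli inequality for smooth maps\<close>

lemma norm_entry_le: "\<bar>(A::real^'n^'m) $ i $ j\<bar> \<le> norm A"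
  using Finite_Cartesian_Product.norm_nth_le[of A i] component_le_norm_cart[of "A $ i" j] by linarith

lemma continuous_on_matrix:
  fixes A :: "'a::topological_space \<Rightarrow> real^'n^'m"
  assumes "\<And>i j. continuous_on S (\<lambda>x. A x $ i $ j)"
  shows "continuous_on S A"
proof -
  have "continuous_on S (\<lambda>x. \<chi> i. \<chi> j. A x $ i $ j)"
    by (intro continuous_on_vec_lambda assms)
  then show ?thesis by simp
qed

lemma measurable_entry:
  fixes A :: "'a \<Rightarrow> real^'n^'m"
  assumes "A \<in> borel_measurable M"
  shows "(\<lambda>x. A x $ i $ j) \<in> borel_measurable M"
proof -
  have "continuous_on UNIV (\<lambda>A::real^'n^'m. A $ i $ j)" by (intro continuous_intros)
  then show ?thesis by (rule measurable_compose[OF assms borel_measurable_continuous_onI])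
qed

lemma has_derivative_everywhere_continuous:
  assumes "\<And>x. (f has_derivative f' x) (at x)"
  shows "continuous_on UNIV f"
  using assms by (meson continuous_at_imp_continuous_on has_derivative_continuous)

lemma det_row_bound:
  fixes v :: "real^'n" and A :: "real^'n^'n"
  shows "\<bar>det (\<chi> i. if i = k then v else A $ i)\<bar> \<le> fact CARD('n) * (norm v * norm A ^ (CARD('n) - 1))"
proof -
  let ?P = "{p. p permutes (UNIV :: 'n set)}"
  let ?B = "\<chi> i. if i = k then v else A $ i"
  have "\<bar>\<Prod>i\<in>UNIV. ?B $ i $ p i\<bar> \<le> norm v * norm A ^ (CARD('n) - 1)" for p
  proof -
    have "\<bar>\<Prod>i\<in>UNIV. ?B $ i $ p i\<bar> = \<bar>v $ p k\<bar> * (\<Prod>i\<in>UNIV - {k}. \<bar>A $ i $ p i\<bar>)"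
      by (subst prod.remove[of _ k]) (auto simp: abs_mult abs_prod intro!: prod.cong)
    also have "\<dots> \<le> norm v * (\<Prod>i\<in>UNIV - {k}. norm A)"
      by (intro mult_mono prod_mono prod_nonneg) (auto simp: component_le_norm_cart norm_entry_le)
    finally show ?thesis by simp
  qed
  then have "\<bar>of_int (sign p) * (\<Prod>i\<in>UNIV. ?B $ i $ p i)\<bar> \<le> norm v * norm A ^ (CARD('n) - 1)" for p
    by (auto simp: abs_mult sign_def)
  then have "\<bar>det ?B\<bar> \<le> (\<Sum>p\<in>?P. norm v * norm A ^ (CARD('n) - 1))"
    unfolding det_def by (intro order_trans[OF sum_abs] sum_mono)
  also have "card ?P = fact CARD('n)"
    by (rule card_permutations) auto
  then have "(\<Sum>p\<in>?P. norm v * norm A ^ (CARD('n) - 1)) = fact CARD('n) * (norm v * norm A ^ (CARD('n) - 1))"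
    by simp
  finally show ?thesis .
qed

text \<open>Squaring makes the positive part continuously differentiable. This is the building block
  of the cutoff function, for which one continuous derivative suffices.\<close>

lemma has_real_derivative_max_square:
  "((\<lambda>x::real. (max 0 x)\<^sup>2) has_real_derivative 2 * max 0 x) (at x)"
proof (cases "x = 0")
  case True
  have "((\<lambda>h. ((max 0 (0 + h))\<^sup>2 - (max 0 (0::real))\<^sup>2) / h) \<longlongrightarrow> 0) (at 0)"
  proof (rule Lim_null_comparison)
    show "\<forall>\<^sub>F h in at 0. norm (((max 0 (0 + h))\<^sup>2 - (max 0 (0::real))\<^sup>2) / h) \<le> \<bar>h\<bar>"
      by (rule always_eventually) (auto simp: max_def power2_eq_square)
    show "((\<lambda>h::real. \<bar>h\<bar>) \<longlongrightarrow> 0) (at 0)"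
      by (intro tendsto_eq_intros) auto
  qed
  then have "((\<lambda>x::real. (max 0 x)\<^sup>2) has_real_derivative 0) (at 0)"
    unfolding DERIV_def .
  with True show ?thesis by simp
next
  case False
  show ?thesis
  proof (cases "x > 0")
    case True
    have "((\<lambda>x::real. x\<^sup>2) has_real_derivative 2 * max 0 x) (at x)"
      using True by (auto intro!: derivative_eq_intros)
    then show ?thesis
      by (rule has_field_derivative_transform_within_open[of _ _ _ "{0<..}"]) (use True in auto)
  next
    case c: False
    have "((\<lambda>x::real. 0) has_real_derivative 2 * max 0 x) (at x)"
      using c by (auto intro!: derivative_eq_intros)
    then show ?thesis
      by (rule has_field_derivative_transform_within_open[of _ _ _ "{..<0}"]) (use c False in auto)
  qed
qed

text \<open>The variable \<open>s\<close> is an affine function of the squared distance, 0 on the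
  sphere of radius \<open>r\<close> and 1 on that of radius \<open>R\<close>. The cutoff applies the
  squared positive part twice, \<open>(1 - s\<^sup>2)\<^sup>2\<close> in between, so that its
  gradient vanishes on both spheres and outside the annulus.\<close>

lemma cutoff_exists:
  fixes a :: "'a::euclidean_space"
  assumes r: "0 < r" "r < R"
  obtains \<phi> :: "'a \<Rightarrow> real" and g :: "'a \<Rightarrow> 'a"
  where "\<And>x. (\<phi> has_derivative (\<lambda>v. g x \<bullet> v)) (at x)" "continuous_on UNIV g"
    "\<And>x. 0 \<le> \<phi> x" "\<And>x. \<phi> x \<le> 1" "\<And>x. norm (x - a) \<le> r \<Longrightarrow> \<phi> x = 1" "\<And>x. norm (x - a) \<ge> R \<Longrightarrow> \<phi> x = 0"
    "\<And>x. norm (x - a) \<le> r \<Longrightarrow> g x = 0" "\<And>x. norm (x - a) \<ge> R \<Longrightarrow> g x = 0"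
    "\<And>x. norm (g x) \<le> 8 / (R - r)"
proof -
  define q where "q = R\<^sup>2 - r\<^sup>2"
  have q: "q > 0" using r by (simp add: q_def power_strict_mono)
  define s where "s x = ((x - a) \<bullet> (x - a) - r\<^sup>2) / q" for x
  define \<phi> where "\<phi> x = (max 0 (1 - (max 0 (s x))\<^sup>2))\<^sup>2" for x
  define e where "e x = - (8 * max 0 (1 - (max 0 (s x))\<^sup>2) * max 0 (s x)) / q" for x
  define g where "g x = e x *\<^sub>R (x - a)" for x
  have ds: "(s has_derivative (\<lambda>v. (2 / q) * ((x - a) \<bullet> v))) (at x)" for x
    unfolding s_def using q
    by (auto intro!: derivative_eq_intros simp: fun_eq_iff inner_commute field_simps)
  have d: "(\<phi> has_derivative (\<lambda>v. g x \<bullet> v)) (at x)" for x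
  proof -
    have "((\<lambda>y. 1 - (max 0 y)\<^sup>2) has_real_derivative - 2 * max 0 y) (at y)" for y :: real
      using DERIV_diff[OF DERIV_const has_real_derivative_max_square] by simp
    from DERIV_chain[OF has_real_derivative_max_square this]
    have "((\<lambda>y. (max 0 (1 - (max 0 y)\<^sup>2))\<^sup>2) has_real_derivative
        2 * max 0 (1 - (max 0 (s x))\<^sup>2) * (- 2 * max 0 (s x))) (at (s x))"
      by (simp add: o_def)
    from has_derivative_compose[OF ds, OF this[unfolded has_field_derivative_def]]
    show ?thesis unfolding \<phi>_def g_def e_def
      by (rule has_derivative_eq_rhs) (auto simp: fun_eq_iff)
  qed
  have cs: "continuous_on UNIV s" unfolding s_def by (intro continuous_intros) (use q in auto)
  have cg: "continuous_on UNIV g" unfolding g_def e_def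
    by (intro continuous_intros cs) (use q in auto)
  have sq: "(x - a) \<bullet> (x - a) = (norm (x - a))\<^sup>2" for x by (simp add: power2_norm_eq_inner)
  have s0: "s x \<le> 0" if "norm (x - a) \<le> r" for x
    using that q by (auto simp: s_def sq divide_nonpos_pos power_mono)
  have s1: "1 \<le> s x" if "norm (x - a) \<ge> R" for x
    using that q r by (auto simp: s_def sq q_def power_mono)
  have p1: "\<phi> x = 1" and g1: "g x = 0" if "norm (x - a) \<le> r" for x
    using s0[OF that] by (auto simp: \<phi>_def g_def e_def max_absorb1)
  have p0: "\<phi> x = 0" and g0: "g x = 0" if "norm (x - a) \<ge> R" for x
  proof -
    have "1 \<le> (max 0 (s x))\<^sup>2" using s1[OF that] by (simp add: one_le_power)
    then have "max 0 (1 - (max 0 (s x))\<^sup>2) = 0" by simp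
    then show "\<phi> x = 0" "g x = 0" unfolding \<phi>_def g_def e_def by simp_all
  qed
  have le1: "max 0 (1 - (max 0 (s x))\<^sup>2) \<le> 1" for x by simp
  have "norm (g x) \<le> 8 / (R - r)" for x
  proof (cases "norm (x - a) < R")
    case True
    have sx: "max 0 (s x) \<le> 1"
      using True q r unfolding s_def sq q_def
      by (auto simp: divide_le_eq intro!: power_mono)
    have "\<bar>e x\<bar> = 8 * (max 0 (1 - (max 0 (s x))\<^sup>2) * max 0 (s x)) / q"
      unfolding e_def using q by (simp add: abs_mult)
    also have "\<dots> \<le> 8 * (1 * 1) / q"
      using q by (intro divide_right_mono mult_left_mono mult_mono le1 sx) auto
    finally have "norm (g x) \<le> 8 / q * R"
      unfolding g_def norm_scaleR using True q by (intro mult_mono) auto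
    \<comment> \<open>\<open>q\<close> factors as \<open>(R - r) * (R + r)\<close>, hence
      \<open>R / q \<le> 1 / (R - r)\<close>.\<close>
    also have "\<dots> \<le> 8 / (R - r)"
      using r q by (simp add: q_def divide_simps power2_eq_square) (simp add: algebra_simps)
    finally show ?thesis .
  next
    case False
    then show ?thesis using g0[of x] r by simp
  qed
  moreover have "0 \<le> \<phi> x" "\<phi> x \<le> 1" for x
    unfolding \<phi>_def using power_le_one[OF _ le1] by auto
  ultimately show ?thesis using that[OF d cg] p0 p1 g0 g1 by blast
qed

text \<open>Young's inequality without sharp constants, by splitting at \<open>a = t * b\<close>.
  The parameter \<open>t\<close> moves weight between the two terms; it is chosen large for hole
  filling and proportional to the gap between the radii for the reverse Hoelder inequality.\<close>

lemma mult_power_Young: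
  fixes a b t :: real
  assumes "0 \<le> a" "0 \<le> b" "0 < t" "0 < n"
  shows "a * b ^ (n - 1) \<le> a ^ n / t ^ (n - 1) + t * b ^ n"
proof (cases "a \<le> t * b")
  case True
  have "a * b ^ (n - 1) \<le> t * b * b ^ (n - 1)"
    using True assms by (intro mult_right_mono) auto
  also have "\<dots> = t * b ^ n" using assms(4) by (cases n) auto
  finally show ?thesis using assms by (simp add: add_increasing)
next
  case False
  then have "b \<le> a / t" using assms by (simp add: field_simps)
  then have "a * b ^ (n - 1) \<le> a * (a / t) ^ (n - 1)"
    using assms by (intro mult_left_mono power_mono) auto
  also have "\<dots> = a ^ n / t ^ (n - 1)" using assms(4) by (cases n) (auto simp: power_divide)
  finally show ?thesis using assms by (simp add: add_increasing2)
qed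

lemma continuous_set_integrable_bounded:
  fixes h :: "'a::euclidean_space \<Rightarrow> real"
  assumes "continuous_on UNIV h" "bounded S" "S \<in> sets borel"
  shows "set_integrable lborel S h"
proof -
  obtain \<rho> where \<rho>: "S \<subseteq> cball 0 \<rho>" using assms(2) unfolding bounded_iff subset_iff mem_cball_0 by metis
  have "set_integrable lborel (cball 0 \<rho>) h"
    unfolding set_integrable_def
    by (rule borel_integrable_compact) (auto intro: continuous_on_subset[OF assms(1)])
  then show ?thesis by (rule set_integrable_subset) (use \<rho> assms in auto)
qed

text \<open>Row \<open>k\<close> of the Jacobian matrix is replaced by the gradient of
  \<open>\<phi> * (g - c)\<close>, and the resulting determinant integrates to zero. By linearity in
  this row it equals \<open>\<phi> x * det (A x)\<close> plus \<open>g x - c\<close> times a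
  determinant with row \<open>G x\<close>, which lives on the annulus only. A single component
  \<open>g\<close> is differentiated here, and \<open>c\<close> is free for the Poincare
  inequality.\<close>

lemma smooth_Caccioppoli:
  fixes g :: "real^'n \<Rightarrow> real" and A :: "real^'n \<Rightarrow> real^'n^'n"
  assumes dg: "\<And>x. (g has_derivative (\<lambda>v. A x $ k \<bullet> v)) (at x)"
    and dA: "\<And>i j x. ((\<lambda>x. A x $ i $ j) has_derivative (\<lambda>v. H i j x \<bullet> v)) (at x)"
    and cH: "\<And>i j. continuous_on UNIV (H i j)"
    and sym: "\<And>i j l x. H i j x $ l = H i l x $ j"
    and r: "0 < r" "r < R"
    and d\<phi>: "\<And>x. (\<phi> has_derivative (\<lambda>v. G x \<bullet> v)) (at x)" and cG: "continuous_on UNIV G"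
    and \<phi>0: "\<And>x. norm (x - a) \<ge> R \<Longrightarrow> \<phi> x = 0"
    and G0: "\<And>x. norm (x - a) \<le> r \<Longrightarrow> G x = 0" "\<And>x. norm (x - a) \<ge> R \<Longrightarrow> G x = 0"
    and Gb: "\<And>x. norm (G x) \<le> B" and t: "0 < t"
  shows "(LINT x|lborel. \<phi> x * det (A x)) \<le> fact CARD('n) * B *
    ((LINT x:ball a R|lborel. \<bar>g x - c\<bar> ^ CARD('n)) / t ^ (CARD('n) - 1) +
     t * (LINT x:ball a R - cball a r|lborel. norm (A x) ^ CARD('n)))"
proof -
  let ?n = "CARD('n)"
  have n0: "0 < ?n" by simp
  have cg: "continuous_on UNIV g" and c\<phi>: "continuous_on UNIV \<phi>"
    using dg d\<phi> by (meson continuous_at_imp_continuous_on has_derivative_continuous)+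
  have cAij: "continuous_on UNIV (\<lambda>x. A x $ i $ j)" for i j
    using dA by (meson continuous_at_imp_continuous_on has_derivative_continuous)
  have cA: "continuous_on UNIV A" by (rule continuous_on_matrix[OF cAij])
  have cdet: "continuous_on UNIV (\<lambda>x. det (M x))" if "continuous_on UNIV M" for M :: "real^'n \<Rightarrow> real^'n^'n"
    unfolding det_def by (intro continuous_intros that)
  have B0: "0 \<le> B" using Gb[of 0] norm_ge_zero order_trans by blast
  define W where "W x = \<phi> x *\<^sub>R A x $ k + (g x - c) *\<^sub>R G x" for x
  have far: "norm (x - a) \<ge> R" if "norm x \<ge> norm a + R" for x
    using that norm_triangle_ineq2[of x a] by linarith
  define Q where "Q x = (\<chi> i. if i = k then G x else A x $ i)" for x
  have cQ: "continuous_on UNIV Q" unfolding Q_def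
  proof (rule continuous_on_vec_lambda)
    show "continuous_on UNIV (\<lambda>x. if i = k then G x else A x $ i)" for i
      by (cases "i = k") (auto intro!: continuous_intros cA cG)
  qed
  have "(LINT x|lborel. det (\<chi> i. if i = k then W x else A x $ i)) = 0"
  proof (rule null_Lagrangian[where w = "\<lambda>x. \<phi> x * (g x - c)" and \<rho> = "norm a + R", OF _ _ _ _ dA cH sym])
    show "((\<lambda>x. \<phi> x * (g x - c)) has_derivative (\<lambda>v. W x \<bullet> v)) (at x)" for x
      unfolding W_def
      by (auto intro!: derivative_eq_intros dg d\<phi> simp: fun_eq_iff inner_add_left)
    show "continuous_on UNIV W" unfolding W_def by (intro continuous_intros c\<phi> cA cg cG)
  qed (auto simp: W_def \<phi>0 G0 far)
  moreover have "det (\<chi> i. if i = k then W x else A x $ i) = \<phi> x * det (A x) + (g x - c) * det (Q x)" for x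
  proof -
    have "(\<chi> i. if i = k then A x $ i else A x $ i) = A x" by (simp add: vec_eq_iff)
    then have "det (\<chi> i. if i = k then A x $ k else A x $ i) = det (A x)"
      by (simp cong: if_cong)
    then show ?thesis
      unfolding W_def Q_def det_row_add det_row_mul[where c = "\<phi> x" and a = "\<lambda>_. A x $ k", unfolded scalar_mult_eq_scaleR]
        det_row_mul[where c = "g x - c" and a = "\<lambda>_. G x", unfolded scalar_mult_eq_scaleR] by simp
  qed
  moreover have i1: "integrable lborel (\<lambda>x. \<phi> x * det (A x))"
    by (rule compact_support_integrable[where \<rho> = "norm a + R"])
       (auto intro!: continuous_intros c\<phi> cdet cA simp: \<phi>0 far)
  moreover have i2: "integrable lborel (\<lambda>x. (g x - c) * det (Q x))"
  proof (rule compact_support_integrable[where \<rho> = "norm a + R"])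
    show "continuous_on UNIV (\<lambda>x. (g x - c) * det (Q x))" by (intro continuous_intros cg cdet cQ)
    fix x :: "real^'n" assume "norm x \<ge> norm a + R"
    then have "G x = 0" by (intro G0 far)
    then have "det (Q x) = 0" using det_row_bound[of k "G x" "A x"] by (simp add: Q_def)
    then show "(g x - c) * det (Q x) = 0" by simp
  qed
  ultimately have "(LINT x|lborel. \<phi> x * det (A x)) = - (LINT x|lborel. (g x - c) * det (Q x))"
    by simp
  also have "\<dots> = (LINT x|lborel. - ((g x - c) * det (Q x)))" by simp
  also have "\<dots> \<le> (LINT x|lborel. fact ?n * B * (indicator (ball a R) x * (\<bar>g x - c\<bar> ^ ?n) / t ^ (?n - 1) +
      t * (indicator (ball a R - cball a r) x * norm (A x) ^ ?n)))"
  proof (rule integral_mono)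
    show "integrable lborel (\<lambda>x. - ((g x - c) * det (Q x)))" using i2 by simp
    have "set_integrable lborel (ball a R) (\<lambda>x. \<bar>g x - c\<bar> ^ ?n)"
      by (intro continuous_set_integrable_bounded continuous_intros cg) auto
    moreover have "set_integrable lborel (ball a R - cball a r) (\<lambda>x. norm (A x) ^ ?n)"
      by (intro continuous_set_integrable_bounded continuous_intros cA bounded_diff) auto
    ultimately show "integrable lborel (\<lambda>x. fact ?n * B * (indicator (ball a R) x * (\<bar>g x - c\<bar> ^ ?n) / t ^ (?n - 1) +
      t * (indicator (ball a R - cball a r) x * norm (A x) ^ ?n)))"
      unfolding set_integrable_def by simp
    fix x
    have bd: "\<bar>- ((g x - c) * det (Q x))\<bar> \<le> fact ?n * norm (G x) * (\<bar>g x - c\<bar> * norm (A x) ^ (?n - 1))"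
      using mult_left_mono[OF det_row_bound[of k "G x" "A x"], of "\<bar>g x - c\<bar>"]
      by (simp add: abs_mult Q_def mult_ac)
    show "- ((g x - c) * det (Q x)) \<le> fact ?n * B * (indicator (ball a R) x * (\<bar>g x - c\<bar> ^ ?n) / t ^ (?n - 1) +
      t * (indicator (ball a R - cball a r) x * norm (A x) ^ ?n))"
    proof (cases "r < norm (x - a) \<and> norm (x - a) < R")
      case True
      have "fact ?n * norm (G x) * (\<bar>g x - c\<bar> * norm (A x) ^ (?n - 1))
          \<le> fact ?n * B * (\<bar>g x - c\<bar> ^ ?n / t ^ (?n - 1) + t * norm (A x) ^ ?n)"
        using B0 by (intro mult_mono mult_left_mono Gb mult_power_Young t n0) auto
      with bd have "- ((g x - c) * det (Q x))
          \<le> fact ?n * B * (\<bar>g x - c\<bar> ^ ?n / t ^ (?n - 1) + t * norm (A x) ^ ?n)"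
        by linarith
      with True show ?thesis
        by (simp add: dist_norm norm_minus_commute)
    next
      case False
      then have "G x = 0" using G0[of x] by force
      with bd have "\<bar>- ((g x - c) * det (Q x))\<bar> \<le> 0" by (metis mult_zero_left mult_zero_right norm_zero)
      then have "- ((g x - c) * det (Q x)) \<le> 0" by linarith
      also have "0 \<le> fact ?n * B * (indicator (ball a R) x * (\<bar>g x - c\<bar> ^ ?n) / t ^ (?n - 1) +
          t * (indicator (ball a R - cball a r) x * norm (A x) ^ ?n))"
        using B0 t by (auto intro!: mult_nonneg_nonneg add_nonneg_nonneg)
      finally show ?thesis .
    qed
  qed
  also have "\<dots> = fact ?n * B *
    ((LINT x:ball a R|lborel. \<bar>g x - c\<bar> ^ ?n) / t ^ (?n - 1) +
     t * (LINT x:ball a R - cball a r|lborel. norm (A x) ^ ?n))"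
  proof -
    have "set_integrable lborel (ball a R) (\<lambda>x. \<bar>g x - c\<bar> ^ ?n)"
      by (intro continuous_set_integrable_bounded continuous_intros cg) auto
    moreover have "set_integrable lborel (ball a R - cball a r) (\<lambda>x. norm (A x) ^ ?n)"
      by (intro continuous_set_integrable_bounded continuous_intros cA bounded_diff) auto
    ultimately show ?thesis
      unfolding set_lebesgue_integral_def set_integrable_def by simp
  qed
  finally show ?thesis .
qed


section \<open>A Poincare inequality with a lower order term\<close>

text \<open>Jensen's inequality for powers: Bernoulli's inequality at \<open>h x / m - 1\<close>,
  multiplied by \<open>m ^ n\<close>, is the tangent line of the power at the mean \<open>m\<close>.
  Stated in \<open>ennreal\<close>, it applies without integrability assumptions.\<close>

lemma (in prob_space) nn_integral_power_le:
  assumes h: "h \<in> borel_measurable M" "\<And>x. 0 \<le> h x"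
  shows "(\<integral>\<^sup>+x. ennreal (h x) \<partial>M) ^ n \<le> (\<integral>\<^sup>+x. ennreal (h x ^ n) \<partial>M)"
proof (cases "n = 0 \<or> (\<integral>\<^sup>+x. ennreal (h x ^ n) \<partial>M) = \<infinity>")
  case True
  then show ?thesis by (auto simp: emeasure_space_1)
next
  case False
  then have n: "n > 0" and fin: "(\<integral>\<^sup>+x. ennreal (h x ^ n) \<partial>M) < \<infinity>" by (auto simp: less_top)
  have ipow: "integrable M (\<lambda>x. h x ^ n)"
    by (rule integrableI_nonneg) (use h fin in auto)
  have ih: "integrable M h"
  proof (rule Bochner_Integration.integrable_bound[of M "\<lambda>x. 1 + h x ^ n"])
    show "AE x in M. norm (h x) \<le> norm (1 + h x ^ n)"
    proof (rule AE_I2)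
      fix x
      have "h x \<le> 1 + h x ^ n"
        using self_le_power[of "h x" n] h(2)[of x] n by (cases "h x \<le> 1") (auto intro: add_increasing2)
      then show "norm (h x) \<le> norm (1 + h x ^ n)" using h(2)[of x] by simp
    qed
  qed (use ipow h in auto)
  define m where "m = expectation h"
  have m0: "0 \<le> m" unfolding m_def using h by simp
  have "m ^ n \<le> expectation (\<lambda>x. h x ^ n)"
  proof (cases "m = 0")
    case True
    then show ?thesis using n h by (simp add: zero_power)
  next
    case False
    then have m: "m > 0" using m0 by simp
    have tangent: "m ^ n + real n * (m ^ (n - 1) * (h x - m)) \<le> h x ^ n" for x
    proof -
      have "1 + real n * (h x / m - 1) \<le> (1 + (h x / m - 1)) ^ n"
        by (rule Bernoulli_inequality) (use h m in auto)
      then have "m ^ n * (1 + real n * (h x / m - 1)) \<le> m ^ n * (h x / m) ^ n"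
        using m by (intro mult_left_mono) auto
      moreover have "m ^ n = m ^ (n - 1) * m" using n by (cases n) auto
      moreover have "m ^ n * (h x / m) ^ n = h x ^ n" using m by (simp add: power_divide)
      moreover have "m ^ n * (real n * (h x / m - 1)) = real n * (m ^ (n - 1) * (h x - m))"
      proof -
        have "m ^ n * (real n * (h x / m - 1)) = real n * (m ^ (n - 1) * (m * (h x / m - 1)))"
          unfolding \<open>m ^ n = m ^ (n - 1) * m\<close> by (simp only: mult_ac)
        also have "m * (h x / m - 1) = h x - m" using m by (simp add: right_diff_distrib)
        finally show ?thesis .
      qed
      ultimately show ?thesis by (simp only: distrib_left mult_1_right)
    qed
    have "expectation (\<lambda>x. m ^ n + real n * (m ^ (n - 1) * (h x - m))) \<le> expectation (\<lambda>x. h x ^ n)"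
      by (intro integral_mono tangent ipow) (use ih in auto)
    moreover have "expectation (\<lambda>x. m ^ n + real n * (m ^ (n - 1) * (h x - m))) = m ^ n"
      using ih by (simp add: prob_space m_def)
    ultimately show ?thesis by simp
  qed
  then have "ennreal (m ^ n) \<le> ennreal (expectation (\<lambda>x. h x ^ n))" by (rule ennreal_leI)
  also have "\<dots> = (\<integral>\<^sup>+x. ennreal (h x ^ n) \<partial>M)"
    using nn_integral_eq_integral[OF ipow] h by simp
  also have "ennreal (m ^ n) = (\<integral>\<^sup>+x. ennreal (h x) \<partial>M) ^ n"
    using nn_integral_eq_integral[OF ih] h m0 by (simp add: m_def ennreal_power)
  finally show ?thesis .
qed

lemma nn_integral_swap:
  assumes "sigma_finite_measure M" "sigma_finite_measure N"
    and "(\<lambda>(x, y). f x y) \<in> borel_measurable (M \<Otimes>\<^sub>M N)"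
  shows "(\<integral>\<^sup>+x. \<integral>\<^sup>+y. f x y \<partial>N \<partial>M) = (\<integral>\<^sup>+y. \<integral>\<^sup>+x. f x y \<partial>M \<partial>N)"
proof -
  interpret pair_sigma_finite M N using assms by (simp add: pair_sigma_finite_def)
  show ?thesis using Fubini'[OF assms(3)] by simp
qed

lemma nn_integral_lborel_translation:
  fixes h :: "'a::euclidean_space \<Rightarrow> ennreal"
  assumes "h \<in> borel_measurable borel"
  shows "(\<integral>\<^sup>+x. h (x + v) \<partial>lborel) = (\<integral>\<^sup>+x. h x \<partial>lborel)"
proof -
  have "(\<integral>\<^sup>+x. h x \<partial>lborel) = (\<integral>\<^sup>+x. h x \<partial>distr lborel borel ((+) v))"
    by (simp add: lborel_distr_plus)
  also have "\<dots> = (\<integral>\<^sup>+x. h (v + x) \<partial>lborel)"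
    by (rule nn_integral_distr) (auto simp: assms)
  finally show ?thesis by (simp add: add.commute)
qed

abbreviation (input) unit_interval_measure :: "real measure" where
  "unit_interval_measure \<equiv> uniform_measure lborel {0..1}"

lemma prob_space_unit_interval: "prob_space unit_interval_measure"
  by (rule prob_space_uniform_measure) auto

text \<open>The fundamental theorem of calculus along a segment, written as an expectation over the
  unit interval so that Jensen's inequality and Fubini's theorem can be applied to it
  directly.\<close>

lemma diff_le_nn_integral_gradient:
  fixes g :: "'a::euclidean_space \<Rightarrow> real"
  assumes dg: "\<And>x. (g has_derivative (\<lambda>v. G x \<bullet> v)) (at x)" and cG: "continuous_on UNIV G"
  shows "ennreal \<bar>g (x + v) - g x\<bar> \<le> (\<integral>\<^sup>+t. ennreal (norm v * norm (G (x + t *\<^sub>R v))) \<partial>unit_interval_measure)"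
proof -
  have cs: "continuous_on UNIV (\<lambda>t. G (x + t *\<^sub>R v))"
    by (intro continuous_on_compose2[OF cG] continuous_intros) auto
  have cont: "continuous_on UNIV (\<lambda>t. G (x + t *\<^sub>R v) \<bullet> v)" by (intro continuous_intros cs)
  have "((\<lambda>t. g (x + t *\<^sub>R v)) has_real_derivative (G (x + t *\<^sub>R v) \<bullet> v)) (at t)" for t
  proof -
    have "((\<lambda>s. g (x + s *\<^sub>R v)) has_derivative (\<lambda>s. G (x + t *\<^sub>R v) \<bullet> (s *\<^sub>R v))) (at t)"
      by (rule has_derivative_compose[where g = g and f = "\<lambda>s. x + s *\<^sub>R v", OF _ dg])
        (auto intro!: derivative_eq_intros)
    then show ?thesis unfolding has_field_derivative_def
      by (rule has_derivative_eq_rhs) (simp add: fun_eq_iff mult.commute)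
  qed
  moreover have "isCont (\<lambda>t. G (x + t *\<^sub>R v) \<bullet> v) t" for t
    using cont by (simp add: continuous_on_eq_continuous_at)
  ultimately have bi: "has_bochner_integral lborel (\<lambda>t. (G (x + t *\<^sub>R v) \<bullet> v) * indicator {0..1} t) (g (x + v) - g x)"
    using has_bochner_integral_FTC_Icc_real[of 0 1 "\<lambda>t. g (x + t *\<^sub>R v)" "\<lambda>t. G (x + t *\<^sub>R v) \<bullet> v"] by simp
  have "ennreal \<bar>g (x + v) - g x\<bar> \<le> (\<integral>\<^sup>+t. ennreal (norm ((G (x + t *\<^sub>R v) \<bullet> v) * indicator {0..1} t)) \<partial>lborel)"
    using integral_norm_bound_ennreal[of lborel "\<lambda>t. (G (x + t *\<^sub>R v) \<bullet> v) * indicator {0..1} t"] bi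
    unfolding has_bochner_integral_iff by simp
  also have "\<dots> \<le> (\<integral>\<^sup>+t. ennreal (norm v * norm (G (x + t *\<^sub>R v))) * indicator {0..1} t \<partial>lborel)"
  proof (rule nn_integral_mono)
    fix t :: real
    have "\<bar>G (x + t *\<^sub>R v) \<bullet> v\<bar> \<le> norm v * norm (G (x + t *\<^sub>R v))"
      using Cauchy_Schwarz_ineq2[of "G (x + t *\<^sub>R v)" v] by (simp only: mult.commute)
    then show "ennreal (norm ((G (x + t *\<^sub>R v) \<bullet> v) * indicator {0..1} t)) \<le>
        ennreal (norm v * norm (G (x + t *\<^sub>R v))) * indicator {0..1} t"
      by (simp add: indicator_def ennreal_leI)
  qed
  also have "\<dots> = (\<integral>\<^sup>+t. ennreal (norm v * norm (G (x + t *\<^sub>R v))) \<partial>unit_interval_measure)"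
  proof -
    have [measurable]: "(\<lambda>t. G (x + t *\<^sub>R v)) \<in> borel_measurable borel"
      using cs by (rule borel_measurable_continuous_onI)
    show ?thesis by (subst nn_integral_uniform_measure) (simp_all add: divide_ennreal_def)
  qed
  finally show ?thesis .
qed

lemma nn_integral_prob_le:
  assumes "prob_space M" "AE x in M. f x \<le> (c::ennreal)"
  shows "(\<integral>\<^sup>+x. f x \<partial>M) \<le> c"
proof -
  interpret prob_space M by fact
  have "(\<integral>\<^sup>+x. f x \<partial>M) \<le> (\<integral>\<^sup>+x. c \<partial>M)" by (intro nn_integral_mono_AE assms)
  then show ?thesis by (simp add: emeasure_space_1)
qed

lemma emeasure_lborel_ball: "emeasure lborel (ball a r) = ennreal (measure lborel (ball a r))"
  using emeasure_lborel_ball_finite[of a r] by (intro emeasure_eq_ennreal_measure) (simp add: less_top)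

lemma power_le_sum_powers:
  fixes x y z :: real
  assumes "0 \<le> x" "0 \<le> y" "0 \<le> z" "x \<le> y + z"
  shows "x ^ n \<le> 2 ^ n * (y ^ n + z ^ n)"
proof (cases "y \<le> z")
  case True
  have "x ^ n \<le> (2 * z) ^ n" using assms True by (intro power_mono) auto
  then show ?thesis using assms by (simp add: power_mult_distrib distrib_left add_increasing)
next
  case False
  have "x ^ n \<le> (2 * y) ^ n" using assms False by (intro power_mono) auto
  then show ?thesis using assms by (simp add: power_mult_distrib distrib_left add_increasing2)
qed

text \<open>\<open>g\<close> is compared with its averages \<open>A\<close> over balls of radius
  \<delta>. The difference \<open>g - A\<close> involves only translations shorter than \<delta>,
  which gives the small factor \<open>\<delta> ^ n\<close>. The variation of \<open>A\<close>
  involves only the first power of the gradient, because every point of the segment from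
  \<open>a\<close> to \<open>x\<close> is smeared over a ball of radius \<delta>. The constant is
  \<open>c = A a\<close>.\<close>

lemma smooth_Poincare:
  fixes g :: "'a::euclidean_space \<Rightarrow> real"
  assumes dg: "\<And>x. (g has_derivative (\<lambda>v. G x \<bullet> v)) (at x)" and cG: "continuous_on UNIV G"
    and R: "0 < R" "0 < \<delta>"
  shows "\<exists>c. (LINT x:ball a R|lborel. \<bar>g x - c\<bar> ^ n) \<le> 2 ^ n * (\<delta> ^ n * (LINT x:ball a (R + \<delta>)|lborel. norm (G x) ^ n)
     + measure lborel (ball a R) * (R / measure lborel (ball (0::'a) \<delta>) * (LINT x:ball a (R + \<delta>)|lborel. norm (G x))) ^ n)"
proof -
  let ?N = "ball (0::'a) \<delta>"
  let ?B = "ball a R" let ?B' = "ball a (R + \<delta>)"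
  define V where "V = measure lborel ?N"
  have V: "V > 0" using R by (simp add: V_def content_ball_pos)
  have eV: "emeasure lborel ?N = ennreal V" unfolding V_def
    by (rule emeasure_lborel_ball)
  define U where "U = uniform_measure lborel ?N"
  interpret U: prob_space U unfolding U_def
    by (rule prob_space_uniform_measure) (use V eV in auto)
  interpret T: prob_space unit_interval_measure by (rule prob_space_unit_interval)
  have sU[measurable_cong]: "sets U = sets borel" by (simp add: U_def)
  have cg: "continuous_on UNIV g"
    by (rule has_derivative_everywhere_continuous[OF dg])
  have mg[measurable]: "g \<in> borel_measurable borel" using cg by (rule borel_measurable_continuous_onI)
  have mG[measurable]: "G \<in> borel_measurable borel" using cG by (rule borel_measurable_continuous_onI)
  have AEU: "AE z in U. z \<in> ?N"
    unfolding U_def by (rule AE_uniform_measureI) auto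
  have int: "integrable U (\<lambda>z. h (y + z))" if c: "continuous_on UNIV h" for h :: "'a \<Rightarrow> real" and y
  proof -
    have "compact (h ` cball y \<delta>)" by (intro compact_continuous_image continuous_on_subset[OF c]) auto
    then obtain B where B: "\<And>x. x \<in> cball y \<delta> \<Longrightarrow> \<bar>h x\<bar> \<le> B"
      by (metis compact_imp_bounded bounded_iff image_eqI real_norm_def)
    have [measurable]: "h \<in> borel_measurable borel" using c by (rule borel_measurable_continuous_onI)
    show ?thesis
      by (rule U.integrable_const_bound[where B = B])
         (use AEU B in \<open>auto elim!: eventually_mono simp: dist_norm\<close>)
  qed
  define A where "A y = (LINT z|U. g (y + z))" for y
  have [measurable]: "?B' \<in> sets borel" "?B \<in> sets borel" "?N \<in> sets borel" by simp_all
  define F1 where "F1 x = indicator ?B' x * ennreal (norm (G x))" for x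
  define Fn where "Fn x = indicator ?B' x * ennreal (norm (G x) ^ n)" for x
  define i where "i x = (indicator ?B x :: ennreal)" for x
  have [measurable]: "F1 \<in> borel_measurable borel" "Fn \<in> borel_measurable borel" "i \<in> borel_measurable borel"
    unfolding F1_def Fn_def i_def by measurable
  define I1 where "I1 = (LINT x:?B'|lborel. norm (G x))"
  define In where "In = (LINT x:?B'|lborel. norm (G x) ^ n)"
  have eI1: "(\<integral>\<^sup>+x. F1 x \<partial>lborel) = ennreal I1"
  proof -
    have "set_integrable lborel ?B' (\<lambda>x. norm (G x))"
      by (intro continuous_set_integrable_bounded continuous_intros cG) auto
    from nn_integral_eq_integral[OF this[unfolded set_integrable_def]]
    show ?thesis unfolding I1_def F1_def set_lebesgue_integral_def
      by (simp add: ennreal_mult ennreal_indicator)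
  qed
  have eIn: "(\<integral>\<^sup>+x. Fn x \<partial>lborel) = ennreal In"
  proof -
    have "set_integrable lborel ?B' (\<lambda>x. norm (G x) ^ n)"
      by (intro continuous_set_integrable_bounded continuous_intros cG) auto
    from nn_integral_eq_integral[OF this[unfolded set_integrable_def]]
    show ?thesis unfolding In_def Fn_def set_lebesgue_integral_def
      by (simp add: ennreal_mult ennreal_indicator)
  qed
  have I0: "I1 \<ge> 0" "In \<ge> 0" unfolding I1_def In_def set_lebesgue_integral_def by (auto intro!: Bochner_Integration.integral_nonneg)
  \<comment> \<open>Jensen is used twice, for the average over \<open>z\<close> and for the integral
    over \<open>t\<close>. After Fubini \<open>z\<close> and \<open>t\<close> are fixed, and the
    integral over \<open>x\<close> is bounded by a translate of the integral of
    \<open>Fn\<close>.\<close>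
  have near: "(\<integral>\<^sup>+x. indicator ?B x * ennreal (\<bar>g x - A x\<bar> ^ n) \<partial>lborel) \<le> ennreal (\<delta> ^ n * In)"
  proof -
    have 1: "ennreal (\<bar>g x - A x\<bar> ^ n) \<le> (\<integral>\<^sup>+z. \<integral>\<^sup>+t. ennreal (norm z ^ n * norm (G (x + t *\<^sub>R z)) ^ n) \<partial>unit_interval_measure \<partial>U)" for x
    proof -
      have "g x - A x = (LINT z|U. g x - g (x + z))"
        unfolding A_def using int[OF cg, of x] by (simp add: U.prob_space)
      then have "ennreal \<bar>g x - A x\<bar> \<le> (\<integral>\<^sup>+z. ennreal \<bar>g x - g (x + z)\<bar> \<partial>U)"
        using integral_norm_bound_ennreal[of U "\<lambda>z. g x - g (x + z)"] int[OF cg, of x] by simp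
      then have "ennreal \<bar>g x - A x\<bar> ^ n \<le> (\<integral>\<^sup>+z. ennreal \<bar>g x - g (x + z)\<bar> \<partial>U) ^ n"
        by (rule power_mono) simp
      also have "\<dots> \<le> (\<integral>\<^sup>+z. ennreal (\<bar>g x - g (x + z)\<bar> ^ n) \<partial>U)"
        by (rule U.nn_integral_power_le) auto
      also have "\<dots> \<le> (\<integral>\<^sup>+z. \<integral>\<^sup>+t. ennreal (norm z ^ n * norm (G (x + t *\<^sub>R z)) ^ n) \<partial>unit_interval_measure \<partial>U)"
      proof (rule nn_integral_mono)
        fix z
        have "ennreal (\<bar>g x - g (x + z)\<bar>) ^ n \<le> (\<integral>\<^sup>+t. ennreal (norm z * norm (G (x + t *\<^sub>R z))) \<partial>unit_interval_measure) ^ n"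
          using diff_le_nn_integral_gradient[OF dg cG, of x z] by (intro power_mono) (auto simp: abs_minus_commute)
        also have "\<dots> \<le> (\<integral>\<^sup>+t. ennreal ((norm z * norm (G (x + t *\<^sub>R z))) ^ n) \<partial>unit_interval_measure)"
          by (rule T.nn_integral_power_le) auto
        finally show "ennreal (\<bar>g x - g (x + z)\<bar> ^ n) \<le> (\<integral>\<^sup>+t. ennreal (norm z ^ n * norm (G (x + t *\<^sub>R z)) ^ n) \<partial>unit_interval_measure)"
          by (simp add: ennreal_power power_mult_distrib)
      qed
      finally show ?thesis by (simp add: ennreal_power)
    qed
    let ?F = "\<lambda>x z t. i x * ennreal (norm z ^ n * norm (G (x + t *\<^sub>R z)) ^ n)"
    have "(\<integral>\<^sup>+x. indicator ?B x * ennreal (\<bar>g x - A x\<bar> ^ n) \<partial>lborel) \<le>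
        (\<integral>\<^sup>+x. \<integral>\<^sup>+z. \<integral>\<^sup>+t. ?F x z t \<partial>unit_interval_measure \<partial>U \<partial>lborel)"
    proof (rule nn_integral_mono)
      fix x :: 'a
      show "indicator ?B x * ennreal (\<bar>g x - A x\<bar> ^ n) \<le> (\<integral>\<^sup>+z. \<integral>\<^sup>+t. ?F x z t \<partial>unit_interval_measure \<partial>U)"
        using 1[of x] by (cases "x \<in> ?B") (auto simp: i_def)
    qed
    also have "\<dots> = (\<integral>\<^sup>+z. \<integral>\<^sup>+x. \<integral>\<^sup>+t. ?F x z t \<partial>unit_interval_measure \<partial>lborel \<partial>U)"
      by (rule nn_integral_swap) (auto intro: U.sigma_finite_measure_axioms sigma_finite_lborel)
    also have "\<dots> \<le> ennreal (\<delta> ^ n * In)"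
    proof (rule nn_integral_prob_le[OF U.prob_space_axioms])
      show "AE z in U. (\<integral>\<^sup>+x. \<integral>\<^sup>+t. ?F x z t \<partial>unit_interval_measure \<partial>lborel) \<le> ennreal (\<delta> ^ n * In)"
        using AEU
      proof (eventually_elim)
        case (elim z)
        then have z: "norm z < \<delta>" by simp
        have "(\<integral>\<^sup>+x. \<integral>\<^sup>+t. ?F x z t \<partial>unit_interval_measure \<partial>lborel) = (\<integral>\<^sup>+t. \<integral>\<^sup>+x. ?F x z t \<partial>lborel \<partial>unit_interval_measure)"
          by (rule nn_integral_swap) (auto intro: T.sigma_finite_measure_axioms sigma_finite_lborel)
        also have "\<dots> \<le> ennreal (\<delta> ^ n * In)"
        proof (rule nn_integral_prob_le[OF T.prob_space_axioms])
          have "AE t in unit_interval_measure. t \<in> {0..1}" by (rule AE_uniform_measureI) auto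
          then show "AE t in unit_interval_measure. (\<integral>\<^sup>+x. ?F x z t \<partial>lborel) \<le> ennreal (\<delta> ^ n * In)"
          proof eventually_elim
            case (elim t)
            have "norm (t *\<^sub>R z) \<le> norm z" using elim by (auto simp: mult_left_le_one_le)
            then have tz: "norm (t *\<^sub>R z) < \<delta>" using z by linarith
            have "(\<integral>\<^sup>+x. ?F x z t \<partial>lborel) \<le>
                (\<integral>\<^sup>+x. ennreal (\<delta> ^ n) * Fn (x + t *\<^sub>R z) \<partial>lborel)"
            proof (rule nn_integral_mono)
              fix x
              show "?F x z t \<le> ennreal (\<delta> ^ n) * Fn (x + t *\<^sub>R z)"
              proof (cases "x \<in> ?B")
                case True
                have "x + t *\<^sub>R z \<in> ?B'"
                  using True tz norm_triangle_ineq[of "x - a" "t *\<^sub>R z"]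
                  by (simp add: dist_norm norm_minus_commute[of a] algebra_simps)
                moreover have "norm z ^ n \<le> \<delta> ^ n" using z by (intro power_mono) auto
                ultimately show ?thesis using R True unfolding i_def Fn_def
                  by (simp add: ennreal_mult[symmetric]) (intro ennreal_leI mult_right_mono, auto)
              qed (auto simp: i_def)
            qed
            also have "\<dots> = ennreal (\<delta> ^ n) * (\<integral>\<^sup>+x. Fn (x + t *\<^sub>R z) \<partial>lborel)"
              by (rule nn_integral_cmult) measurable
            also have "\<dots> = ennreal (\<delta> ^ n) * ennreal In"
              using nn_integral_lborel_translation[of Fn "t *\<^sub>R z"] eIn by simp
            finally show ?case using I0 R by (simp add: ennreal_mult)
          qed
        qed
        finally show ?case .
      qed
    qed
    finally show ?thesis .
  qed
  \<comment> \<open>Now \<open>t\<close> is fixed and the integral over \<open>z\<close> is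
    innermost: it is a mean, with denominator \<open>V\<close>, of the gradient over a translated
    ball of radius \<delta>, contained in \<open>ball a (R + \<delta>)\<close>.\<close>
  have far: "\<bar>A x - A a\<bar> \<le> R / V * I1" if x: "x \<in> ?B" for x
  proof -
    have "A x - A a = (LINT z|U. g (x + z) - g (a + z))"
      unfolding A_def using int[OF cg, of x] int[OF cg, of a] by simp
    then have "ennreal \<bar>A x - A a\<bar> \<le> (\<integral>\<^sup>+z. ennreal \<bar>g (x + z) - g (a + z)\<bar> \<partial>U)"
      using integral_norm_bound_ennreal[of U "\<lambda>z. g (x + z) - g (a + z)"] int[OF cg, of x] int[OF cg, of a] by simp
    also have "\<dots> \<le> (\<integral>\<^sup>+z. \<integral>\<^sup>+t. ennreal (norm (x - a) * norm (G (a + z + t *\<^sub>R (x - a)))) \<partial>unit_interval_measure \<partial>U)"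
    proof (rule nn_integral_mono)
      fix z
      show "ennreal \<bar>g (x + z) - g (a + z)\<bar> \<le> (\<integral>\<^sup>+t. ennreal (norm (x - a) * norm (G (a + z + t *\<^sub>R (x - a)))) \<partial>unit_interval_measure)"
        using diff_le_nn_integral_gradient[OF dg cG, of "a + z" "x - a"] by (simp add: algebra_simps)
    qed
    also have "\<dots> = (\<integral>\<^sup>+t. \<integral>\<^sup>+z. ennreal (norm (x - a) * norm (G (a + z + t *\<^sub>R (x - a)))) \<partial>U \<partial>unit_interval_measure)"
      by (rule nn_integral_swap) (auto intro: T.sigma_finite_measure_axioms U.sigma_finite_measure_axioms)
    also have "\<dots> \<le> ennreal (R / V * I1)"
    proof (rule nn_integral_prob_le[OF T.prob_space_axioms])
      have "AE t in unit_interval_measure. t \<in> {0..1}" by (rule AE_uniform_measureI) auto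
      then show "AE t in unit_interval_measure. (\<integral>\<^sup>+z. ennreal (norm (x - a) * norm (G (a + z + t *\<^sub>R (x - a)))) \<partial>U) \<le> ennreal (R / V * I1)"
      proof eventually_elim
        case (elim t)
        have xa: "norm (x - a) < R" using x by (simp add: dist_norm norm_minus_commute)
        have "norm (t *\<^sub>R (x - a)) \<le> norm (x - a)" using elim by (auto simp: mult_left_le_one_le)
        then have tz: "norm (t *\<^sub>R (x - a)) < R" using xa by linarith
        let ?s = "a + t *\<^sub>R (x - a)"
        have "(\<integral>\<^sup>+z. ennreal (norm (x - a) * norm (G (a + z + t *\<^sub>R (x - a)))) \<partial>U) =
            (\<integral>\<^sup>+z. ennreal (norm (x - a) * norm (G (z + ?s))) \<partial>U)"
          by (simp add: algebra_simps)
        also have "\<dots> = (\<integral>\<^sup>+z. ennreal (norm (x - a) * norm (G (z + ?s))) * indicator ?N z \<partial>lborel) / ennreal V"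
          unfolding U_def eV[symmetric] by (rule nn_integral_uniform_measure) auto
        also have "(\<integral>\<^sup>+z. ennreal (norm (x - a) * norm (G (z + ?s))) * indicator ?N z \<partial>lborel) \<le>
            (\<integral>\<^sup>+z. ennreal R * F1 (z + ?s) \<partial>lborel)"
        proof (rule nn_integral_mono)
          fix z :: 'a
          show "ennreal (norm (x - a) * norm (G (z + ?s))) * indicator ?N z \<le> ennreal R * F1 (z + ?s)"
          proof (cases "z \<in> ?N")
            case True
            have "norm (z + ?s - a) < R + \<delta>"
              using True tz norm_triangle_ineq[of z "t *\<^sub>R (x - a)"] by simp
            then have "z + ?s \<in> ?B'" by (simp only: mem_ball dist_norm norm_minus_commute[of a])
            then show ?thesis using R True xa unfolding F1_def
              by (simp add: ennreal_mult[symmetric]) (intro ennreal_leI mult_right_mono, auto)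
          qed auto
        qed
        also have "\<dots> = ennreal R * (\<integral>\<^sup>+z. F1 (z + ?s) \<partial>lborel)"
          by (rule nn_integral_cmult) measurable
        also have "\<dots> = ennreal R * ennreal I1"
          using nn_integral_lborel_translation[of F1 ?s] eI1 by simp
        finally show ?case using I0 R V
          by (simp add: ennreal_mult[symmetric] divide_ennreal divide_right_mono_ennreal)
      qed
    qed
    finally show ?thesis using I0 R V by (subst (asm) ennreal_le_iff) auto
  qed
  define W where "W = (R / V * I1) ^ n"
  have W0: "W \<ge> 0" using I0 R V by (simp add: W_def)
  have cA[measurable]: "A \<in> borel_measurable borel" unfolding A_def
    by (rule U.borel_measurable_lebesgue_integral) measurable
  have iB: "set_integrable lborel ?B (\<lambda>x. \<bar>g x - A a\<bar> ^ n)"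
    by (intro continuous_set_integrable_bounded continuous_intros cg) auto
  have e1: "ennreal (LINT x:?B|lborel. \<bar>g x - A a\<bar> ^ n) = (\<integral>\<^sup>+x. indicator ?B x * ennreal (\<bar>g x - A a\<bar> ^ n) \<partial>lborel)"
    using nn_integral_eq_integral[OF iB[unfolded set_integrable_def]]
    unfolding set_lebesgue_integral_def by (simp add: ennreal_mult ennreal_indicator)
  have e2: "(\<integral>\<^sup>+x. indicator ?B x * ennreal (\<bar>g x - A a\<bar> ^ n) \<partial>lborel) \<le> (\<integral>\<^sup>+x. ennreal (2 ^ n) * (indicator ?B x * ennreal (\<bar>g x - A x\<bar> ^ n) + ennreal W * indicator ?B x) \<partial>lborel)"
  proof (rule nn_integral_mono)
    fix x :: 'a
    show "indicator ?B x * ennreal (\<bar>g x - A a\<bar> ^ n) \<le> ennreal (2 ^ n) * (indicator ?B x * ennreal (\<bar>g x - A x\<bar> ^ n) + ennreal W * indicator ?B x)"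
    proof (cases "x \<in> ?B")
      case True
      have "\<bar>g x - A a\<bar> \<le> \<bar>g x - A x\<bar> + R / V * I1"
        using far[OF True] by arith
      then have *: "\<bar>g x - A a\<bar> ^ n \<le> 2 ^ n * (\<bar>g x - A x\<bar> ^ n + W)"
        unfolding W_def using I0 R V by (intro power_le_sum_powers) auto
      have "ennreal (\<bar>g x - A a\<bar> ^ n) \<le> ennreal (2 ^ n * (\<bar>g x - A x\<bar> ^ n + W))"
        using * by (rule ennreal_leI)
      then show ?thesis using True W0 by (simp add: ennreal_mult)
    qed auto
  qed
  have e3: "(\<integral>\<^sup>+x. ennreal (2 ^ n) * (indicator ?B x * ennreal (\<bar>g x - A x\<bar> ^ n) + ennreal W * indicator ?B x) \<partial>lborel) = ennreal (2 ^ n) * ((\<integral>\<^sup>+x. indicator ?B x * ennreal (\<bar>g x - A x\<bar> ^ n) \<partial>lborel) + ennreal W * emeasure lborel ?B)"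
    by (simp add: nn_integral_cmult nn_integral_add nn_integral_cmult_indicator)
  have e4: "ennreal (2 ^ n) * ((\<integral>\<^sup>+x. indicator ?B x * ennreal (\<bar>g x - A x\<bar> ^ n) \<partial>lborel) + ennreal W * emeasure lborel ?B) \<le> ennreal (2 ^ n) * (ennreal (\<delta> ^ n * In) + ennreal W * ennreal (measure lborel ?B))"
    unfolding emeasure_lborel_ball[symmetric] by (rule mult_left_mono[OF add_right_mono[OF near]]) simp
  have e5: "ennreal (2 ^ n) * (ennreal (\<delta> ^ n * In) + ennreal W * ennreal b) = ennreal (2 ^ n * (\<delta> ^ n * In + b * W))"
    if "b \<ge> 0" for b
    using W0 I0 R that by (simp add: ennreal_mult mult.commute[of "ennreal W"])
  have "ennreal (LINT x:?B|lborel. \<bar>g x - A a\<bar> ^ n) \<le> ennreal (2 ^ n * (\<delta> ^ n * In + measure lborel ?B * W))"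
    unfolding e1 e5[symmetric, OF measure_nonneg] by (rule order_trans[OF e2[unfolded e3] e4])
  then have "(LINT x:?B|lborel. \<bar>g x - A a\<bar> ^ n) \<le> 2 ^ n * (\<delta> ^ n * In + measure lborel ?B * W)"
    using W0 I0 R by (subst (asm) ennreal_le_iff) auto
  then show ?thesis unfolding W_def V_def I1_def In_def by blast
qed


section \<open>Mollification\<close>

text \<open>For \<open>m = 0\<close> this is the classical smooth function that is flat at 0. The
  denominators \<open>t ^ m\<close> are carried along because they make the span of the family
  closed under differentiation.\<close>

definition flat_exp :: "nat \<Rightarrow> real \<Rightarrow> real" where
  "flat_exp m t = (if t > 0 then exp (- 1 / t) / t ^ m else 0)"

lemma flat_exp_nonneg: "0 \<le> flat_exp m t" by (simp add: flat_exp_def)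

lemma tendsto_flat_exp_0: "(flat_exp m \<longlongrightarrow> 0) (at 0)"
proof -
  have "((\<lambda>t::real. inverse t ^ m / exp (inverse t)) \<longlongrightarrow> 0) (at_right 0)"
    by (rule filterlim_compose[OF tendsto_power_div_exp_0 filterlim_inverse_at_top_right])
  moreover have "\<forall>\<^sub>F t in at_right 0. inverse t ^ m / exp (inverse t) = flat_exp m t"
    using eventually_at_right_less[of 0]
    by eventually_elim (simp add: flat_exp_def exp_minus divide_inverse power_inverse)
  ultimately have "(flat_exp m \<longlongrightarrow> 0) (at_right 0)" by (rule Lim_transform_eventually)
  moreover have "(flat_exp m \<longlongrightarrow> 0) (at_left 0)"
    by (rule Lim_transform_eventually[OF tendsto_const])
       (auto simp: eventually_at_filter flat_exp_def)
  ultimately show ?thesis using filterlim_split_at by blast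
qed

lemma flat_exp_has_real_derivative:
  "(flat_exp m has_real_derivative flat_exp (m + 2) t - real m * flat_exp (m + 1) t) (at t)"
proof -
  consider "t > 0" | "t < 0" | "t = 0" by linarith
  then show ?thesis
  proof cases
    case 1
    have "((\<lambda>t. exp (- 1 / t) / t ^ m) has_real_derivative
        (exp (- 1 / t) * (1 / t\<^sup>2) * t ^ m - exp (- 1 / t) * (real m * t ^ (m - 1))) / (t ^ m * t ^ m)) (at t)"
      using 1 by (auto intro!: derivative_eq_intros simp: power2_eq_square)
    moreover have "(exp (- 1 / t) * (1 / t\<^sup>2) * t ^ m - exp (- 1 / t) * (real m * t ^ (m - 1))) / (t ^ m * t ^ m)
        = flat_exp (m + 2) t - real m * flat_exp (m + 1) t"
      using 1 by (cases m) (auto simp: flat_exp_def field_simps power2_eq_square power_add)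
    ultimately have "((\<lambda>t. exp (- 1 / t) / t ^ m) has_real_derivative flat_exp (m + 2) t - real m * flat_exp (m + 1) t) (at t)"
      by simp
    then show ?thesis
      by (rule has_field_derivative_transform_within_open[of _ _ _ "{0<..}"]) (use 1 in \<open>auto simp: flat_exp_def\<close>)
  next
    case 2
    have "((\<lambda>t::real. 0) has_real_derivative flat_exp (m + 2) t - real m * flat_exp (m + 1) t) (at t)"
      using 2 by (simp add: flat_exp_def)
    then show ?thesis
      by (rule has_field_derivative_transform_within_open[of _ _ _ "{..<0}"]) (use 2 in \<open>auto simp: flat_exp_def\<close>)
  next
    case 3
    have "(\<lambda>h. (flat_exp m (0 + h) - flat_exp m 0) / h) = flat_exp (m + 1)"
      by (auto simp: fun_eq_iff flat_exp_def)
    then have "(flat_exp m has_real_derivative 0) (at 0)"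
      using tendsto_flat_exp_0[of "m + 1"] by (simp add: DERIV_def)
    with 3 show ?thesis by (simp add: flat_exp_def)
  qed
qed

text \<open>Since this class is closed under directional derivatives, its members satisfy \<open>Ck k\<close> for all \<open>k\<close>.\<close>

inductive bump_class :: "real \<Rightarrow> 'a::euclidean_space \<Rightarrow> ('a \<Rightarrow> real) \<Rightarrow> bool" for r a where
  base: "bump_class r a (\<lambda>x. flat_exp m (r\<^sup>2 - (x - a) \<bullet> (x - a)))"
| linear: "bump_class r a f \<Longrightarrow> bump_class r a (\<lambda>x. ((x - a) \<bullet> b) * f x)"
| add: "bump_class r a f \<Longrightarrow> bump_class r a g \<Longrightarrow> bump_class r a (\<lambda>x. f x + g x)"
| scale: "bump_class r a f \<Longrightarrow> bump_class r a (\<lambda>x. c * f x)"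

lemma bump_class_support: "bump_class r a f \<Longrightarrow> 0 \<le> r \<Longrightarrow> norm (x - a) \<ge> r \<Longrightarrow> f x = 0"
proof (induction rule: bump_class.induct)
  case (base m)
  have "r\<^sup>2 \<le> (x - a) \<bullet> (x - a)" using base by (simp add: power2_norm_eq_inner[symmetric] power_mono)
  then show ?case by (simp add: flat_exp_def)
qed auto

lemma flat_exp_ball_has_derivative:
  "((\<lambda>x::'a::euclidean_space. flat_exp m (s - (x - a) \<bullet> (x - a))) has_derivative
     (\<lambda>v. (- 2 * ((x - a) \<bullet> v)) * (flat_exp (m + 2) (s - (x - a) \<bullet> (x - a)) - real m * flat_exp (m + 1) (s - (x - a) \<bullet> (x - a))))) (at x)"
proof -
  have "((\<lambda>x. s - (x - a) \<bullet> (x - a)) has_derivative (\<lambda>v. - 2 * ((x - a) \<bullet> v))) (at x)"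
    by (auto intro!: derivative_eq_intros simp: fun_eq_iff inner_commute)
  from has_derivative_compose[OF this flat_exp_has_real_derivative[of m, unfolded has_field_derivative_def]]
  show ?thesis by (rule has_derivative_eq_rhs) (auto simp: fun_eq_iff)
qed

lemma bump_class_derivative:
  "bump_class r a f \<Longrightarrow> \<exists>f'. (\<forall>x. (f has_derivative f' x) (at x)) \<and> (\<forall>b. bump_class r a (\<lambda>x. f' x b))"
proof (induction rule: bump_class.induct)
  case (base m)
  let ?q = "\<lambda>x. r\<^sup>2 - (x - a) \<bullet> (x - a)"
  show ?case
  proof (intro exI conjI allI)
    show "((\<lambda>x. flat_exp m (?q x)) has_derivative
      (\<lambda>v. (- 2 * ((x - a) \<bullet> v)) * (flat_exp (m + 2) (?q x) - real m * flat_exp (m + 1) (?q x)))) (at x)" for x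
      by (rule flat_exp_ball_has_derivative)
    have "bump_class r a (\<lambda>x. ((x - a) \<bullet> b) * ((- 2) * flat_exp (m + 2) (?q x) + (2 * real m) * flat_exp (m + 1) (?q x)))" for b
      by (intro bump_class.intros)
    then show "bump_class r a (\<lambda>x. - 2 * ((x - a) \<bullet> b) * (flat_exp (m + 2) (?q x) - real m * flat_exp (m + 1) (?q x)))" for b
      by (simp add: algebra_simps)
  qed
next
  case (linear f b)
  then obtain f' where d: "\<And>x. (f has_derivative f' x) (at x)" and c: "\<And>b. bump_class r a (\<lambda>x. f' x b)" by blast
  show ?case
  proof (intro exI conjI allI)
    show "((\<lambda>x. ((x - a) \<bullet> b) * f x) has_derivative (\<lambda>v. (b \<bullet> v) * f x + ((x - a) \<bullet> b) * f' x v)) (at x)" for x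
      by (auto intro!: derivative_eq_intros d simp: fun_eq_iff inner_commute)
    show "bump_class r a (\<lambda>x. (b \<bullet> v) * f x + ((x - a) \<bullet> b) * f' x v)" for v
      by (intro bump_class.intros linear.hyps c)
  qed
next
  case (add f g)
  then obtain f' g' where d: "\<And>x. (f has_derivative f' x) (at x)" "\<And>x. (g has_derivative g' x) (at x)"
    and c: "\<And>b. bump_class r a (\<lambda>x. f' x b)" "\<And>b. bump_class r a (\<lambda>x. g' x b)" by blast
  show ?case
    by (intro exI[of _ "\<lambda>x v. f' x v + g' x v"] conjI allI has_derivative_add d bump_class.add c)
next
  case (scale f c)
  then obtain f' where d: "\<And>x. (f has_derivative f' x) (at x)" and c: "\<And>b. bump_class r a (\<lambda>x. f' x b)" by blast
  show ?case
    by (intro exI[of _ "\<lambda>x v. c * f' x v"] conjI allI has_derivative_mult_right d bump_class.scale c)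
qed

lemma bump_class_Ck: "bump_class r a f \<Longrightarrow> Ck k f"
proof (induction k arbitrary: f)
  case 0
  obtain f' where "\<And>x. (f has_derivative f' x) (at x)" using bump_class_derivative[OF 0] by blast
  then show ?case using has_derivative_continuous continuous_at_imp_continuous_on by (metis Ck.simps(1))
next
  case (Suc k)
  obtain f' where d: "\<And>x. (f has_derivative f' x) (at x)" and c: "\<And>b. bump_class r a (\<lambda>x. f' x b)"
    using bump_class_derivative[OF Suc.prems] by blast
  have "frechet_derivative f (at x) = f' x" for x using frechet_derivative_at[OF d] by simp
  then show ?case using Suc.IH[OF c] d by (auto simp: differentiable_def)
qed

lemma bump_class_test_fun:
  fixes a :: "'a::euclidean_space"
  assumes "bump_class r a f" "0 \<le> r" "cball a r \<subseteq> U"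
  shows "test_fun U f"
proof -
  have "closure {x. f x \<noteq> 0} \<subseteq> cball a r"
  proof (rule closure_minimal)
    show "{x. f x \<noteq> 0} \<subseteq> cball a r"
      using bump_class_support[OF assms(1,2)] by (force simp: dist_norm norm_minus_commute)
  qed simp
  moreover from this have "compact (closure {x. f x \<noteq> 0})"
    by (meson bounded_cball bounded_subset closed_closure compact_eq_bounded_closed)
  ultimately show ?thesis
    using assms bump_class_Ck unfolding test_fun_def by blast
qed

section \<open>Convolution with a compactly supported kernel\<close>

definition conv :: "('a::euclidean_space \<Rightarrow> real) \<Rightarrow> ('a \<Rightarrow> real) \<Rightarrow> 'a \<Rightarrow> real" where
  "conv k f x = (LINT y|lborel. k (x - y) * f y)"

lemma compact_support_uniformly_continuous:
  fixes k :: "'a::euclidean_space \<Rightarrow> 'b::real_normed_vector"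
  assumes ck: "continuous_on UNIV k" and supp: "\<And>x. norm x \<ge> \<rho> \<Longrightarrow> k x = 0" and e: "e > 0"
  obtains d where "d > 0" "\<And>x y. dist x y < d \<Longrightarrow> dist (k x) (k y) < e"
proof -
  have "uniformly_continuous_on (cball 0 (\<rho> + 1)) k"
    by (intro compact_uniformly_continuous continuous_on_subset[OF ck]) auto
  then obtain d where d: "d > 0"
    "\<And>x y. x \<in> cball 0 (\<rho> + 1) \<Longrightarrow> y \<in> cball 0 (\<rho> + 1) \<Longrightarrow> dist y x < d \<Longrightarrow> dist (k y) (k x) < e"
    by (rule uniformly_continuous_onE[OF _ e]) blast
  have "dist (k x) (k y) < e" if "dist x y < min d 1" for x y
  proof (cases "norm x \<le> \<rho> + 1 \<and> norm y \<le> \<rho> + 1")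
    case True
    then show ?thesis using d(2)[of y x] that by simp
  next
    case False
    have "\<bar>norm x - norm y\<bar> < 1" using that norm_triangle_ineq3[of x y] by (simp add: dist_norm)
    then have "norm x \<ge> \<rho>" "norm y \<ge> \<rho>" using False by linarith+
    then show ?thesis using supp e by simp
  qed
  then show ?thesis using that[of "min d 1"] d(1) by simp
qed

lemma conv_integrable:
  fixes k :: "'a::euclidean_space \<Rightarrow> real"
  assumes ck: "continuous_on UNIV k" and supp: "\<And>x. norm x \<ge> \<rho> \<Longrightarrow> k x = 0" and f: "integrable lborel f"
  shows "integrable lborel (\<lambda>y. k (x - y) * f y)"
proof -
  obtain B where B: "B > 0" "\<And>x. \<bar>k x\<bar> \<le> B" using compact_support_bounded[OF ck supp] by blast
  have [measurable]: "k \<in> borel_measurable borel" using ck by (rule borel_measurable_continuous_onI)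
  show ?thesis
    by (rule Bochner_Integration.integrable_bound[of lborel "\<lambda>y. B * f y"])
       (use f B in \<open>auto simp: abs_mult intro!: mult_mono\<close>)
qed

lemma conv_continuous:
  assumes ck: "continuous_on UNIV k" and supp: "\<And>x. norm x \<ge> \<rho> \<Longrightarrow> k x = 0" and f: "integrable lborel f"
  shows "continuous_on UNIV (conv k f)"
proof -
  define I where "I = (LINT y|lborel. \<bar>f y\<bar>)"
  have I0: "I \<ge> 0" unfolding I_def by (rule Bochner_Integration.integral_nonneg) simp
  have "\<exists>d>0. \<forall>x'. dist x' x < d \<longrightarrow> dist (conv k f x') (conv k f x) < e" if e: "e > 0" for x e
  proof -
    have "e / (I + 1) > 0" using e I0 by simp
    then obtain d where d: "d > 0" "\<And>x y. dist x y < d \<Longrightarrow> dist (k x) (k y) < e / (I + 1)"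
      using compact_support_uniformly_continuous[OF ck supp] by blast
    have "dist (conv k f x') (conv k f x) < e" if "dist x' x < d" for x'
    proof -
      have "conv k f x' - conv k f x = (LINT y|lborel. (k (x' - y) - k (x - y)) * f y)"
        unfolding conv_def using conv_integrable[OF ck supp f]
        by (subst Bochner_Integration.integral_diff[symmetric]) (auto simp: left_diff_distrib)
      also have "\<bar>\<dots>\<bar> \<le> (LINT y|lborel. \<bar>(k (x' - y) - k (x - y)) * f y\<bar>)"
        by (rule integral_abs_bound)
      also have "\<dots> \<le> (LINT y|lborel. e / (I + 1) * \<bar>f y\<bar>)"
      proof (rule integral_mono)
        show "integrable lborel (\<lambda>y. \<bar>(k (x' - y) - k (x - y)) * f y\<bar>)"
          unfolding left_diff_distrib using conv_integrable[OF ck supp f] by (intro integrable_abs Bochner_Integration.integrable_diff) auto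
        show "integrable lborel (\<lambda>y. e / (I + 1) * \<bar>f y\<bar>)" using f by simp
        show "\<bar>(k (x' - y) - k (x - y)) * f y\<bar> \<le> e / (I + 1) * \<bar>f y\<bar>" for y
          unfolding abs_mult using d(2)[of "x' - y" "x - y"] that
          by (intro mult_right_mono) (auto simp: dist_norm)
      qed
      also have "\<dots> = e * (I / (I + 1))" unfolding I_def by simp
      also have "\<dots> < e * 1" using e I0 by (intro mult_strict_left_mono) auto
      finally show ?thesis by (simp add: dist_norm)
    qed
    with d(1) show ?thesis by blast
  qed
  then show ?thesis by (auto simp: continuous_on_iff)
qed

text \<open>Differentiation under the integral for a merely integrable \<open>f\<close>: uniform
  continuity of the gradient of the kernel bounds its linearisation error uniformly in
  \<open>y\<close>. The tolerance \<open>e / (I + 1)\<close> is well defined even if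
  \<open>f\<close> vanishes almost everywhere.\<close>

lemma conv_has_derivative:
  fixes k :: "'a::euclidean_space \<Rightarrow> real"
  assumes dk: "\<And>x. (k has_derivative (\<lambda>v. gk x \<bullet> v)) (at x)" and cg: "continuous_on UNIV gk"
    and supp: "\<And>x. norm x \<ge> \<rho> \<Longrightarrow> k x = 0" "\<And>x. norm x \<ge> \<rho> \<Longrightarrow> gk x = 0" and f: "integrable lborel f"
  shows "(conv k f has_derivative (\<lambda>v. (\<Sum>b\<in>Basis. conv (\<lambda>z. gk z \<bullet> b) f x *\<^sub>R b) \<bullet> v)) (at x)"
proof -
  define I where "I = (LINT y|lborel. \<bar>f y\<bar>)"
  have I0: "I \<ge> 0" unfolding I_def by (rule Bochner_Integration.integral_nonneg) simp
  have ck: "continuous_on UNIV k"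
    by (rule has_derivative_everywhere_continuous[OF dk])
  have ci: "integrable lborel (\<lambda>y. (gk (x - y) \<bullet> v) * f y)" for v x
    by (rule conv_integrable[of "\<lambda>z. gk z \<bullet> v" \<rho> f x]) (auto intro!: continuous_intros cg f simp: supp)
  have lin: "(\<Sum>b\<in>Basis. conv (\<lambda>z. gk z \<bullet> b) f x *\<^sub>R b) \<bullet> v = (LINT y|lborel. (gk (x - y) \<bullet> v) * f y)" for v
  proof -
    have "(LINT y|lborel. (gk (x - y) \<bullet> v) * f y) = (LINT y|lborel. (\<Sum>b\<in>Basis. (v \<bullet> b) * ((gk (x - y) \<bullet> b) * f y)))"
      by (subst euclidean_inner) (simp add: sum_distrib_right sum_distrib_left mult.commute mult.left_commute)
    also have "\<dots> = (\<Sum>b\<in>Basis. (v \<bullet> b) * conv (\<lambda>z. gk z \<bullet> b) f x)"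
      unfolding conv_def using ci by (subst Bochner_Integration.integral_sum) auto
    finally show ?thesis by (simp add: inner_sum_right inner_commute[of _ v] mult.commute)
  qed
  have "\<exists>d>0. \<forall>x'. norm (x' - x) < d \<longrightarrow> norm (conv k f x' - conv k f x -
      (\<Sum>b\<in>Basis. conv (\<lambda>z. gk z \<bullet> b) f x *\<^sub>R b) \<bullet> (x' - x)) \<le> e * norm (x' - x)" if e: "e > 0" for e
  proof -
    have "e / (I + 1) > 0" using e I0 by simp
    then obtain d where d: "d > 0" "\<And>x y. dist x y < d \<Longrightarrow> dist (gk x) (gk y) < e / (I + 1)"
      using compact_support_uniformly_continuous[OF cg supp(2)] by blast
    have "norm (conv k f x' - conv k f x - (\<Sum>b\<in>Basis. conv (\<lambda>z. gk z \<bullet> b) f x *\<^sub>R b) \<bullet> (x' - x)) \<le> e * norm (x' - x)"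
      if x': "norm (x' - x) < d" for x'
    proof -
      let ?r = "\<lambda>y. k (x' - y) - k (x - y) - gk (x - y) \<bullet> (x' - x)"
      have r: "\<bar>?r y\<bar> \<le> norm (x' - x) * (e / (I + 1))" for y
      proof -
        have "norm (k (x' - y) - k (x - y) - gk (x - y) \<bullet> ((x' - y) - (x - y))) \<le> norm ((x' - y) - (x - y)) * (e / (I + 1))"
        proof (rule differentiable_bound_linearization[where S = "ball (x - y) d" and f = k and f' = "\<lambda>z. (\<bullet>) (gk z)"])
          show "x - y + t *\<^sub>R (x' - y - (x - y)) \<in> ball (x - y) d" if "t \<in> {0..1}" for t
            using x' that mult_left_le_one_le[of "norm (x' - x)" t] by (auto simp: dist_norm)
          show "(k has_derivative (\<lambda>v. gk z \<bullet> v)) (at z within ball (x - y) d)" for z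
            by (rule has_derivative_at_withinI[OF dk])
          show "onorm ((\<bullet>) (gk z) - (\<bullet>) (gk (x - y))) \<le> e / (I + 1)" if "z \<in> ball (x - y) d" for z
          proof (rule onorm_bound)
            show "norm (((\<bullet>) (gk z) - (\<bullet>) (gk (x - y))) v) \<le> e / (I + 1) * norm v" for v
              using d(2)[of z "x - y"] that Cauchy_Schwarz_ineq2[of "gk z - gk (x - y)" v]
                mult_right_mono[of "norm (gk z - gk (x - y))" "e / (I + 1)" "norm v"]
              by (simp add: inner_diff_left[symmetric] dist_norm norm_minus_commute del: times_divide_eq_left)
          qed (use e I0 in auto)
          show "x - y \<in> ball (x - y) d" using d(1) by simp
        qed
        then show ?thesis by simp
      qed
      have i1: "integrable lborel (\<lambda>y. ?r y * f y)"
        unfolding left_diff_distrib by (intro Bochner_Integration.integrable_diff conv_integrable[OF ck supp(1) f] ci)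
      have "conv k f x' - conv k f x - (\<Sum>b\<in>Basis. conv (\<lambda>z. gk z \<bullet> b) f x *\<^sub>R b) \<bullet> (x' - x) =
          (LINT y|lborel. ?r y * f y)"
        unfolding lin unfolding conv_def left_diff_distrib using conv_integrable[OF ck supp(1) f] ci
        by (subst Bochner_Integration.integral_diff, auto)+
      also have "\<bar>\<dots>\<bar> \<le> (LINT y|lborel. \<bar>?r y * f y\<bar>)" by (rule integral_abs_bound)
      also have "\<dots> \<le> (LINT y|lborel. norm (x' - x) * (e / (I + 1)) * \<bar>f y\<bar>)"
      proof (rule integral_mono)
        show "integrable lborel (\<lambda>y. \<bar>?r y * f y\<bar>)" using i1 by (rule integrable_abs)
        show "integrable lborel (\<lambda>y. norm (x' - x) * (e / (I + 1)) * \<bar>f y\<bar>)"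
          by (intro integrable_mult_right integrable_abs f)
        show "\<bar>?r y * f y\<bar> \<le> norm (x' - x) * (e / (I + 1)) * \<bar>f y\<bar>" for y
          unfolding abs_mult using r by (intro mult_right_mono) auto
      qed
      also have "\<dots> = (norm (x' - x) * e) * (I / (I + 1))" unfolding I_def by simp
      also have "\<dots> \<le> (norm (x' - x) * e) * 1" using e I0 by (intro mult_left_mono) auto
      finally show ?thesis by (simp add: mult.commute)
    qed
    with d(1) show ?thesis by blast
  qed
  then show ?thesis
    unfolding has_derivative_at_alt by (auto intro: bounded_linear_inner_right)
qed

section \<open>The standard mollifier and approximation in the mean\<close>

lemma ball_pos_measure_integral_pos:
  fixes h :: "'a::euclidean_space \<Rightarrow> real"
  assumes "integrable lborel h" "\<And>x. 0 \<le> h x" "\<And>x. x \<in> ball a r \<Longrightarrow> 0 < h x" "0 < r"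
  shows "0 < (LINT x|lborel. h x)"
proof (rule ccontr)
  assume "\<not> ?thesis"
  moreover have "0 \<le> (LINT x|lborel. h x)" using assms(2) by (intro Bochner_Integration.integral_nonneg) auto
  ultimately have "(LINT x|lborel. h x) = 0" by simp
  then have "AE x in lborel. h x = 0" using integral_nonneg_eq_0_iff_AE[OF assms(1)] assms(2) by simp
  then have "AE x in lborel. x \<notin> ball a r" by eventually_elim (use assms(3) in force)
  then have "emeasure lborel (ball a r) = 0"
    by (subst (asm) AE_iff_null_sets[symmetric]) auto
  then show False using content_ball_pos[OF assms(4), of a] by (simp add: measure_def)
qed

text \<open>Each radius is normalised by its own integral instead of scaling one fixed function. The
  approximation argument uses only continuity, sign, support, evenness and total mass 1.\<close>

definition mollifier :: "real \<Rightarrow> 'a::euclidean_space \<Rightarrow> real" where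
  "mollifier r x = flat_exp 0 (r\<^sup>2 - x \<bullet> x) / (LINT z|lborel. flat_exp 0 (r\<^sup>2 - (z::'a) \<bullet> z))"

lemma flat_exp_continuous: "continuous_on UNIV (flat_exp m)"
  using flat_exp_has_real_derivative by (meson DERIV_isCont continuous_at_imp_continuous_on)

lemma flat_exp_ball_continuous:
  "continuous_on UNIV (\<lambda>x::'a::euclidean_space. flat_exp m (s - x \<bullet> x))"
  by (intro continuous_on_compose2[OF flat_exp_continuous] continuous_intros) auto

lemma flat_exp_ball_support:
  "0 \<le> r \<Longrightarrow> norm (x::'a::euclidean_space) \<ge> r \<Longrightarrow> flat_exp m (r\<^sup>2 - x \<bullet> x) = 0"
  using bump_class_support[OF bump_class.base[of r 0 m], of x] by simp

lemma mollifier_integral_pos: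
  assumes "0 < r"
  shows "0 < (LINT z|lborel. flat_exp 0 (r\<^sup>2 - (z::'a::euclidean_space) \<bullet> z))"
proof (rule ball_pos_measure_integral_pos[where a = 0 and r = r])
  show "integrable lborel (\<lambda>z::'a. flat_exp 0 (r\<^sup>2 - z \<bullet> z))"
    by (rule compact_support_integrable[OF flat_exp_ball_continuous flat_exp_ball_support]) (use assms in auto)
  fix x :: 'a assume "x \<in> ball 0 r"
  then have "x \<bullet> x < r\<^sup>2" by (simp add: power2_norm_eq_inner[symmetric] power_strict_mono)
  then show "0 < flat_exp 0 (r\<^sup>2 - x \<bullet> x)" by (simp add: flat_exp_def)
qed (use assms flat_exp_nonneg in auto)

lemma mollifier:
  assumes "0 < r"
  shows mollifier_nonneg: "0 \<le> mollifier r x"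
    and mollifier_support: "norm x \<ge> r \<Longrightarrow> mollifier r x = 0"
    and mollifier_continuous: "continuous_on UNIV (mollifier r :: 'a::euclidean_space \<Rightarrow> real)"
    and mollifier_even: "mollifier r (- x) = mollifier r x"
    and mollifier_integral: "(LINT x|lborel. mollifier r (x::'a)) = 1"
    and mollifier_integrable: "integrable lborel (mollifier r :: 'a \<Rightarrow> real)"
proof -
  let ?I = "LINT z|lborel. flat_exp 0 (r\<^sup>2 - (z::'a) \<bullet> z)"
  have I: "?I > 0" using mollifier_integral_pos[OF assms] .
  show "0 \<le> mollifier r x" unfolding mollifier_def
    using flat_exp_nonneg by (intro divide_nonneg_nonneg Bochner_Integration.integral_nonneg) auto
  show "mollifier r x = 0" if "norm x \<ge> r" for x
    using flat_exp_ball_support[of r x 0] assms that by (simp add: mollifier_def)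
  then have s: "mollifier r x = 0" if "norm x \<ge> r" for x :: 'a using that by blast
  show c: "continuous_on UNIV (mollifier r :: 'a \<Rightarrow> real)"
    unfolding mollifier_def[abs_def] using I
    by (intro continuous_on_divide flat_exp_ball_continuous continuous_on_const) auto
  show "mollifier r (- x) = mollifier r x" by (simp add: mollifier_def)
  show "(LINT x|lborel. mollifier r (x::'a)) = 1" using I by (simp add: mollifier_def)
  show "integrable lborel (mollifier r :: 'a \<Rightarrow> real)" by (rule compact_support_integrable[OF c s])
qed

lemma mollifier_shift_integral:
  fixes x :: "'a::euclidean_space"
  assumes "0 < r"
  shows "(\<integral>\<^sup>+y. ennreal (mollifier r (x - y)) \<partial>lborel) = 1" "(\<integral>\<^sup>+y. ennreal (mollifier r (y - x)) \<partial>lborel) = 1"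
proof -
  have m: "(mollifier r :: 'a \<Rightarrow> real) \<in> borel_measurable borel"
    using mollifier_continuous[OF assms] by (rule borel_measurable_continuous_onI)
  have "(\<integral>\<^sup>+y. ennreal (mollifier r (y + - x)) \<partial>lborel) = (\<integral>\<^sup>+y. ennreal (mollifier r (y::'a)) \<partial>lborel)"
    by (rule nn_integral_lborel_translation) (use m in measurable)
  also have "\<dots> = 1"
    using nn_integral_eq_integral[OF mollifier_integrable[OF assms]] mollifier_nonneg[OF assms]
      mollifier_integral[OF assms] by (metis (mono_tags, lifting) AE_I2 ennreal_1)
  finally show *: "(\<integral>\<^sup>+y. ennreal (mollifier r (y - x)) \<partial>lborel) = 1" by simp
  have "mollifier r (x - y) = mollifier r (y - x)" for y
    using mollifier_even[OF assms, of "y - x"] by simp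
  with * show "(\<integral>\<^sup>+y. ennreal (mollifier r (x - y)) \<partial>lborel) = 1" by simp
qed

text \<open>Mollification averages \<open>w\<close> with respect to the probability density
  \<open>mollifier r (x - y)\<close>. Jensen bounds the power of the average by the average of the
  power, and after Fubini the kernel integrates to 1 in \<open>x\<close> as well.\<close>

lemma conv_mollifier_power_le:
  fixes w :: "'a::euclidean_space \<Rightarrow> real"
  assumes r: "0 < r" and w: "integrable lborel w"
  shows "(\<integral>\<^sup>+x. ennreal (\<bar>conv (mollifier r) w x\<bar> ^ n) \<partial>lborel) \<le> (\<integral>\<^sup>+x. ennreal (\<bar>w x\<bar> ^ n) \<partial>lborel)"
proof -
  have [measurable]: "(mollifier r :: 'a \<Rightarrow> real) \<in> borel_measurable borel"
    using mollifier_continuous[OF r] by (rule borel_measurable_continuous_onI)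
  have [measurable]: "w \<in> borel_measurable borel" using w by (simp add: borel_measurable_integrable[of lborel, simplified])
  have "ennreal (\<bar>conv (mollifier r) w x\<bar> ^ n) \<le> (\<integral>\<^sup>+y. ennreal (mollifier r (x - y)) * ennreal (\<bar>w y\<bar> ^ n) \<partial>lborel)" for x
  proof -
    define M where "M = density lborel (\<lambda>y. ennreal (mollifier r (x - y)))"
    interpret M: prob_space M unfolding M_def
      by (rule prob_spaceI) (simp add: emeasure_density mollifier_shift_integral[OF r])
    have "ennreal \<bar>conv (mollifier r) w x\<bar> \<le> (\<integral>\<^sup>+y. ennreal (norm (mollifier r (x - y) * w y)) \<partial>lborel)"
      unfolding conv_def using integral_norm_bound_ennreal[OF conv_integrable[OF mollifier_continuous[OF r] mollifier_support[OF r] w]]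
      by simp
    also have "\<dots> = (\<integral>\<^sup>+y. ennreal \<bar>w y\<bar> \<partial>M)"
      unfolding M_def by (subst nn_integral_density) (auto simp: abs_mult mollifier_nonneg[OF r] ennreal_mult)
    finally have "ennreal \<bar>conv (mollifier r) w x\<bar> ^ n \<le> (\<integral>\<^sup>+y. ennreal \<bar>w y\<bar> \<partial>M) ^ n"
      by (rule power_mono) simp
    also have "\<dots> \<le> (\<integral>\<^sup>+y. ennreal (\<bar>w y\<bar> ^ n) \<partial>M)"
      by (rule M.nn_integral_power_le) (auto simp: M_def)
    also have "\<dots> = (\<integral>\<^sup>+y. ennreal (mollifier r (x - y)) * ennreal (\<bar>w y\<bar> ^ n) \<partial>lborel)"
      unfolding M_def by (rule nn_integral_density) auto
    finally show ?thesis by (simp add: ennreal_power)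
  qed
  then have "(\<integral>\<^sup>+x. ennreal (\<bar>conv (mollifier r) w x\<bar> ^ n) \<partial>lborel) \<le>
      (\<integral>\<^sup>+x. \<integral>\<^sup>+y. ennreal (mollifier r (x - y)) * ennreal (\<bar>w y\<bar> ^ n) \<partial>lborel \<partial>lborel)"
    by (rule nn_integral_mono)
  also have "\<dots> = (\<integral>\<^sup>+y. \<integral>\<^sup>+x. ennreal (mollifier r (x - y)) * ennreal (\<bar>w y\<bar> ^ n) \<partial>lborel \<partial>lborel)"
    by (rule nn_integral_swap) (auto intro: sigma_finite_lborel)
  also have "\<dots> = (\<integral>\<^sup>+y. ennreal (\<bar>w y\<bar> ^ n) \<partial>lborel)"
    by (subst nn_integral_multc) (auto simp: mollifier_shift_integral[OF r])
  finally show ?thesis .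
qed

text \<open>\<open>w\<close> is clipped at height \<open>m\<close>, and continuous functions
  converging to the clipped function almost everywhere are clipped at the same height. Both limits
  follow by dominated convergence, with majorant \<open>\<bar>w x\<bar> ^ n\<close> in the first and
  the constant \<open>(2 * real m) ^ n\<close> in the second.\<close>

lemma continuous_approximation_power:
  fixes w :: "'a::euclidean_space \<Rightarrow> real"
  assumes w[measurable]: "w \<in> borel_measurable borel" and n: "0 < n"
    and fin: "integrable lborel (\<lambda>x. indicator (cball a R) x * \<bar>w x\<bar> ^ n)" and e: "0 < e"
  shows "\<exists>v. continuous_on UNIV v \<and> (\<integral>\<^sup>+x\<in>cball a R. ennreal (\<bar>w x - v x\<bar> ^ n) \<partial>lborel) < ennreal e"
proof -
  let ?S = "cball a R"
  have [measurable]: "?S \<in> sets borel" by simp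
  define cl where "cl m y = max (- m) (min m y)" for m y :: real
  have clb: "\<bar>cl m y\<bar> \<le> m" if "m \<ge> 0" for m y using that by (auto simp: cl_def)
  have [measurable]: "cl m \<in> borel_measurable borel" for m unfolding cl_def by measurable
  \<comment> \<open>Two errors of this size are added by \<open>power_le_sum_powers\<close>, at the
    price of the factor \<open>2 ^ n\<close>.\<close>
  have e': "0 < e / 2 ^ n / 2" using e by simp
  have "(\<lambda>m. LINT x|lborel. indicator ?S x * \<bar>w x - cl (real m) (w x)\<bar> ^ n) \<longlonglongrightarrow> (LINT x|(lborel :: 'a measure). (0::real))"
  proof (rule integral_dominated_convergence[where w = "\<lambda>x. indicator ?S x * \<bar>w x\<bar> ^ n"])
    show "integrable lborel (\<lambda>x. indicator ?S x * \<bar>w x\<bar> ^ n)" by (rule fin)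
    show "AE x in lborel. (\<lambda>m. indicator ?S x * \<bar>w x - cl (real m) (w x)\<bar> ^ n) \<longlonglongrightarrow> 0"
    proof (rule AE_I2)
      fix x
      obtain M where M: "\<bar>w x\<bar> \<le> real M" using real_arch_simple by blast
      have "\<forall>\<^sub>F m in sequentially. indicator ?S x * \<bar>w x - cl (real m) (w x)\<bar> ^ n = 0"
        using eventually_ge_at_top[of M]
      proof eventually_elim
        case (elim m)
        then have "\<bar>w x\<bar> \<le> real m" using M by linarith
        then have "cl (real m) (w x) = w x" unfolding cl_def by linarith
        then show ?case using n by simp
      qed
      then show "(\<lambda>m. indicator ?S x * \<bar>w x - cl (real m) (w x)\<bar> ^ n) \<longlonglongrightarrow> 0" by (rule tendsto_eventually)
    qed
    show "AE x in lborel. norm (indicator ?S x * \<bar>w x - cl (real m) (w x)\<bar> ^ n) \<le> indicator ?S x * \<bar>w x\<bar> ^ n" for m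
    proof (rule AE_I2)
      fix x
      have "\<bar>w x - cl (real m) (w x)\<bar> \<le> \<bar>w x\<bar>" unfolding cl_def by linarith
      then have "\<bar>w x - cl (real m) (w x)\<bar> ^ n \<le> \<bar>w x\<bar> ^ n" by (rule power_mono) simp
      then show "norm (indicator ?S x * \<bar>w x - cl (real m) (w x)\<bar> ^ n) \<le> indicator ?S x * \<bar>w x\<bar> ^ n"
        by (simp add: indicator_def)
    qed
  qed measurable
  then have "(\<lambda>m. LINT x|lborel. indicator ?S x * \<bar>w x - cl (real m) (w x)\<bar> ^ n) \<longlonglongrightarrow> 0" by simp
  from order_tendstoD(2)[OF this e'] obtain m :: nat
    where m: "(LINT x|lborel. indicator ?S x * \<bar>w x - cl (real m) (w x)\<bar> ^ n) < e / 2 ^ n / 2"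
    by (auto simp: eventually_sequentially)
  define u where "u x = cl (real m) (w x)" for x
  have [measurable]: "u \<in> borel_measurable borel" unfolding u_def by measurable
  \<comment> \<open>The source of the continuous functions: \<open>measurable_on\<close> provides
    continuous \<open>g j\<close> that converge to \<open>u\<close> outside a negligible
    set.\<close>
  have "u \<in> borel_measurable (lebesgue_on UNIV)"
    by (simp add: lebesgue_on_UNIV_eq measurable_completion)
  then have "u measurable_on UNIV" by (simp add: measurable_on_iff_borel_measurable)
  then obtain N g where N: "negligible N" and g: "\<And>j. continuous_on UNIV (g j)"
    and lim: "\<And>x. x \<notin> N \<Longrightarrow> (\<lambda>j. g j x) \<longlonglongrightarrow> u x"
    unfolding measurable_on_def by auto
  have cg: "continuous_on UNIV (\<lambda>x. cl (real m) (g j x))" for j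
    unfolding cl_def by (intro continuous_intros g)
  have [measurable]: "g j \<in> borel_measurable borel" for j using g by (rule borel_measurable_continuous_onI)
  have cu: "cl (real m) (u x) = u x" for x unfolding u_def cl_def by linarith
  have bd: "\<bar>u x - cl (real m) y\<bar> ^ n \<le> (2 * real m) ^ n" for x y
    using clb[of "real m" "w x"] clb[of "real m" y] by (intro power_mono) (auto simp: u_def)
  have iS: "integrable lborel (\<lambda>x. indicator ?S x * c :: real)" for c
  proof -
    have "integrable lborel (\<lambda>x. indicator ?S x *\<^sub>R c)" by (rule borel_integrable_compact) auto
    then show ?thesis by simp
  qed
  have AEN: "AE x in lborel. x \<notin> N"
  proof -
    have "AE x in lebesgue. x \<notin> N"
      using N by (simp add: negligible_iff_null_sets AE_not_in)
    then show ?thesis by (simp add: AE_completion_iff)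
  qed
  have "(\<lambda>j. LINT x|lborel. indicator ?S x * \<bar>u x - cl (real m) (g j x)\<bar> ^ n) \<longlonglongrightarrow> (LINT x|(lborel :: 'a measure). (0::real))"
  proof (rule integral_dominated_convergence[where w = "\<lambda>x. indicator ?S x * (2 * real m) ^ n"])
    show "integrable lborel (\<lambda>x. indicator ?S x * (2 * real m) ^ n)" by (rule iS)
    show "AE x in lborel. (\<lambda>j. indicator ?S x * \<bar>u x - cl (real m) (g j x)\<bar> ^ n) \<longlonglongrightarrow> 0"
      using AEN
    proof eventually_elim
      case (elim x)
      have "(\<lambda>j. cl (real m) (g j x)) \<longlonglongrightarrow> cl (real m) (u x)"
        unfolding cl_def by (intro tendsto_intros lim elim)
      then have "(\<lambda>j. indicator ?S x * \<bar>u x - cl (real m) (g j x)\<bar> ^ n) \<longlonglongrightarrow> indicator ?S x * \<bar>u x - u x\<bar> ^ n"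
        unfolding cu by (intro tendsto_intros)
      then show ?case using n by (simp add: zero_power)
    qed
    show "AE x in lborel. norm (indicator ?S x * \<bar>u x - cl (real m) (g j x)\<bar> ^ n) \<le> indicator ?S x * (2 * real m) ^ n" for j
      using bd by (auto simp: indicator_def)
  qed measurable
  then have "(\<lambda>j. LINT x|lborel. indicator ?S x * \<bar>u x - cl (real m) (g j x)\<bar> ^ n) \<longlonglongrightarrow> 0" by simp
  from order_tendstoD(2)[OF this e'] obtain j
    where j: "(LINT x|lborel. indicator ?S x * \<bar>u x - cl (real m) (g j x)\<bar> ^ n) < e / 2 ^ n / 2"
    by (auto simp: eventually_sequentially)
  define v where "v x = cl (real m) (g j x)" for x
  have [measurable]: "v \<in> borel_measurable borel" unfolding v_def by measurable
  have i1: "integrable lborel (\<lambda>x. indicator ?S x * \<bar>w x - u x\<bar> ^ n)"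
  proof (rule Bochner_Integration.integrable_bound[OF fin])
    show "AE x in lborel. norm (indicator ?S x * \<bar>w x - u x\<bar> ^ n) \<le> norm (indicator ?S x * \<bar>w x\<bar> ^ n)"
    proof (rule AE_I2)
      fix x
      have "\<bar>w x - u x\<bar> \<le> \<bar>w x\<bar>" unfolding u_def cl_def by linarith
      then have "\<bar>w x - u x\<bar> ^ n \<le> \<bar>w x\<bar> ^ n" by (rule power_mono) simp
      then show "norm (indicator ?S x * \<bar>w x - u x\<bar> ^ n) \<le> norm (indicator ?S x * \<bar>w x\<bar> ^ n)"
        by (simp add: indicator_def)
    qed
  qed measurable
  have i2: "integrable lborel (\<lambda>x. indicator ?S x * \<bar>u x - v x\<bar> ^ n)"
    by (rule Bochner_Integration.integrable_bound[OF iS[of "(2 * real m) ^ n"]])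
       (use bd in \<open>auto simp: indicator_def v_def\<close>)
  have "(\<integral>\<^sup>+x\<in>?S. ennreal (\<bar>w x - v x\<bar> ^ n) \<partial>lborel) \<le>
      (\<integral>\<^sup>+x. ennreal (2 ^ n * (indicator ?S x * \<bar>w x - u x\<bar> ^ n + indicator ?S x * \<bar>u x - v x\<bar> ^ n)) \<partial>lborel)"
  proof (rule nn_integral_mono)
    fix x
    have "\<bar>w x - v x\<bar> ^ n \<le> 2 ^ n * (\<bar>w x - u x\<bar> ^ n + \<bar>u x - v x\<bar> ^ n)"
      by (rule power_le_sum_powers) auto
    then show "ennreal (\<bar>w x - v x\<bar> ^ n) * indicator ?S x \<le> ennreal (2 ^ n * (indicator ?S x * \<bar>w x - u x\<bar> ^ n + indicator ?S x * \<bar>u x - v x\<bar> ^ n))"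
      by (simp add: indicator_def ennreal_leI)
  qed
  then have le: "(\<integral>\<^sup>+x\<in>?S. ennreal (\<bar>w x - v x\<bar> ^ n) \<partial>lborel) \<le>
      ennreal (LINT x|lborel. 2 ^ n * (indicator ?S x * \<bar>w x - u x\<bar> ^ n + indicator ?S x * \<bar>u x - v x\<bar> ^ n))"
    using i1 i2 by (subst (asm) nn_integral_eq_integral) auto
  have "(LINT x|lborel. 2 ^ n * (indicator ?S x * \<bar>w x - u x\<bar> ^ n + indicator ?S x * \<bar>u x - v x\<bar> ^ n)) =
      2 ^ n * ((LINT x|lborel. indicator ?S x * \<bar>w x - u x\<bar> ^ n) + (LINT x|lborel. indicator ?S x * \<bar>u x - v x\<bar> ^ n))"
    using i1 i2 by simp
  also have "2 ^ n * ((LINT x|lborel. indicator ?S x * \<bar>w x - u x\<bar> ^ n) + (LINT x|lborel. indicator ?S x * \<bar>u x - v x\<bar> ^ n))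
      < 2 ^ n * (e / 2 ^ n / 2 + e / 2 ^ n / 2)"
    using m j by (intro mult_strict_left_mono add_strict_mono) (auto simp: u_def v_def)
  also have "\<dots> = e" by simp
  finally have "(\<integral>\<^sup>+x\<in>?S. ennreal (\<bar>w x - v x\<bar> ^ n) \<partial>lborel) < ennreal e"
    using e by (intro le_less_trans[OF le] ennreal_lessI)
  then show ?thesis using cg[of j] unfolding v_def[symmetric] by blast
qed

text \<open>Three-term splitting around a continuous function \<open>v\<close>. The mollification of
  \<open>w - v\<close> is no larger than \<open>w - v\<close> itself, by
  \<open>conv_mollifier_power_le\<close>; the mollification of \<open>v\<close> is uniformly close
  to \<open>v\<close>. Radii are kept below 1 so that only the values on the enlarged ball of radius
  \<open>R + 1\<close> matter.\<close>

lemma conv_mollifier_approximates: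
  fixes w :: "'a::euclidean_space \<Rightarrow> real"
  assumes w: "integrable lborel w" and supp: "\<And>x. x \<notin> cball a R \<Longrightarrow> w x = 0" and n: "0 < n"
    and fin: "integrable lborel (\<lambda>x. \<bar>w x\<bar> ^ n)" and e: "0 < e"
  shows "\<exists>d>0. \<forall>r. 0 < r \<and> r < d \<longrightarrow> (\<integral>\<^sup>+x\<in>cball a R. ennreal (\<bar>conv (mollifier r) w x - w x\<bar> ^ n) \<partial>lborel) < ennreal e"
proof -
  let ?S = "cball a R" and ?S' = "cball a (R + 1)"
  have [measurable]: "?S \<in> sets borel" "?S' \<in> sets borel" by auto
  have [measurable]: "w \<in> borel_measurable borel" using w by (simp add: borel_measurable_integrable[of lborel, simplified])
  \<comment> \<open>\<open>power_le_sum_powers\<close> is applied twice and costs at most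
    \<open>4 ^ n\<close>. Three terms bounded by a quarter each leave the final inequality
    strict.\<close>
  define e1 where "e1 = e / 4 ^ n / 4"
  have e1: "e1 > 0" using e by (simp add: e1_def)
  define m where "m = measure lborel ?S"
  have em: "emeasure lborel ?S = ennreal m"
    unfolding m_def using emeasure_lborel_cball_finite[of a R] by (intro emeasure_eq_ennreal_measure) (simp add: less_top)
  define h where "h = min 1 (e1 / (m + 1))"
  have m0: "m \<ge> 0" by (simp add: m_def)
  have h: "0 < h" "h \<le> 1" using e1 m0 by (auto simp: h_def)
  have hm: "h ^ n * m \<le> e1"
  proof -
    have "h ^ n \<le> h ^ 1" using h n by (intro power_decreasing) auto
    then have "h ^ n * m \<le> h * m" using m0 by (intro mult_right_mono) auto
    also have "\<dots> \<le> e1 / (m + 1) * m" using m0 by (intro mult_right_mono) (auto simp: h_def)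
    also have "\<dots> \<le> e1" using m0 e1 by (simp add: field_simps)
    finally show ?thesis .
  qed
  have "integrable lborel (\<lambda>x. indicator ?S' x * \<bar>w x\<bar> ^ n)"
    by (rule Bochner_Integration.integrable_bound[OF fin]) (auto simp: indicator_def)
  from continuous_approximation_power[OF _ n this e1] obtain v
    where v: "continuous_on UNIV v" and v1: "(\<integral>\<^sup>+x\<in>?S'. ennreal (\<bar>w x - v x\<bar> ^ n) \<partial>lborel) < ennreal e1" by auto
  have [measurable]: "v \<in> borel_measurable borel" using v by (rule borel_measurable_continuous_onI)
  \<comment> \<open>Cutting off makes \<open>v\<close> integrable without changing it within
    distance 1 of \<open>cball a R\<close>. Since \<open>w\<close> vanishes off that ball,
    \<open>w - v'\<close> vanishes off the enlarged one.\<close>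
  define v' where "v' x = indicator ?S' x * v x" for x
  have iv: "integrable lborel v'"
  proof -
    have "integrable lborel (\<lambda>x. indicator ?S' x *\<^sub>R v x)"
      by (rule borel_integrable_compact) (auto intro: continuous_on_subset[OF v])
    then show ?thesis unfolding v'_def by simp
  qed
  have "uniformly_continuous_on ?S' v"
    by (intro compact_uniformly_continuous continuous_on_subset[OF v]) auto
  then obtain d where d: "d > 0" "\<And>x y. x \<in> ?S' \<Longrightarrow> y \<in> ?S' \<Longrightarrow> dist y x < d \<Longrightarrow> dist (v y) (v x) < h"
    by (rule uniformly_continuous_onE[OF _ h(1)]) blast
  have "(\<integral>\<^sup>+x\<in>?S. ennreal (\<bar>conv (mollifier r) w x - w x\<bar> ^ n) \<partial>lborel) < ennreal e" if r: "0 < r" "r < min d 1" for r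
  proof -
    let ?k = "mollifier r :: 'a \<Rightarrow> real"
    have ci: "integrable lborel (\<lambda>y. ?k (x - y) * f y)" if "integrable lborel f" for f x
      by (rule conv_integrable[OF mollifier_continuous[OF r(1)] mollifier_support[OF r(1)] that])
    have ik: "integrable lborel (\<lambda>y. ?k (x - y))" and intk: "(LINT y|lborel. ?k (x - y)) = 1" for x
    proof -
      have [measurable]: "?k \<in> borel_measurable borel"
        using mollifier_continuous[OF r(1)] by (rule borel_measurable_continuous_onI)
      show *: "integrable lborel (\<lambda>y. ?k (x - y))"
        by (rule integrableI_nonneg) (auto simp: mollifier_nonneg[OF r(1)] mollifier_shift_integral[OF r(1)])
      have "ennreal (LINT y|lborel. ?k (x - y)) = 1"
        by (subst nn_integral_eq_integral[OF *, symmetric])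
          (auto simp: mollifier_nonneg[OF r(1)] mollifier_shift_integral(1)[OF r(1)])
      then show "(LINT y|lborel. ?k (x - y)) = 1" by (simp add: ennreal_eq_1)
    qed
    have cv: "\<bar>conv ?k v' x - v x\<bar> \<le> h" if x: "x \<in> ?S" for x
    proof -
      have "conv ?k v' x - v x = (LINT y|lborel. ?k (x - y) * v' y - ?k (x - y) * v x)"
        unfolding conv_def using ci[OF iv] ik intk by simp
      also have "\<bar>\<dots>\<bar> \<le> (LINT y|lborel. \<bar>?k (x - y) * v' y - ?k (x - y) * v x\<bar>)"
        by (rule integral_abs_bound)
      also have "\<dots> \<le> (LINT y|lborel. ?k (x - y) * h)"
      proof (rule integral_mono)
        fix y
        show "\<bar>?k (x - y) * v' y - ?k (x - y) * v x\<bar> \<le> ?k (x - y) * h"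
        proof (cases "norm (x - y) \<ge> r")
          case True
          then show ?thesis using mollifier_support[OF r(1) True] by simp
        next
          case False
          have "norm (x - a) \<le> R" using x by (simp add: dist_norm norm_minus_commute)
          moreover have "norm (y - a) \<le> norm (x - a) + norm (x - y)"
            using norm_triangle_ineq4[of "x - a" "x - y"] by (simp add: algebra_simps)
          ultimately have y: "y \<in> ?S'" using False r by (simp add: dist_norm norm_minus_commute[of a])
          moreover have "x \<in> ?S'" using x by simp
          ultimately have "\<bar>v y - v x\<bar> \<le> h" using d(2)[of x y] False r by (simp add: dist_norm norm_minus_commute)
          then have "?k (x - y) * \<bar>v y - v x\<bar> \<le> ?k (x - y) * h"
            using mollifier_nonneg[OF r(1)] by (intro mult_left_mono) auto
          moreover have "v' y = v y" using y by (simp add: v'_def)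
          ultimately show ?thesis using mollifier_nonneg[OF r(1), of "x - y"]
            by (simp add: right_diff_distrib[symmetric] abs_mult)
        qed
      qed (use ci[OF iv] ik in auto)
      also have "\<dots> = h" using ik intk by simp
      finally show ?thesis .
    qed
    have i2: "integrable lborel (\<lambda>x. w x - v' x)" using w iv by simp
    have split: "conv ?k w x = conv ?k (\<lambda>x. w x - v' x) x + conv ?k v' x" for x
      unfolding conv_def right_diff_distrib using ci[OF w] ci[OF iv] by simp
    let ?c = "\<lambda>x. conv ?k (\<lambda>x. w x - v' x) x"
    have [measurable]: "conv ?k f \<in> borel_measurable borel" if "integrable lborel f" for f
      by (rule borel_measurable_continuous_onI[OF conv_continuous[OF mollifier_continuous[OF r(1)] mollifier_support[OF r(1)] that]])
    have [measurable]: "?c \<in> borel_measurable borel"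
      by (rule borel_measurable_continuous_onI[OF conv_continuous[OF mollifier_continuous[OF r(1)] mollifier_support[OF r(1)] i2]])
    have pt: "\<bar>conv ?k w x - w x\<bar> ^ n \<le> 4 ^ n * (\<bar>?c x\<bar> ^ n + (h ^ n + \<bar>w x - v x\<bar> ^ n))" if x: "x \<in> ?S" for x
    proof -
      have "\<bar>conv ?k w x - w x\<bar> \<le> \<bar>?c x\<bar> + (h + \<bar>w x - v x\<bar>)"
        using cv[OF x] unfolding split by linarith
      then have "\<bar>conv ?k w x - w x\<bar> ^ n \<le> 2 ^ n * (\<bar>?c x\<bar> ^ n + (h + \<bar>w x - v x\<bar>) ^ n)"
        using h by (intro power_le_sum_powers) auto
      also have "(h + \<bar>w x - v x\<bar>) ^ n \<le> 2 ^ n * (h ^ n + \<bar>w x - v x\<bar> ^ n)"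
        using h by (intro power_le_sum_powers) auto
      also have "\<bar>?c x\<bar> ^ n \<le> 2 ^ n * \<bar>?c x\<bar> ^ n"
        using mult_right_mono[of 1 "2 ^ n" "\<bar>?c x\<bar> ^ n"] by simp
      finally have "\<bar>conv ?k w x - w x\<bar> ^ n \<le> 2 ^ n * (2 ^ n * (\<bar>?c x\<bar> ^ n + (h ^ n + \<bar>w x - v x\<bar> ^ n)))"
        by (simp add: distrib_left)
      also have "(2::real) ^ n * (2 ^ n * z) = 4 ^ n * z" for z
        by (simp add: power_mult_distrib[symmetric] mult.assoc[symmetric])
      finally show ?thesis .
    qed
    have "(\<integral>\<^sup>+x\<in>?S. ennreal (\<bar>conv ?k w x - w x\<bar> ^ n) \<partial>lborel) \<le>
        (\<integral>\<^sup>+x. ennreal (4 ^ n) * (ennreal (\<bar>?c x\<bar> ^ n) + (ennreal (h ^ n) * indicator ?S x + ennreal (\<bar>w x - v x\<bar> ^ n) * indicator ?S' x)) \<partial>lborel)"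
    proof (rule nn_integral_mono)
      fix x
      show "ennreal (\<bar>conv ?k w x - w x\<bar> ^ n) * indicator ?S x \<le>
        ennreal (4 ^ n) * (ennreal (\<bar>?c x\<bar> ^ n) + (ennreal (h ^ n) * indicator ?S x + ennreal (\<bar>w x - v x\<bar> ^ n) * indicator ?S' x))"
      proof (cases "x \<in> ?S")
        case True
        then have "x \<in> ?S'" by simp
        have "ennreal (\<bar>conv ?k w x - w x\<bar> ^ n) \<le> ennreal (4 ^ n * (\<bar>?c x\<bar> ^ n + (h ^ n + \<bar>w x - v x\<bar> ^ n)))"
          by (rule ennreal_leI[OF pt[OF True]])
        then show ?thesis using True \<open>x \<in> ?S'\<close> h by (simp add: ennreal_mult)
      qed simp
    qed
    also have "\<dots> = ennreal (4 ^ n) * ((\<integral>\<^sup>+x. ennreal (\<bar>?c x\<bar> ^ n) \<partial>lborel) + (ennreal (h ^ n) * emeasure lborel ?S + (\<integral>\<^sup>+x\<in>?S'. ennreal (\<bar>w x - v x\<bar> ^ n) \<partial>lborel)))"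
      by (simp add: nn_integral_cmult nn_integral_add nn_integral_cmult_indicator)
    also have "(\<integral>\<^sup>+x. ennreal (\<bar>?c x\<bar> ^ n) \<partial>lborel) \<le> ennreal e1"
    proof -
      have "(\<integral>\<^sup>+x. ennreal (\<bar>?c x\<bar> ^ n) \<partial>lborel) \<le> (\<integral>\<^sup>+x. ennreal (\<bar>w x - v' x\<bar> ^ n) \<partial>lborel)"
        by (rule conv_mollifier_power_le[OF r(1) i2])
      also have "\<dots> = (\<integral>\<^sup>+x\<in>?S'. ennreal (\<bar>w x - v x\<bar> ^ n) \<partial>lborel)"
        by (intro nn_integral_cong) (use supp n in \<open>auto simp: v'_def indicator_def zero_power\<close>)
      finally show ?thesis using v1 by simp
    qed
    also have "(\<integral>\<^sup>+x\<in>?S'. ennreal (\<bar>w x - v x\<bar> ^ n) \<partial>lborel) \<le> ennreal e1" using v1 by simp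
    also have "ennreal (h ^ n) * emeasure lborel ?S \<le> ennreal e1"
      unfolding em using hm h m0 by (simp add: ennreal_mult[symmetric] ennreal_leI)
    finally have "(\<integral>\<^sup>+x\<in>?S. ennreal (\<bar>conv ?k w x - w x\<bar> ^ n) \<partial>lborel) \<le> ennreal (4 ^ n) * (ennreal e1 + (ennreal e1 + ennreal e1))"
      by (simp add: add_mono mult_left_mono)
    also have "\<dots> = ennreal (4 ^ n * (e1 + (e1 + e1)))" using e1 by (simp add: ennreal_mult[symmetric] ennreal_plus[symmetric] del: ennreal_plus)
    also have "\<dots> < ennreal e"
      by (rule ennreal_lessI[OF e]) (use e in \<open>simp add: e1_def\<close>)
    finally show ?thesis .
  qed
  then show ?thesis using d(1) by (intro exI[of _ "min d 1"]) auto
qed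

text \<open>If \<open>norm (A - B)\<close> is small compared with \<open>norm B\<close>, both
  matrices are rescaled by \<open>norm B\<close> and uniform continuity on a bounded set gives the
  error \<open>t * norm B ^ n\<close>. Otherwise \<open>norm A\<close> and \<open>norm B\<close> are
  at most multiples of \<open>norm (A - B)\<close>, and the growth of \<open>H\<close> suffices;
  this case determines \<open>C\<close>.\<close>

lemma homogeneous_difference_bound:
  fixes H :: "'a::euclidean_space \<Rightarrow> real"
  assumes cH: "continuous_on UNIV H" and hom: "\<And>c x. 0 \<le> c \<Longrightarrow> H (c *\<^sub>R x) = c ^ n * H x"
    and n: "0 < n" and t: "0 < t"
  shows "\<exists>C\<ge>0. \<forall>A B. \<bar>H A - H B\<bar> \<le> C * norm (A - B) ^ n + t * norm B ^ n"
proof -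
  have H0: "H 0 = 0" using hom[of 0 0] n by (simp add: zero_power)
  have "compact (H ` cball 0 1)" by (intro compact_continuous_image continuous_on_subset[OF cH]) auto
  then obtain S where S: "S > 0" "\<And>x. norm x \<le> 1 \<Longrightarrow> \<bar>H x\<bar> \<le> S"
    by (force dest!: compact_imp_bounded simp: bounded_pos)
  have Hb: "\<bar>H x\<bar> \<le> S * norm x ^ n" for x
  proof (cases "x = 0")
    case False
    have "H x = norm x ^ n * H (x /\<^sub>R norm x)" using hom[of "norm x" "x /\<^sub>R norm x"] False by simp
    moreover have "\<bar>H (x /\<^sub>R norm x)\<bar> \<le> S" using False by (intro S) simp
    ultimately show ?thesis by (simp add: abs_mult mult.commute[of S] mult_left_mono)
  qed (use H0 n in \<open>simp add: zero_power\<close>)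
  have "uniformly_continuous_on (cball 0 2) H"
    by (intro compact_uniformly_continuous continuous_on_subset[OF cH]) auto
  then obtain s0 where s0: "s0 > 0"
    "\<And>x y. x \<in> cball 0 2 \<Longrightarrow> y \<in> cball 0 2 \<Longrightarrow> dist y x < s0 \<Longrightarrow> dist (H y) (H x) < t"
    by (rule uniformly_continuous_onE[OF _ t]) blast
  define s where "s = min s0 1"
  have s: "0 < s" "s \<le> 1" "s \<le> s0" using s0 by (auto simp: s_def)
  define C where "C = S * (1 + 1 / s) ^ n + S * (1 / s) ^ n"
  have C0: "C \<ge> 0" using S s by (simp add: C_def)
  have "\<bar>H A - H B\<bar> \<le> C * norm (A - B) ^ n + t * norm B ^ n" for A B
  proof (cases "norm (A - B) < s * norm B")
    case True
    then have B: "norm B > 0" by (cases "B = 0") auto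
    let ?A = "A /\<^sub>R norm B" and ?B = "B /\<^sub>R norm B"
    have d: "dist ?A ?B < s"
    proof -
      have "dist ?A ?B = norm (A - B) / norm B"
        by (simp add: dist_norm scaleR_diff_right[symmetric] divide_inverse mult.commute)
      also have "\<dots> < s" using True B by (simp add: field_simps)
      finally show ?thesis .
    qed
    have nB: "norm ?B = 1" using B by simp
    have nA: "norm ?A \<le> 2" using d s nB norm_triangle_ineq[of "?A - ?B" ?B] by (simp add: dist_norm)
    have "dist (H ?A) (H ?B) < t" using d s nB nA by (intro s0(2)) auto
    moreover have "H A = norm B ^ n * H ?A" "H B = norm B ^ n * H ?B"
      using hom[of "norm B" ?A] hom[of "norm B" ?B] B by simp_all
    ultimately have "\<bar>H A - H B\<bar> \<le> norm B ^ n * t"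
      by (simp add: right_diff_distrib[symmetric] abs_mult dist_real_def mult_left_mono)
    then show ?thesis using C0 by (simp add: add_increasing mult.commute)
  next
    case False
    then have B: "norm B \<le> 1 / s * norm (A - B)" using s by (simp add: field_simps)
    moreover have "norm A \<le> norm (A - B) + norm B" using norm_triangle_ineq[of "A - B" B] by simp
    ultimately have A: "norm A \<le> (1 + 1 / s) * norm (A - B)" by (simp add: distrib_right)
    have "\<bar>H A - H B\<bar> \<le> S * norm A ^ n + S * norm B ^ n" using Hb[of A] Hb[of B] by linarith
    also have "\<dots> \<le> S * ((1 + 1 / s) * norm (A - B)) ^ n + S * (1 / s * norm (A - B)) ^ n"
      using S by (intro add_mono mult_left_mono power_mono A B) auto
    also have "\<dots> = C * norm (A - B) ^ n"      unfolding C_def power_mult_distrib[of "1 + 1 / s"] power_mult_distrib[of "1 / s"] by (simp only: distrib_right mult.assoc)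
    finally show ?thesis using t by (simp add: add_increasing2)
  qed
  with C0 show ?thesis by blast
qed

section \<open>Smooth approximation of weakly differentiable maps\<close>

text \<open>A counterpart of \<open>has_weak_deriv\<close> with Borel functions and
  \<open>lborel\<close>, the setting in which the convolutions and Fubini arguments take place.
  Integrability is supplied separately, ball by ball.\<close>

definition borel_weak_deriv :: "(real^'n) set \<Rightarrow> (real^'n \<Rightarrow> real^'n) \<Rightarrow> (real^'n \<Rightarrow> real^'n^'n) \<Rightarrow> bool" where
  "borel_weak_deriv U f D \<longleftrightarrow> U \<in> sets borel \<and> (\<lambda>x. indicator U x *\<^sub>R f x) \<in> borel_measurable borel \<and>
     D \<in> borel_measurable borel \<and>
     (\<forall>\<phi> i j. test_fun U \<phi> \<longrightarrow>
        (LINT x|lborel. indicator U x * (f x $ i * frechet_derivative \<phi> (at x) (axis j 1))) =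
        - (LINT x|lborel. indicator U x * (D x $ i $ j * \<phi> x)))"

text \<open>The gradient and second derivatives are written out by differentiating
  \<open>flat_exp\<close> with indices 0 and 2. Their explicit form shows the symmetry of the second
  derivatives, which \<open>null_Lagrangian\<close> requires.\<close>

lemma mollifier_gradients:
  fixes \<rho> :: real
  assumes \<rho>: "0 < \<rho>"
  obtains K1 :: "real^'n \<Rightarrow> real^'n" and K2 :: "'n \<Rightarrow> real^'n \<Rightarrow> real^'n"
  where "\<And>z. (mollifier \<rho> has_derivative (\<lambda>v. K1 z \<bullet> v)) (at z)" "continuous_on UNIV K1"
    "\<And>z. norm z \<ge> \<rho> \<Longrightarrow> K1 z = 0"
    "\<And>j z. ((\<lambda>z. K1 z $ j) has_derivative (\<lambda>v. K2 j z \<bullet> v)) (at z)" "\<And>j. continuous_on UNIV (K2 j)"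
    "\<And>j z. norm z \<ge> \<rho> \<Longrightarrow> K2 j z = 0" "\<And>j l z. K2 j z $ l = K2 l z $ j"
proof -
  define I where "I = (LINT z|lborel. flat_exp 0 (\<rho>\<^sup>2 - (z::real^'n) \<bullet> z))"
  have I: "I > 0" unfolding I_def by (rule mollifier_integral_pos[OF \<rho>])
  define fe where "fe m z = flat_exp m (\<rho>\<^sup>2 - z \<bullet> z)" for m and z :: "real^'n"
  have dfe: "(fe m has_derivative (\<lambda>v. (- 2 * (z \<bullet> v)) * (fe (m + 2) z - real m * fe (m + 1) z))) (at z)" for m z
    using flat_exp_ball_has_derivative[of m "\<rho>\<^sup>2" 0 z] unfolding fe_def by simp
  have cfe: "continuous_on UNIV (fe m)" for m unfolding fe_def by (rule flat_exp_ball_continuous)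
  have sfe: "fe m z = 0" if "norm z \<ge> \<rho>" for m z unfolding fe_def using flat_exp_ball_support[of \<rho> z m] \<rho> that by simp
  define K1 where "K1 z = (- 2 * fe 2 z / I) *\<^sub>R z" for z
  define K2 where "K2 j z = (4 * z $ j * (fe 4 z - 2 * fe 3 z) / I) *\<^sub>R z + (- 2 * fe 2 z / I) *\<^sub>R axis j 1" for j z
  show ?thesis
  proof (rule that[of K1 K2])
    show "(mollifier \<rho> has_derivative (\<lambda>v. K1 z \<bullet> v)) (at z)" for z
    proof -
      have "((\<lambda>z. fe 0 z / I) has_derivative (\<lambda>v. ((- 2 * (z \<bullet> v)) * (fe 2 z - 0)) / I)) (at z)"
        using dfe[of 0 z] by (intro bounded_linear.has_derivative[OF bounded_linear_divide]) (simp add: numeral_2_eq_2)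
      moreover have "mollifier \<rho> = (\<lambda>z. fe 0 z / I)" by (simp only: fun_eq_iff mollifier_def I_def fe_def) simp
      moreover have "(\<lambda>v. ((- 2 * (z \<bullet> v)) * (fe 2 z - 0)) / I) = (\<lambda>v. K1 z \<bullet> v)"
        by (simp add: fun_eq_iff K1_def)
      ultimately show ?thesis by simp
    qed
    show "((\<lambda>z. K1 z $ j) has_derivative (\<lambda>v. K2 j z \<bullet> v)) (at z)" for j z
    proof -
      have "((\<lambda>z. - 2 / I * (fe 2 z * z $ j)) has_derivative
          (\<lambda>v. - 2 / I * (fe 2 z * v $ j + ((- 2 * (z \<bullet> v)) * (fe 4 z - 2 * fe 3 z)) * z $ j))) (at z)"
        using dfe[of 2 z]
        by (intro has_derivative_mult_right has_derivative_mult bounded_linear.has_derivative[OF bounded_linear_vec_nth] has_derivative_ident)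
           (simp add: eval_nat_numeral)
      moreover have "(\<lambda>z. K1 z $ j) = (\<lambda>z. - 2 / I * (fe 2 z * z $ j))"
        by (simp add: fun_eq_iff K1_def)
      moreover have "(\<lambda>v. - 2 / I * (fe 2 z * v $ j + ((- 2 * (z \<bullet> v)) * (fe 4 z - 2 * fe 3 z)) * z $ j)) = (\<lambda>v. K2 j z \<bullet> v)"
      proof
        fix v
        have "K2 j z \<bullet> v = (4 * z $ j * (fe 4 z - 2 * fe 3 z) / I) * (z \<bullet> v) + (- 2 * fe 2 z / I) * v $ j"
          unfolding K2_def inner_add_left inner_scaleR_left inner_axis' by simp
        then show "- 2 / I * (fe 2 z * v $ j + ((- 2 * (z \<bullet> v)) * (fe 4 z - 2 * fe 3 z)) * z $ j) = K2 j z \<bullet> v"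
          using I by (simp add: diff_divide_distrib add_divide_distrib algebra_simps)
      qed
      ultimately show ?thesis by simp
    qed
    show "K2 j z $ l = K2 l z $ j" for j l z by (simp add: K2_def axis_def)
  qed (use I in \<open>auto simp: K1_def K2_def sfe intro!: continuous_intros cfe\<close>)
qed

text \<open>The derivatives fall on the kernel, so \<open>g\<close>, \<open>A\<close> and
  \<open>H\<close> are defined and regular on the whole space, with \<open>f\<close> cut off outside
  the ball. Inserting the test function \<open>mollifier \<rho> (x - y)\<close> into the weak
  derivative identity shows that \<open>A\<close> also mollifies \<open>D\<close>, as long as the
  support of this function stays inside the ball; hence the radius
  \<open>R - \<rho>\<close>.\<close>

lemma mollification:
  fixes f :: "real^'n \<Rightarrow> real^'n"
  assumes wd: "borel_weak_deriv U f D" and sub: "cball a R \<subseteq> U" and \<rho>: "0 < \<rho>"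
    and intf: "integrable lborel (\<lambda>x. indicator (cball a R) x *\<^sub>R f x)"
  obtains g :: "'n \<Rightarrow> real^'n \<Rightarrow> real" and A H
  where "\<And>i x. (g i has_derivative (\<lambda>v. A x $ i \<bullet> v)) (at x)"
    "\<And>i j x. ((\<lambda>x. A x $ i $ j) has_derivative (\<lambda>v. H i j x \<bullet> v)) (at x)"
    "\<And>i j. continuous_on UNIV (H i j)" "\<And>i j l x. H i j x $ l = H i l x $ j"
    "\<And>i j x. x \<in> cball a (R - \<rho>) \<Longrightarrow> A x $ i $ j = conv (mollifier \<rho>) (\<lambda>y. indicator (cball a R) y * D y $ i $ j) x"
proof -
  obtain K1 :: "real^'n \<Rightarrow> real^'n" and K2 :: "'n \<Rightarrow> real^'n \<Rightarrow> real^'n" where K1: "\<And>z. (mollifier \<rho> has_derivative (\<lambda>v. K1 z \<bullet> v)) (at z)" "continuous_on UNIV K1"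
    "\<And>z. norm z \<ge> \<rho> \<Longrightarrow> K1 z = 0"
    and K2: "\<And>j z. ((\<lambda>z. K1 z $ j) has_derivative (\<lambda>v. K2 j z \<bullet> v)) (at z)" "\<And>j. continuous_on UNIV (K2 j)"
    "\<And>j z. norm z \<ge> \<rho> \<Longrightarrow> K2 j z = 0" "\<And>j l z. K2 j z $ l = K2 l z $ j"
    using mollifier_gradients[OF \<rho>] by blast
  define F where "F i x = indicator (cball a R) x * f x $ i" for i x
  have iF: "integrable lborel (F i)" for i
    using integrable_bounded_linear[OF bounded_linear_vec_nth intf, of i] by (simp add: F_def[abs_def])
  define g where "g i = conv (mollifier \<rho>) (F i)" for i
  define A where "A x = (\<chi> i j. conv (\<lambda>z. K1 z $ j) (F i) x)" for x
  define H where "H i j x = (\<chi> l. conv (\<lambda>z. K2 j z $ l) (F i) x)" for i j x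
  have vec: "(\<Sum>b\<in>Basis. conv (\<lambda>z. G z \<bullet> b) h x *\<^sub>R b) = (\<chi> l. conv (\<lambda>z. G z $ l) h x)" for G :: "real^'n \<Rightarrow> real^'n" and h x
  proof -
    have B: "(Basis :: (real^'n) set) = (\<lambda>l. axis l 1) ` UNIV" by (auto simp: Basis_vec_def)
    have "inj (\<lambda>l::'n. axis l (1::real))" by (auto simp: inj_on_def axis_eq_axis)
    then have "(\<Sum>b\<in>Basis. conv (\<lambda>z. G z \<bullet> b) h x *\<^sub>R b) = (\<Sum>l\<in>UNIV. conv (\<lambda>z. G z \<bullet> axis l 1) h x *\<^sub>R axis l 1)"
      unfolding B by (subst sum.reindex) auto
    also have "\<dots> = (\<Sum>l\<in>UNIV. conv (\<lambda>z. G z $ l) h x *\<^sub>R axis l 1)"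
      by (simp add: inner_axis)
    also have "\<dots> = (\<chi> l. conv (\<lambda>z. G z $ l) h x)"
      by (auto simp: vec_eq_iff axis_def if_distrib[of "\<lambda>c. _ * c"] cong: if_cong)
    finally show ?thesis .
  qed
  show ?thesis
  proof (rule that[of g A H])
    show "(g i has_derivative (\<lambda>v. A x $ i \<bullet> v)) (at x)" for i x
      using conv_has_derivative[OF K1(1,2) mollifier_support[OF \<rho>] K1(3) iF[of i], where x = x]
      unfolding vec g_def A_def by simp
    show "((\<lambda>x. A x $ i $ j) has_derivative (\<lambda>v. H i j x \<bullet> v)) (at x)" for i j x
      using conv_has_derivative[OF K2(1)[of j] K2(2)[of j] _ _ iF[of i], where x = x and \<rho> = \<rho>] K1(3) K2(3)
      unfolding vec A_def H_def by simp
    show "continuous_on UNIV (H i j)" for i j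
      unfolding H_def
      by (intro continuous_on_vec_lambda conv_continuous[where \<rho> = \<rho>] continuous_intros K2 iF) (simp add: K2(3))
    show "H i j x $ l = H i l x $ j" for i j l x
      unfolding H_def using K2(4)[of j _ l] by simp
  next
    fix i j and x :: "real^'n" assume x: "x \<in> cball a (R - \<rho>)"
    let ?\<phi> = "\<lambda>y. mollifier \<rho> (x - y)"
    have sub2: "cball x \<rho> \<subseteq> cball a R"
      using x by (simp add: cball_subset_cball_iff dist_commute)
    have bc: "bump_class \<rho> x ?\<phi>"
    proof -
      have "bump_class \<rho> x (\<lambda>y. 1 / (LINT z|lborel. flat_exp 0 (\<rho>\<^sup>2 - (z::real^'n) \<bullet> z)) * flat_exp 0 (\<rho>\<^sup>2 - (y - x) \<bullet> (y - x)))"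
        by (intro bump_class.scale bump_class.base)
      moreover have "(x - y) \<bullet> (x - y) = (y - x) \<bullet> (y - x)" for y by (simp add: algebra_simps inner_commute)
      ultimately show ?thesis by (simp add: mollifier_def)
    qed
    then have tf: "test_fun U ?\<phi>"
      by (rule bump_class_test_fun) (use sub sub2 \<rho> in auto)
    have fd: "frechet_derivative ?\<phi> (at y) (axis j 1) = - K1 (x - y) $ j" for y
    proof -
      have "(?\<phi> has_derivative (\<lambda>v. K1 (x - y) \<bullet> (- v))) (at y)"
        by (rule has_derivative_compose[where g = "mollifier \<rho>" and f = "\<lambda>y. x - y", OF _ K1(1)])
           (auto intro!: derivative_eq_intros)
      from frechet_derivative_at[OF this] show ?thesis by (metis inner_axis inner_minus_right mult_1_right inner_real_def mult.commute)
    qed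
    have out: "y \<in> cball a R" if "norm (x - y) < \<rho>" for y
      using sub2 that by (auto simp: dist_norm subset_iff)
    have "A x $ i $ j = (LINT y|lborel. K1 (x - y) $ j * F i y)" by (simp add: A_def conv_def)
    also have "\<dots> = - (LINT y|lborel. indicator U y * (f y $ i * frechet_derivative ?\<phi> (at y) (axis j 1)))"
      unfolding Bochner_Integration.integral_minus[symmetric]
    proof (rule Bochner_Integration.integral_cong[OF refl])
      fix y
      show "K1 (x - y) $ j * F i y = - (indicator U y * (f y $ i * frechet_derivative ?\<phi> (at y) (axis j 1)))"
        using K1(3)[of "x - y"] out[of y] sub unfolding fd F_def by (cases "norm (x - y) < \<rho>") (auto simp: indicator_def)
    qed
    also have "\<dots> = (LINT y|lborel. indicator U y * (D y $ i $ j * ?\<phi> y))"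
      using wd tf unfolding borel_weak_deriv_def by simp
    also have "\<dots> = (LINT y|lborel. ?\<phi> y * (indicator (cball a R) y * D y $ i $ j))"
    proof (rule Bochner_Integration.integral_cong[OF refl])
      fix y
      show "indicator U y * (D y $ i $ j * ?\<phi> y) = ?\<phi> y * (indicator (cball a R) y * D y $ i $ j)"
        using mollifier_support[OF \<rho>, of "x - y"] out[of y] sub by (cases "norm (x - y) < \<rho>") (auto simp: indicator_def)
    qed
    finally show "A x $ i $ j = conv (mollifier \<rho>) (\<lambda>y. indicator (cball a R) y * D y $ i $ j) x"
      by (simp add: conv_def)
  qed
qed

lemma sum_power_le_card_power:
  fixes c :: "'b \<Rightarrow> real"
  assumes "finite P" "\<And>p. p \<in> P \<Longrightarrow> 0 \<le> c p" "0 < n"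
  shows "(\<Sum>p\<in>P. c p) ^ n \<le> real (card P) ^ n * (\<Sum>p\<in>P. c p ^ n)"
proof (cases "P = {}")
  case True
  then show ?thesis using assms(3) by (simp add: zero_power)
next
  case False
  then have "Max (c ` P) \<in> c ` P" using assms(1) by (intro Max_in) auto
  then obtain q where q: "q \<in> P" "c q = Max (c ` P)" by auto
  have "(\<Sum>p\<in>P. c p) \<le> real (card P) * c q"
    using q assms(1) by (intro sum_bounded_above) auto
  then have "(\<Sum>p\<in>P. c p) ^ n \<le> (real (card P) * c q) ^ n"
    using assms(2) by (intro power_mono sum_nonneg) auto
  also have "\<dots> = real (card P) ^ n * c q ^ n" by (simp add: power_mult_distrib)
  also have "c q ^ n \<le> (\<Sum>p\<in>P. c p ^ n)"
    using assms q by (intro member_le_sum) auto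
  finally show ?thesis by (simp add: mult_left_mono)
qed

lemma norm_power_le_entries:
  fixes M :: "real^'n^'m"
  assumes "0 < n"
  shows "norm M ^ n \<le> real (CARD('m) * CARD('n)) ^ n * (\<Sum>i\<in>UNIV. \<Sum>j\<in>UNIV. \<bar>M $ i $ j\<bar> ^ n)"
proof -
  have "norm M \<le> (\<Sum>i\<in>UNIV. norm (M $ i))" unfolding norm_vec_def by (rule L2_set_le_sum) auto
  also have "\<dots> \<le> (\<Sum>i\<in>UNIV. \<Sum>j\<in>UNIV. \<bar>M $ i $ j\<bar>)" by (intro sum_mono norm_le_l1_cart)
  also have "\<dots> = (\<Sum>(i, j)\<in>UNIV. \<bar>M $ i $ j\<bar>)" by (simp add: sum.cartesian_product)
  finally have "norm M ^ n \<le> (\<Sum>(i, j)\<in>UNIV. \<bar>M $ i $ j\<bar>) ^ n" by (rule power_mono) simp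
  also have "\<dots> \<le> real (card (UNIV :: ('m \<times> 'n) set)) ^ n * (\<Sum>p\<in>UNIV. (case p of (i, j) \<Rightarrow> \<bar>M $ i $ j\<bar>) ^ n)"
    by (rule sum_power_le_card_power) (use assms in auto)
  also have "(\<Sum>p\<in>UNIV. (case p of (i, j) \<Rightarrow> \<bar>M $ i $ j\<bar>) ^ n) = (\<Sum>i\<in>UNIV. \<Sum>j\<in>UNIV. \<bar>M $ i $ j\<bar> ^ n)"
    by (simp add: sum.cartesian_product split_def)
  finally show ?thesis by (simp add: card_cartesian_product[of "UNIV :: 'm set" "UNIV :: 'n set", simplified])
qed


section \<open>The Caccioppoli inequality for Sobolev maps\<close>

text \<open>One limit theorem that serves the determinant, the n-th power of the norm and, with
  exponent 1, the norm itself. The error is at most \<open>C\<close> times a distance that tends to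
  0 plus \<open>t\<close> times a fixed integral; \<open>t\<close> is chosen first, and
  \<open>C\<close> depends on it.\<close>

lemma homogeneous_integral_tendsto:
  fixes A :: "nat \<Rightarrow> 'a::euclidean_space \<Rightarrow> 'b::euclidean_space" and H :: "'b \<Rightarrow> real"
  assumes mA[measurable]: "\<And>k. A k \<in> borel_measurable borel" and mD[measurable]: "D \<in> borel_measurable borel"
    and T[measurable]: "T \<in> sets borel"
    and iD: "integrable lborel (\<lambda>x. indicator T x * norm (D x) ^ n)"
    and iA: "\<And>k. integrable lborel (\<lambda>x. indicator T x * norm (A k x - D x) ^ n)"
    and lim: "(\<lambda>k. LINT x|lborel. indicator T x * norm (A k x - D x) ^ n) \<longlonglongrightarrow> 0"
    and H: "continuous_on UNIV H" "\<And>c x. 0 \<le> c \<Longrightarrow> H (c *\<^sub>R x) = c ^ n * H x" and n: "0 < n"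
    and p[measurable]: "\<psi> \<in> borel_measurable borel" "\<And>x. \<bar>\<psi> x\<bar> \<le> indicator T x"
  shows "(\<lambda>k. LINT x|lborel. \<psi> x * H (A k x)) \<longlonglongrightarrow> (LINT x|lborel. \<psi> x * H (D x))"
    and "integrable lborel (\<lambda>x. \<psi> x * H (D x))"
proof -
  have [measurable]: "H \<in> borel_measurable borel" using H(1) by (rule borel_measurable_continuous_onI)
  have H0: "H 0 = 0" using H(2)[of 0 0] n by (simp add: zero_power)
  obtain C0 where C0: "C0 \<ge> 0" "\<And>A B. \<bar>H A - H B\<bar> \<le> C0 * norm (A - B) ^ n + 1 * norm B ^ n"
    using homogeneous_difference_bound[OF H n, of 1] by auto
  have HD: "\<bar>\<psi> x * H y\<bar> \<le> C0 * (indicator T x * norm y ^ n)" for x y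
  proof -
    have "\<bar>H y\<bar> \<le> C0 * norm y ^ n" using C0(2)[of y 0] H0 n by (simp add: zero_power)
    then have "\<bar>\<psi> x\<bar> * \<bar>H y\<bar> \<le> indicator T x * (C0 * norm y ^ n)"
      using p(2)[of x] C0 by (intro mult_mono) auto
    then show ?thesis by (simp add: abs_mult mult_ac)
  qed
  show iHD: "integrable lborel (\<lambda>x. \<psi> x * H (D x))"
    by (rule Bochner_Integration.integrable_bound[OF integrable_mult_right[OF iD, of C0]]) (use HD C0 in auto)
  have diff: "\<bar>\<psi> x * H (A k x) - \<psi> x * H (D x)\<bar> \<le> C * (indicator T x * norm (A k x - D x) ^ n) + t * (indicator T x * norm (D x) ^ n)"
    if "\<And>A B. \<bar>H A - H B\<bar> \<le> C * norm (A - B) ^ n + t * norm B ^ n" for C t k x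
  proof -
    have "\<bar>\<psi> x\<bar> * \<bar>H (A k x) - H (D x)\<bar> \<le> indicator T x * (C * norm (A k x - D x) ^ n + t * norm (D x) ^ n)"
      using p(2)[of x] that[of "A k x" "D x"] by (intro mult_mono) auto
    then show ?thesis by (simp add: abs_mult right_diff_distrib[symmetric] distrib_left mult_ac)
  qed
  have iHA: "integrable lborel (\<lambda>x. \<psi> x * H (A k x))" for k
  proof -
    have "integrable lborel (\<lambda>x. \<psi> x * H (A k x) - \<psi> x * H (D x))"
      by (rule Bochner_Integration.integrable_bound[OF Bochner_Integration.integrable_add[OF integrable_mult_right[OF iA[of k], of C0] integrable_mult_right[OF iD, of 1]]])
         (use order_trans[OF diff[OF C0(2), where k = k] abs_ge_self] in auto)
    from Bochner_Integration.integrable_add[OF this iHD] show ?thesis by simp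
  qed
  show "(\<lambda>k. LINT x|lborel. \<psi> x * H (A k x)) \<longlonglongrightarrow> (LINT x|lborel. \<psi> x * H (D x))"
  proof (rule metric_LIMSEQ_I)
    fix e :: real assume e: "e > 0"
    define J where "J = (LINT x|lborel. indicator T x * norm (D x) ^ n)"
    have J: "J \<ge> 0" unfolding J_def by (intro Bochner_Integration.integral_nonneg) auto
    define t where "t = e / 2 / (J + 1)"
    have t: "t > 0" using e J by (simp add: t_def)
    have tJ: "t * J < e / 2" using e J by (simp add: t_def field_simps)
    obtain C where C: "C \<ge> 0" "\<And>A B. \<bar>H A - H B\<bar> \<le> C * norm (A - B) ^ n + t * norm B ^ n"
      using homogeneous_difference_bound[OF H n t] by auto
    have "e / 2 / (C + 1) > 0" using e C by simp
    from order_tendstoD(2)[OF lim this] obtain N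
      where N: "\<And>k. k \<ge> N \<Longrightarrow> (LINT x|lborel. indicator T x * norm (A k x - D x) ^ n) < e / 2 / (C + 1)"
      by (auto simp: eventually_sequentially)
    have "dist (LINT x|lborel. \<psi> x * H (A k x)) (LINT x|lborel. \<psi> x * H (D x)) < e" if "k \<ge> N" for k
    proof -
      let ?E = "LINT x|lborel. indicator T x * norm (A k x - D x) ^ n"
      have E: "?E \<ge> 0" by (intro Bochner_Integration.integral_nonneg) auto
      have "(LINT x|lborel. \<psi> x * H (A k x)) - (LINT x|lborel. \<psi> x * H (D x)) = (LINT x|lborel. \<psi> x * H (A k x) - \<psi> x * H (D x))"
        using iHA iHD by simp
      also have "\<bar>\<dots>\<bar> \<le> (LINT x|lborel. \<bar>\<psi> x * H (A k x) - \<psi> x * H (D x)\<bar>)" by (rule integral_abs_bound)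
      also have "\<dots> \<le> (LINT x|lborel. C * (indicator T x * norm (A k x - D x) ^ n) + t * (indicator T x * norm (D x) ^ n))"
      proof (rule integral_mono)
        show "integrable lborel (\<lambda>x. C * (indicator T x * norm (A k x - D x) ^ n) + t * (indicator T x * norm (D x) ^ n))"
          by (intro Bochner_Integration.integrable_add integrable_mult_right iA iD)
        show "integrable lborel (\<lambda>x. \<bar>\<psi> x * H (A k x) - \<psi> x * H (D x)\<bar>)" using iHA iHD by simp
      qed (rule diff[OF C(2)])
      also have "\<dots> = C * ?E + t * J"
        using iA[of k] iD by (simp add: J_def)
      also have "\<dots> < e"
      proof -
        have "C * ?E \<le> (C + 1) * ?E" using E by (intro mult_right_mono) auto
        also have "\<dots> \<le> (C + 1) * (e / 2 / (C + 1))" using N[OF that] C by (intro mult_left_mono) auto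
        also have "\<dots> = e / 2" using C by (simp add: field_simps)
        finally show ?thesis using tJ by linarith
      qed
      finally show ?thesis by (simp add: dist_real_def)
    qed
    then show "\<exists>N. \<forall>k\<ge>N. dist (LINT x|lborel. \<psi> x * H (A k x)) (LINT x|lborel. \<psi> x * H (D x)) < e" by blast
  qed
qed

lemma set_integrable_norm_if_power:
  assumes [measurable]: "D \<in> borel_measurable borel" "T \<in> sets borel" and b: "bounded T" and n: "0 < n"
    and i: "integrable lborel (\<lambda>x::'a::euclidean_space. indicator T x * norm (D x) ^ n)"
  shows "integrable lborel (\<lambda>x. indicator T x * norm (D x) :: real)"
proof (rule Bochner_Integration.integrable_bound[of _ "\<lambda>x. indicator T x + indicator T x * norm (D x) ^ n"])
  have "integrable lborel (indicator T :: 'a \<Rightarrow> real)"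
    using b emeasure_bounded_finite[OF b] by (intro integrable_real_indicator) auto
  then show "integrable lborel (\<lambda>x. indicator T x + indicator T x * norm (D x) ^ n :: real)" using i by simp
  show "AE x in lborel. norm (indicator T x * norm (D x) :: real) \<le> norm (indicator T x + indicator T x * norm (D x) ^ n :: real)"
  proof (rule AE_I2)
    fix x
    have "norm (D x) \<le> 1 + norm (D x) ^ n"
      using self_le_power[of "norm (D x)" n] n by (cases "norm (D x) \<le> 1") (auto intro: add_increasing2)
    then show "norm (indicator T x * norm (D x) :: real) \<le> norm (indicator T x + indicator T x * norm (D x) ^ n :: real)"
      by (simp add: indicator_def)
  qed
qed measurable

lemma mollification_sequence:
  fixes f :: "real^'n \<Rightarrow> real^'n" and n :: nat
  assumes wd: "borel_weak_deriv U f D" and sub: "cball a R \<subseteq> U" and R: "0 < R2" "R2 < R" and n: "0 < n"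
    and intf: "integrable lborel (\<lambda>x. indicator (cball a R) x *\<^sub>R f x)"
    and intD: "integrable lborel (\<lambda>x. indicator (cball a R) x * norm (D x) ^ n)"
  obtains g :: "nat \<Rightarrow> 'n \<Rightarrow> real^'n \<Rightarrow> real" and A H
  where "\<And>k i x. (g k i has_derivative (\<lambda>v. A k x $ i \<bullet> v)) (at x)"
    "\<And>k i j x. ((\<lambda>x. A k x $ i $ j) has_derivative (\<lambda>v. H k i j x \<bullet> v)) (at x)"
    "\<And>k i j. continuous_on UNIV (H k i j)" "\<And>k i j l x. H k i j x $ l = H k i l x $ j"
    "\<And>k. integrable lborel (\<lambda>x. indicator (cball a R2) x * norm (A k x - D x) ^ n)"
    "(\<lambda>k. LINT x|lborel. indicator (cball a R2) x * norm (A k x - D x) ^ n) \<longlonglongrightarrow> 0"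
proof -
  \<comment> \<open>All radii are at most \<open>R - R2\<close>, so on \<open>cball a R2\<close>
    every \<open>A k\<close> is the mollification of \<open>D\<close>.\<close>
  define \<rho> where "\<rho> k = (R - R2) / (real k + 1)" for k :: nat
  have \<rho>: "0 < \<rho> k" "\<rho> k \<le> R - R2" for k
    using R by (auto simp: \<rho>_def divide_le_eq mult_left_le mult_le_cancel_left1)
  define w where "w i j y = indicator (cball a R) y * D y $ i $ j" for i j y
  define P where "P k g A H \<longleftrightarrow> (\<forall>i x. (g i has_derivative (\<lambda>v. A x $ i \<bullet> v)) (at x)) \<and>
      (\<forall>i j x. ((\<lambda>x. A x $ i $ j) has_derivative (\<lambda>v. H i j x \<bullet> v)) (at x)) \<and>
      (\<forall>i j. continuous_on UNIV (H i j)) \<and> (\<forall>i j l x. H i j x $ l = H i l x $ j) \<and>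
      (\<forall>i j x. x \<in> cball a (R - \<rho> k) \<longrightarrow> A x $ i $ j = conv (mollifier (\<rho> k)) (w i j) x)"
    for k and g :: "'n \<Rightarrow> real^'n \<Rightarrow> real" and A :: "real^'n \<Rightarrow> real^'n^'n" and H :: "'n \<Rightarrow> 'n \<Rightarrow> real^'n \<Rightarrow> real^'n"
  have "\<exists>g A H. P k g A H" for k
  proof (rule mollification[OF wd sub \<rho>(1)[of k] intf])
    fix g :: "'n \<Rightarrow> real^'n \<Rightarrow> real" and A :: "real^'n \<Rightarrow> real^'n^'n" and H :: "'n \<Rightarrow> 'n \<Rightarrow> real^'n \<Rightarrow> real^'n"
    assume a: "\<And>i x. (g i has_derivative (\<lambda>v. A x $ i \<bullet> v)) (at x)"
      "\<And>i j x. ((\<lambda>x. A x $ i $ j) has_derivative (\<lambda>v. H i j x \<bullet> v)) (at x)"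
      "\<And>i j. continuous_on UNIV (H i j)" "\<And>i j l x. H i j x $ l = H i l x $ j"
      "\<And>i j x. x \<in> cball a (R - \<rho> k) \<Longrightarrow> A x $ i $ j = conv (mollifier (\<rho> k)) (\<lambda>y. indicator (cball a R) y * D y $ i $ j) x"
    have "P k g A H" unfolding P_def w_def[abs_def] by (intro conjI allI impI a)
    then show "\<exists>g A H. P k g A H" by blast
  qed
  then obtain g A H where P: "\<And>k. P k (g k) (A k) (H k)" by metis
  then have gAH: "\<And>k i x. (g k i has_derivative (\<lambda>v. A k x $ i \<bullet> v)) (at x)"
    "\<And>k i j x. ((\<lambda>x. A k x $ i $ j) has_derivative (\<lambda>v. H k i j x \<bullet> v)) (at x)"
    "\<And>k i j. continuous_on UNIV (H k i j)" "\<And>k i j l x. H k i j x $ l = H k i l x $ j"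
    "\<And>k i j x. x \<in> cball a (R - \<rho> k) \<Longrightarrow> A k x $ i $ j = conv (mollifier (\<rho> k)) (w i j) x"
    unfolding P_def by simp_all
  have [measurable]: "D \<in> borel_measurable borel" using wd by (simp add: borel_weak_deriv_def)
  have [measurable]: "cball a r \<in> sets borel" for r by simp
  note mDij[measurable] = measurable_entry[OF \<open>D \<in> borel_measurable borel\<close>]
  have [measurable]: "w i j \<in> borel_measurable borel" for i j unfolding w_def by measurable
  have iD1: "integrable lborel (\<lambda>x. indicator (cball a R) x * norm (D x))"
    by (rule set_integrable_norm_if_power[OF _ _ _ n intD]) auto
  have iw: "integrable lborel (w i j)" for i j
    by (rule Bochner_Integration.integrable_bound[OF iD1]) (auto simp: w_def indicator_def norm_entry_le)
  have iwn: "integrable lborel (\<lambda>x. \<bar>w i j x\<bar> ^ n)" for i j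
    by (rule Bochner_Integration.integrable_bound[OF intD])
       (use n in \<open>auto simp: w_def indicator_def norm_entry_le zero_power intro!: power_mono\<close>)
  have cA: "continuous_on UNIV (A k)" for k
    by (rule continuous_on_matrix[OF has_derivative_everywhere_continuous[OF gAH(2)]])
  then have [measurable]: "A k \<in> borel_measurable borel" for k by (rule borel_measurable_continuous_onI)
  have iA: "integrable lborel (\<lambda>x. indicator (cball a R2) x * norm (A k x - D x) ^ n)" for k
  proof (rule Bochner_Integration.integrable_bound[of _ "\<lambda>x. 2 ^ n * (indicator (cball a R2) x * norm (A k x) ^ n + indicator (cball a R) x * norm (D x) ^ n)"])
    have "integrable lborel (\<lambda>x. indicator (cball a R2) x *\<^sub>R (norm (A k x) ^ n))"
      by (rule borel_integrable_compact) (auto intro!: continuous_intros continuous_on_subset[OF cA])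
    then show "integrable lborel (\<lambda>x. 2 ^ n * (indicator (cball a R2) x * norm (A k x) ^ n + indicator (cball a R) x * norm (D x) ^ n))"
      using intD by simp
    have "norm (A k x - D x) ^ n \<le> 2 ^ n * (norm (A k x) ^ n + norm (D x) ^ n)" for x
      by (rule power_le_sum_powers) (auto intro: norm_triangle_ineq4)
    moreover have "x \<in> cball a R" if "x \<in> cball a R2" for x using that R by simp
    ultimately have "indicator (cball a R2) x * norm (A k x - D x) ^ n \<le>
        2 ^ n * (indicator (cball a R2) x * norm (A k x) ^ n + indicator (cball a R) x * norm (D x) ^ n)" for x
      by (cases "x \<in> cball a R2") auto
    then show "AE x in lborel. norm (indicator (cball a R2) x * norm (A k x - D x) ^ n) \<le>
        norm (2 ^ n * (indicator (cball a R2) x * norm (A k x) ^ n + indicator (cball a R) x * norm (D x) ^ n))"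
      by (intro AE_I2) (simp add: abs_mult)
  qed measurable
  let ?N = "real (CARD('n) * CARD('n)) ^ n"
  have lim: "(\<lambda>k. LINT x|lborel. indicator (cball a R2) x * norm (A k x - D x) ^ n) \<longlonglongrightarrow> 0"
  proof (rule LIMSEQ_I)
    fix e :: real assume e: "e > 0"
    \<comment> \<open>The total error \<open>e / 2\<close> is shared by all matrix entries after
      division by the factor \<open>?N\<close> from \<open>norm_power_le_entries\<close>.\<close>
    define e1 where "e1 = e / 2 / ?N / (real CARD('n) * real CARD('n))"
    have e1: "e1 > 0" using e by (simp add: e1_def)
    define Q where "Q i j r \<longleftrightarrow> (\<integral>\<^sup>+x\<in>cball a R. ennreal (\<bar>conv (mollifier r) (w i j) x - w i j x\<bar> ^ n) \<partial>lborel) < ennreal e1" for i j r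
    have "\<exists>d>0. \<forall>r. 0 < r \<and> r < d \<longrightarrow> Q i j r" for i j
      unfolding Q_def by (rule conv_mollifier_approximates[OF iw _ n iwn e1]) (simp add: w_def)
    then obtain d where d: "\<And>i j. d i j > 0" "\<And>i j r. 0 < r \<Longrightarrow> r < d i j \<Longrightarrow> Q i j r"
      by metis
    define d0 where "d0 = Min (range (\<lambda>(i, j). d i j))"
    have d0: "d0 > 0" "d0 \<le> d i j" for i j
      unfolding d0_def using d(1) by (auto intro!: Min_le)
    obtain N :: nat where N: "(R - R2) / d0 < real N" using reals_Archimedean2 by blast
    have "(LINT x|lborel. indicator (cball a R2) x * norm (A k x - D x) ^ n) \<le> e / 2" if "k \<ge> N" for k
    proof -
      have "(R - R2) / d0 < real k + 1" using N that by linarith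
      then have \<rho>k: "\<rho> k < d0" using d0(1) by (simp add: \<rho>_def field_simps)
      let ?c = "\<lambda>i j x. \<bar>conv (mollifier (\<rho> k)) (w i j) x - w i j x\<bar> ^ n"
      have mc[measurable]: "conv (mollifier (\<rho> k)) (w i j) \<in> borel_measurable borel" for i j
        by (rule borel_measurable_continuous_onI[OF conv_continuous[OF mollifier_continuous[OF \<rho>(1)] mollifier_support[OF \<rho>(1)] iw]])
      have "ennreal (LINT x|lborel. indicator (cball a R2) x * norm (A k x - D x) ^ n) =
          (\<integral>\<^sup>+x. ennreal (indicator (cball a R2) x * norm (A k x - D x) ^ n) \<partial>lborel)"
        using nn_integral_eq_integral[OF iA[of k]] by simp
      also have "\<dots> \<le> (\<integral>\<^sup>+x. ennreal ?N * (\<Sum>i\<in>UNIV. \<Sum>j\<in>UNIV. ennreal (?c i j x) * indicator (cball a R) x) \<partial>lborel)"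
      proof (rule nn_integral_mono)
        fix x
        show "ennreal (indicator (cball a R2) x * norm (A k x - D x) ^ n) \<le>
            ennreal ?N * (\<Sum>i\<in>UNIV. \<Sum>j\<in>UNIV. ennreal (?c i j x) * indicator (cball a R) x)"
        proof (cases "x \<in> cball a R2")
          case True
          then have x: "x \<in> cball a R" "x \<in> cball a (R - \<rho> k)" using R \<rho>(2)[of k] by auto
          have "norm (A k x - D x) ^ n \<le> ?N * (\<Sum>i\<in>UNIV. \<Sum>j\<in>UNIV. \<bar>(A k x - D x) $ i $ j\<bar> ^ n)"
            by (rule norm_power_le_entries[OF n])
          also have "(\<Sum>i\<in>UNIV. \<Sum>j\<in>UNIV. \<bar>(A k x - D x) $ i $ j\<bar> ^ n) = (\<Sum>i\<in>UNIV. \<Sum>j\<in>UNIV. ?c i j x)"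
            using gAH(5)[OF x(2)] x(1) by (simp add: w_def)
          finally have "ennreal (norm (A k x - D x) ^ n) \<le> ennreal (?N * (\<Sum>i\<in>UNIV. \<Sum>j\<in>UNIV. ?c i j x))"
            by (rule ennreal_leI)
          also have "\<dots> = ennreal ?N * (\<Sum>i\<in>UNIV. \<Sum>j\<in>UNIV. ennreal (?c i j x))"
            by (subst ennreal_mult) (auto simp: sum_ennreal sum_nonneg)
          finally show ?thesis using True x(1) by simp
        qed simp
      qed
      also have "\<dots> = ennreal ?N * (\<Sum>i\<in>UNIV. \<Sum>j\<in>UNIV. (\<integral>\<^sup>+x\<in>cball a R. ennreal (?c i j x) \<partial>lborel))"
      proof -
        define F where "F i j x = ennreal (?c i j x) * indicator (cball a R) x" for i j x
        have [measurable]: "F i j \<in> borel_measurable borel" for i j unfolding F_def by measurable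
        show ?thesis unfolding F_def[symmetric] by (simp add: nn_integral_cmult nn_integral_sum)
      qed
      also have "\<dots> \<le> ennreal ?N * (\<Sum>i\<in>(UNIV::'n set). \<Sum>j\<in>(UNIV::'n set). ennreal e1)"
      proof (intro mult_left_mono sum_mono)
        fix i j
        have "\<rho> k < d i j" using \<rho>k d0(2)[of i j] by linarith
        then show "(\<integral>\<^sup>+x\<in>cball a R. ennreal (?c i j x) \<partial>lborel) \<le> ennreal e1"
          using d(2)[OF \<rho>(1), of k i j] by (simp add: Q_def)
      qed simp
      also have "\<dots> = ennreal (?N * (\<Sum>i\<in>(UNIV::'n set). \<Sum>j\<in>(UNIV::'n set). e1))"
        using e1 by (simp add: ennreal_mult ennreal_of_nat_eq_real_of_nat del: of_nat_mult)
      also have "?N * (\<Sum>i\<in>(UNIV::'n set). \<Sum>j\<in>(UNIV::'n set). e1) = e / 2"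
        by (simp add: e1_def)
      finally show ?thesis using e by (simp add: ennreal_le_iff)
    qed
    note small = this
    have nn: "0 \<le> (LINT x|lborel. indicator (cball a R2) x * norm (A k x - D x) ^ n)" for k
      by (intro Bochner_Integration.integral_nonneg) auto
    have half: "norm (y - 0) < e" if "0 \<le> y" "y \<le> e / 2" for y :: real using that e by simp
    show "\<exists>N. \<forall>k\<ge>N. norm ((LINT x|lborel. indicator (cball a R2) x * norm (A k x - D x) ^ n) - 0) < e"
      by (rule exI[of _ N], intro allI impI half nn small)
  qed
  show ?thesis by (rule that[OF gAH(1-4) iA lim])
qed

text \<open>On a bounded set \<open>mult_power_Young\<close> with second factor 1 replaces Hoelder's
  inequality: the term \<open>s * m\<close> is made small by the choice of \<open>s\<close>, then
  the other one by the choice of \<open>k\<close>.\<close>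

lemma L1_tendsto_if_power_tendsto:
  fixes A :: "nat \<Rightarrow> 'a::euclidean_space \<Rightarrow> 'b::euclidean_space"
  assumes [measurable]: "\<And>k. A k \<in> borel_measurable borel" "D \<in> borel_measurable borel" "T \<in> sets borel"
    and bT: "bounded T" and n: "0 < n"
    and iA: "\<And>k. integrable lborel (\<lambda>x. indicator T x * norm (A k x - D x) ^ n)"
    and lim: "(\<lambda>k. LINT x|lborel. indicator T x * norm (A k x - D x) ^ n) \<longlonglongrightarrow> 0"
  shows "\<And>k. integrable lborel (\<lambda>x. indicator T x * norm (A k x - D x) ^ 1 :: real)"
    and "(\<lambda>k. LINT x|lborel. indicator T x * norm (A k x - D x) ^ 1) \<longlonglongrightarrow> (0::real)"
proof -
  have i1: "integrable lborel (\<lambda>x. indicator T x * norm (A k x - D x) :: real)" for k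
    by (rule set_integrable_norm_if_power[OF _ _ bT n iA]) measurable
  then show "integrable lborel (\<lambda>x. indicator T x * norm (A k x - D x) ^ 1 :: real)" for k by simp
  define m where "m = measure lborel T"
  have m0: "m \<ge> 0" by (simp add: m_def)
  have iT: "integrable lborel (indicator T :: 'a \<Rightarrow> real)"
    using emeasure_bounded_finite[OF bT] by (intro integrable_real_indicator) auto
  define E where "E k = (LINT x|lborel. indicator T x * norm (A k x - D x) ^ n)" for k
  have le: "(LINT x|lborel. indicator T x * norm (A k x - D x)) \<le> E k / s ^ (n - 1) + s * m" if s: "s > 0" for s k
  proof -
    have "(LINT x|lborel. indicator T x * norm (A k x - D x)) \<le>
        (LINT x|lborel. (indicator T x * norm (A k x - D x) ^ n) / s ^ (n - 1) + s * indicator T x)"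
    proof (rule integral_mono[OF i1])
      show "integrable lborel (\<lambda>x. (indicator T x * norm (A k x - D x) ^ n) / s ^ (n - 1) + s * indicator T x)"
        by (intro Bochner_Integration.integrable_add integrable_divide integrable_mult_right iA iT)
      fix x
      have "norm (A k x - D x) * 1 ^ (n - 1) \<le> norm (A k x - D x) ^ n / s ^ (n - 1) + s * 1 ^ n"
        using s n by (intro mult_power_Young) auto
      then show "indicator T x * norm (A k x - D x) \<le> (indicator T x * norm (A k x - D x) ^ n) / s ^ (n - 1) + s * indicator T x"
        by (simp add: indicator_def)
    qed
    also have "\<dots> = E k / s ^ (n - 1) + s * m"
      using iA[of k] iT by (simp add: E_def m_def)
    finally show ?thesis .
  qed
  show "(\<lambda>k. LINT x|lborel. indicator T x * norm (A k x - D x) ^ 1) \<longlonglongrightarrow> (0::real)"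
  proof (rule LIMSEQ_I)
    fix e :: real assume e: "e > 0"
    define s where "s = e / 2 / (m + 1)"
    have s: "s > 0" using e m0 by (simp add: s_def)
    have sm: "s * m < e / 2" using e m0 by (simp add: s_def field_simps)
    have "e / 2 * s ^ (n - 1) > 0" using e s by simp
    from order_tendstoD(2)[OF lim this] obtain N where N: "\<And>k. k \<ge> N \<Longrightarrow> E k < e / 2 * s ^ (n - 1)"
      by (auto simp: eventually_sequentially E_def)
    have "(LINT x|lborel. indicator T x * norm (A k x - D x)) < e" if "k \<ge> N" for k
    proof -
      have "E k / s ^ (n - 1) < e / 2" using N[OF that] s by (simp add: field_simps)
      then show ?thesis using le[OF s, of k] sm by linarith
    qed
    moreover have nn: "0 \<le> (LINT x|lborel. indicator T x * norm (A k x - D x))" for k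
      by (intro Bochner_Integration.integral_nonneg) auto
    ultimately show "\<exists>N. \<forall>k\<ge>N. norm ((LINT x|lborel. indicator T x * norm (A k x - D x) ^ 1) - 0) < e"
      by (intro exI[of _ N]) simp
  qed
qed

text \<open>The Caccioppoli and Poincare inequalities are combined before the limit is taken. The
  approximating functions \<open>g k i\<close> and the constants \<open>c\<close>, which vary with
  \<open>k\<close>, have then disappeared, and only integrals of \<open>A k\<close> remain to
  converge.\<close>

lemma weak_Caccioppoli:
  fixes f :: "real^'n \<Rightarrow> real^'n"
  assumes wd: "borel_weak_deriv U f D" and sub: "cball a R' \<subseteq> U"
    and r: "0 < r" "r < R" "0 < \<delta>" "R + \<delta> < R'"
    and intf: "integrable lborel (\<lambda>x. indicator (cball a R') x *\<^sub>R f x)"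
    and intD: "integrable lborel (\<lambda>x. indicator (cball a R') x * norm (D x) ^ CARD('n))"
    and d\<phi>: "\<And>x. (\<phi> has_derivative (\<lambda>v. G x \<bullet> v)) (at x)" and cG: "continuous_on UNIV G"
    and \<phi>0: "\<And>x. norm (x - a) \<ge> R \<Longrightarrow> \<phi> x = 0" and \<phi>1: "\<And>x. \<bar>\<phi> x\<bar> \<le> 1"
    and G0: "\<And>x. norm (x - a) \<le> r \<Longrightarrow> G x = 0" "\<And>x. norm (x - a) \<ge> R \<Longrightarrow> G x = 0"
    and Gb: "\<And>x. norm (G x) \<le> B" and t: "0 < t"
  shows "integrable lborel (\<lambda>x. \<phi> x * det (D x))"
    and "(LINT x|lborel. \<phi> x * det (D x)) \<le> fact CARD('n) * B *
    (2 ^ CARD('n) * (\<delta> ^ CARD('n) * (LINT x:ball a (R + \<delta>)|lborel. norm (D x) ^ CARD('n))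
       + measure lborel (ball a R) * (R / measure lborel (ball (0::real^'n) \<delta>) * (LINT x:ball a (R + \<delta>)|lborel. norm (D x))) ^ CARD('n))
     / t ^ (CARD('n) - 1) + t * (LINT x:ball a R - cball a r|lborel. norm (D x) ^ CARD('n)))"
proof -
  let ?n = "CARD('n)"
  have n: "0 < ?n" by simp
  define R2 where "R2 = R + \<delta>"
  let ?T = "cball a R2"
  obtain g :: "nat \<Rightarrow> 'n \<Rightarrow> real^'n \<Rightarrow> real" and A H
    where gA: "\<And>k i x. (g k i has_derivative (\<lambda>v. A k x $ i \<bullet> v)) (at x)"
    and AH: "\<And>k i j x. ((\<lambda>x. A k x $ i $ j) has_derivative (\<lambda>v. H k i j x \<bullet> v)) (at x)"
    and cH: "\<And>k i j. continuous_on UNIV (H k i j)" and sym: "\<And>k i j l x. H k i j x $ l = H k i l x $ j"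
    and iA: "\<And>k. integrable lborel (\<lambda>x. indicator ?T x * norm (A k x - D x) ^ ?n)"
    and lim: "(\<lambda>k. LINT x|lborel. indicator ?T x * norm (A k x - D x) ^ ?n) \<longlonglongrightarrow> 0"
  proof (rule mollification_sequence[OF wd sub _ _ n intf intD])
    show "0 < R2" "R2 < R'" using r by (auto simp: R2_def)
  qed blast
  have [measurable]: "D \<in> borel_measurable borel" using wd by (simp add: borel_weak_deriv_def)
  have cA: "continuous_on UNIV (A k)" for k
    by (rule continuous_on_matrix[OF has_derivative_everywhere_continuous[OF AH]])
  have mA[measurable]: "A k \<in> borel_measurable borel" for k using cA by (rule borel_measurable_continuous_onI)
  have mT[measurable]: "?T \<in> sets borel" by simp
  have iDT: "integrable lborel (\<lambda>x. indicator ?T x * norm (D x) ^ ?n)"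
  proof (rule Bochner_Integration.integrable_bound[OF intD])
    have "?T \<subseteq> cball a R'" using r by (auto simp: R2_def)
    then show "AE x in lborel. norm (indicator ?T x * norm (D x) ^ ?n) \<le> norm (indicator (cball a R') x * norm (D x) ^ ?n)"
      by (intro AE_I2) (auto simp: indicator_def)
  qed measurable
  note iD1 = set_integrable_norm_if_power[OF _ mT bounded_cball n iDT]
  have c\<phi>: "continuous_on UNIV \<phi>"
    by (rule has_derivative_everywhere_continuous[OF d\<phi>])
  then have m\<phi>: "\<phi> \<in> borel_measurable borel" by (rule borel_measurable_continuous_onI)
  have \<phi>T: "\<bar>\<phi> x\<bar> \<le> indicator ?T x" for x
  proof (cases "x \<in> ?T")
    case False
    then have "norm (x - a) \<ge> R" using r by (simp add: R2_def dist_norm norm_minus_commute)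
    then show ?thesis using \<phi>0 by simp
  qed (use \<phi>1 in simp)
  have cdet: "continuous_on UNIV (det :: real^'n^'n \<Rightarrow> real)"
    unfolding det_def[abs_def] by (intro continuous_intros)
  have hdet: "det (c *\<^sub>R M) = c ^ ?n * det M" for c and M :: "real^'n^'n"
  proof -
    have "det (c *\<^sub>R M) = (\<Sum>p\<in>{p. p permutes UNIV}. c ^ ?n * (of_int (sign p) * (\<Prod>i\<in>UNIV. M $ i $ p i)))"
      unfolding det_def by (intro sum.cong) (auto simp: prod.distrib)
    then show ?thesis unfolding det_def by (simp add: sum_distrib_left)
  qed
  note L = homogeneous_integral_tendsto[OF mA \<open>D \<in> borel_measurable borel\<close> mT iDT iA lim]
  have Ldet: "(\<lambda>k. LINT x|lborel. \<phi> x * det (A k x)) \<longlonglongrightarrow> (LINT x|lborel. \<phi> x * det (D x))"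
    by (rule L(1)[OF cdet hdet n m\<phi> \<phi>T])
  show "integrable lborel (\<lambda>x. \<phi> x * det (D x))"
    by (rule L(2)[OF cdet hdet n m\<phi> \<phi>T])
  have Ln: "(\<lambda>k. LINT x:S|lborel. norm (A k x) ^ ?n) \<longlonglongrightarrow> (LINT x:S|lborel. norm (D x) ^ ?n)"
    if "S \<in> sets borel" "S \<subseteq> ?T" for S
  proof -
    have "(\<lambda>k. LINT x|lborel. indicator S x * norm (A k x) ^ ?n) \<longlonglongrightarrow> (LINT x|lborel. indicator S x * norm (D x) ^ ?n)"
    proof (rule L(1)[where H = "\<lambda>M. norm M ^ ?n"])
      show "continuous_on UNIV (\<lambda>M::real^'n^'n. norm M ^ ?n)" by (intro continuous_intros)
      show "\<bar>indicator S x :: real\<bar> \<le> indicator ?T x" for x using that by (auto simp: indicator_def)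
    qed (use that in \<open>auto simp: power_mult_distrib\<close>)
    then show ?thesis by (simp add: set_lebesgue_integral_def)
  qed
  have L1: "(\<lambda>k. LINT x:S|lborel. norm (A k x)) \<longlonglongrightarrow> (LINT x:S|lborel. norm (D x))"
    if "S \<in> sets borel" "S \<subseteq> ?T" for S
  proof -
    have "(\<lambda>k. LINT x|lborel. indicator S x * norm (A k x)) \<longlonglongrightarrow> (LINT x|lborel. indicator S x * norm (D x))"
    proof (rule homogeneous_integral_tendsto(1)[OF mA _ mT, where n = 1 and H = norm])
      show "integrable lborel (\<lambda>x. indicator ?T x * norm (D x) ^ 1)" using iD1 by simp
      show "integrable lborel (\<lambda>x. indicator ?T x * norm (A k x - D x) ^ 1)" for k
        by (rule L1_tendsto_if_power_tendsto(1)[OF mA _ mT bounded_cball n iA lim]) measurable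
      show "(\<lambda>k. LINT x|lborel. indicator ?T x * norm (A k x - D x) ^ 1) \<longlonglongrightarrow> 0"
        by (rule L1_tendsto_if_power_tendsto(2)[OF mA _ mT bounded_cball n iA lim]) measurable
      show "continuous_on UNIV (norm :: real^'n^'n \<Rightarrow> real)" by (intro continuous_intros)
      show "\<bar>indicator S x :: real\<bar> \<le> indicator ?T x" for x using that by (auto simp: indicator_def)
    qed (use that in \<open>auto simp: power_mult_distrib\<close>)
    then show ?thesis by (simp add: set_lebesgue_integral_def)
  qed
  have B0: "0 \<le> B" using Gb[of 0] norm_ge_zero order_trans by blast
  let ?bd = "\<lambda>In I1 Ia. fact ?n * B * (2 ^ ?n * (\<delta> ^ ?n * In
       + measure lborel (ball a R) * (R / measure lborel (ball (0::real^'n) \<delta>) * I1) ^ ?n)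
     / t ^ (?n - 1) + t * Ia)"
  have le: "(LINT x|lborel. \<phi> x * det (A k x)) \<le> ?bd (LINT x:ball a (R + \<delta>)|lborel. norm (A k x) ^ ?n)
      (LINT x:ball a (R + \<delta>)|lborel. norm (A k x)) (LINT x:ball a R - cball a r|lborel. norm (A k x) ^ ?n)" for k
  proof -
    \<comment> \<open>Any component of the map will do; an index type is never empty.\<close>
    define i :: 'n where "i = undefined"
    have cAi: "continuous_on UNIV (\<lambda>x. A k x $ i)" by (intro continuous_intros cA)
    obtain c where c: "(LINT x:ball a R|lborel. \<bar>g k i x - c\<bar> ^ ?n) \<le> 2 ^ ?n * (\<delta> ^ ?n * (LINT x:ball a (R + \<delta>)|lborel. norm (A k x $ i) ^ ?n)
     + measure lborel (ball a R) * (R / measure lborel (ball (0::real^'n) \<delta>) * (LINT x:ball a (R + \<delta>)|lborel. norm (A k x $ i))) ^ ?n)"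
      using smooth_Poincare[OF gA[of k i] cAi, of R \<delta> a ?n] r by auto
    have bdd: "bounded (ball a (R + \<delta>))" "ball a (R + \<delta>) \<in> sets borel" by auto
    have In: "(LINT x:ball a (R + \<delta>)|lborel. norm (A k x $ i) ^ ?n) \<le> (LINT x:ball a (R + \<delta>)|lborel. norm (A k x) ^ ?n)"
      by (intro set_integral_mono continuous_set_integrable_bounded continuous_intros cA bdd power_mono Finite_Cartesian_Product.norm_nth_le) auto
    have I1: "(LINT x:ball a (R + \<delta>)|lborel. norm (A k x $ i)) \<le> (LINT x:ball a (R + \<delta>)|lborel. norm (A k x))"
      by (intro set_integral_mono continuous_set_integrable_bounded continuous_intros cA bdd Finite_Cartesian_Product.norm_nth_le)
    have I10: "0 \<le> (LINT x:ball a (R + \<delta>)|lborel. norm (A k x $ i))"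
      unfolding set_lebesgue_integral_def by (intro Bochner_Integration.integral_nonneg) auto
    have "(LINT x|lborel. \<phi> x * det (A k x)) \<le> fact ?n * B *
      ((LINT x:ball a R|lborel. \<bar>g k i x - c\<bar> ^ ?n) / t ^ (?n - 1) +
       t * (LINT x:ball a R - cball a r|lborel. norm (A k x) ^ ?n))"
      by (rule smooth_Caccioppoli[OF gA AH cH sym r(1,2) d\<phi> cG \<phi>0 G0 Gb t])
    also have "\<dots> \<le> fact ?n * B * ((2 ^ ?n * (\<delta> ^ ?n * (LINT x:ball a (R + \<delta>)|lborel. norm (A k x) ^ ?n)
     + measure lborel (ball a R) * (R / measure lborel (ball (0::real^'n) \<delta>) * (LINT x:ball a (R + \<delta>)|lborel. norm (A k x))) ^ ?n)) / t ^ (?n - 1) +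
       t * (LINT x:ball a R - cball a r|lborel. norm (A k x) ^ ?n))"
    proof (intro mult_left_mono add_right_mono divide_right_mono order_trans[OF c] add_mono power_mono In I1)
    qed (use B0 t r I10 in auto)
    finally show ?thesis .
  qed
  have sub1: "ball a (R + \<delta>) \<subseteq> ?T" "ball a R - cball a r \<subseteq> ?T" using r by (auto simp: R2_def)
  have "(\<lambda>k. ?bd (LINT x:ball a (R + \<delta>)|lborel. norm (A k x) ^ ?n)
      (LINT x:ball a (R + \<delta>)|lborel. norm (A k x)) (LINT x:ball a R - cball a r|lborel. norm (A k x) ^ ?n))
    \<longlonglongrightarrow> ?bd (LINT x:ball a (R + \<delta>)|lborel. norm (D x) ^ ?n)
      (LINT x:ball a (R + \<delta>)|lborel. norm (D x)) (LINT x:ball a R - cball a r|lborel. norm (D x) ^ ?n)"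
    by (intro tendsto_intros Ln L1 sub1) (use t in auto)
  from LIMSEQ_le[OF Ldet this] le
  show "(LINT x|lborel. \<phi> x * det (D x)) \<le> ?bd (LINT x:ball a (R + \<delta>)|lborel. norm (D x) ^ ?n)
      (LINT x:ball a (R + \<delta>)|lborel. norm (D x)) (LINT x:ball a R - cball a r|lborel. norm (D x) ^ ?n)"
    by blast
qed

section \<open>From the Euclidean matrix norm to the operator norm\<close>

definition opnorm :: "real^'n^'m \<Rightarrow> real" where "opnorm M = onorm ((*v) M)"

lemma opnorm_nonneg[simp]: "0 \<le> opnorm M"
  unfolding opnorm_def by (intro onorm_pos_le matrix_vector_mul_bounded_linear)

lemma opnorm_le_norm: "opnorm (M::real^'n^'m) \<le> real CARD('m) * real CARD('n) * norm M"
  unfolding opnorm_def by (rule onorm_le_matrix_component) (rule norm_entry_le)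

lemma norm_le_opnorm: "norm (M::real^'n^'m) \<le> real CARD('m) * real CARD('n) * opnorm M"
proof -
  have "norm M \<le> (\<Sum>i\<in>UNIV. norm (M $ i))" unfolding norm_vec_def by (rule L2_set_le_sum) auto
  also have "\<dots> \<le> (\<Sum>i\<in>UNIV. \<Sum>j\<in>UNIV. \<bar>M $ i $ j\<bar>)" by (intro sum_mono norm_le_l1_cart)
  also have "\<dots> \<le> (\<Sum>i\<in>(UNIV::'m set). \<Sum>j\<in>(UNIV::'n set). opnorm M)"
    unfolding opnorm_def by (intro sum_mono matrix_component_le_onorm)
  finally show ?thesis by simp
qed

lemma opnorm_diff: "\<bar>opnorm A - opnorm B\<bar> \<le> opnorm (A - B)"
proof -
  have tri: "opnorm A \<le> opnorm B + opnorm (A - B)" for A B :: "real^'n^'m"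
  proof -
    have "onorm (\<lambda>x. B *v x + (A - B) *v x) \<le> onorm ((*v) B) + onorm ((*v) (A - B))"
      by (intro onorm_triangle matrix_vector_mul_bounded_linear)
    then show ?thesis by (simp add: opnorm_def matrix_vector_mult_diff_rdistrib)
  qed
  have "opnorm (B - A) = opnorm (A - B)"
  proof -
    have "(\<lambda>x. (B - A) *v x) = (\<lambda>x. - ((A - B) *v x))" by (simp add: matrix_vector_mult_diff_rdistrib)
    then show ?thesis unfolding opnorm_def by (simp add: onorm_neg)
  qed
  with tri[of A B] tri[of B A] show ?thesis by linarith
qed

lemma continuous_opnorm: "continuous_on UNIV (opnorm :: real^'n^'m \<Rightarrow> real)"
proof -
  let ?C = "real CARD('m) * real CARD('n)"
  have "dist (opnorm A) (opnorm B) \<le> ?C * dist A B" for A B :: "real^'n^'m"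
    using opnorm_diff[of A B] opnorm_le_norm[of "A - B"] by (simp add: dist_norm)
  then have "?C-lipschitz_on UNIV (opnorm :: real^'n^'m \<Rightarrow> real)" by (intro lipschitz_onI) auto
  then show ?thesis by (rule lipschitz_on_continuous_on)
qed

lemma measurable_opnorm[measurable]: "opnorm \<in> borel_measurable borel"
  by (rule borel_measurable_continuous_onI[OF continuous_opnorm])

lemma measure_ball_scale:
  assumes "0 \<le> r"
  shows "measure lborel (ball (a::'a::euclidean_space) r) = measure lborel (ball (0::'a) 1) * r ^ DIM('a)"
  using content_ball[OF assms, of a] content_ball[of 1 "0::'a"] by simp

text \<open>The factorial comes from \<open>det_row_bound\<close>, 8 from the gradient of the
  cutoff, the power of \<open>n * n\<close> from \<open>norm_le_opnorm\<close> and
  \<open>2 ^ n\<close> from \<open>smooth_Poincare\<close>. The last bracket dominates the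
  coefficients of all three terms, so that one constant can be pulled out.\<close>

definition caccioppoli_const :: "'n::finite itself \<Rightarrow> real" where
  "caccioppoli_const _ = fact CARD('n) * 8 * (real CARD('n) * real CARD('n)) ^ CARD('n) *
     (2 ^ CARD('n) * (1 + (1 / measure lborel (ball (0::real^'n) 1)) ^ (CARD('n) - 1)))"

lemma caccioppoli_const_pos: "0 < caccioppoli_const TYPE('n::finite)"
  unfolding caccioppoli_const_def
  by (intro mult_pos_pos) (auto intro!: add_pos_nonneg zero_less_power)

text \<open>Quasiregularity bounds the n-th power of the operator norm by
  \<open>K * det (D x)\<close>, which is therefore nonnegative almost everywhere on
  \<open>U\<close>. So the integral over the small ball is at most \<open>K\<close> times that of
  \<open>\<phi> x * det (D x)\<close>, the quantity estimated by
  \<open>weak_Caccioppoli\<close>.\<close>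

lemma quasiregular_Caccioppoli:
  fixes f :: "real^'n \<Rightarrow> real^'n"
  assumes wd: "borel_weak_deriv U f D" and sub: "cball a R' \<subseteq> U" and K: "0 \<le> K"
    and qr: "AE x in lborel. x \<in> U \<longrightarrow> opnorm (D x) ^ CARD('n) \<le> K * det (D x)"
    and r: "0 < r" "r < R" "0 < \<delta>" "R + \<delta> < R'" and t: "0 < t"
    and intf: "integrable lborel (\<lambda>x. indicator (cball a R') x *\<^sub>R f x)"
    and intD: "integrable lborel (\<lambda>x. indicator (cball a R') x * opnorm (D x) ^ CARD('n))"
  shows "(LINT x:ball a r|lborel. opnorm (D x) ^ CARD('n)) \<le> K * caccioppoli_const TYPE('n) / (R - r) *
     ((\<delta> ^ CARD('n) * (LINT x:ball a (R + \<delta>)|lborel. opnorm (D x) ^ CARD('n))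
       + (R\<^sup>2 / \<delta> ^ CARD('n)) ^ CARD('n) * (LINT x:ball a (R + \<delta>)|lborel. opnorm (D x)) ^ CARD('n))
     / t ^ (CARD('n) - 1) + t * (LINT x:ball a R - ball a r|lborel. opnorm (D x) ^ CARD('n)))"
proof -
  let ?n = "CARD('n)"
  define N where "N = real ?n * real ?n"
  define v where "v = measure lborel (ball (0::real^'n) 1)"
  have n: "0 < ?n" by simp
  have N: "N \<ge> 1" unfolding N_def by (simp add: mult_ge1_I Suc_leI)
  have v: "v > 0" by (simp add: v_def)
  have mD[measurable]: "D \<in> borel_measurable borel" using wd by (simp add: borel_weak_deriv_def)
  have mB[measurable]: "ball a s \<in> sets borel" "cball a s \<in> sets borel" for s by auto
  have le: "norm (D x) \<le> N * opnorm (D x)" for x using norm_le_opnorm[of "D x"] by (simp add: N_def)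
  have len: "norm (D x) ^ ?n \<le> N ^ ?n * opnorm (D x) ^ ?n" for x
    using power_mono[OF le, of x ?n] by (simp add: power_mult_distrib)
  have intDn: "integrable lborel (\<lambda>x. indicator (cball a R') x * norm (D x) ^ ?n)"
    by (rule Bochner_Integration.integrable_bound[OF integrable_mult_right[OF intD, of "N ^ ?n"]])
       (use len N in \<open>auto simp: indicator_def abs_mult\<close>)
  have siW: "set_integrable lborel S (\<lambda>x. opnorm (D x) ^ ?n)" "set_integrable lborel S (\<lambda>x. norm (D x) ^ ?n)"
    if "S \<in> sets borel" "S \<subseteq> cball a R'" for S
  proof -
    have "set_integrable lborel (cball a R') (\<lambda>x. opnorm (D x) ^ ?n)" "set_integrable lborel (cball a R') (\<lambda>x. norm (D x) ^ ?n)"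
      using intD intDn by (auto simp: set_integrable_def)
    then show "set_integrable lborel S (\<lambda>x. opnorm (D x) ^ ?n)" "set_integrable lborel S (\<lambda>x. norm (D x) ^ ?n)"
      using that by (auto intro: set_integrable_subset)
  qed
  have iW1: "integrable lborel (\<lambda>x. indicator (cball a R') x * norm (opnorm (D x)))"
    by (rule set_integrable_norm_if_power[OF _ _ _ n]) (use intD in auto)
  have iD1: "integrable lborel (\<lambda>x. indicator (cball a R') x * norm (D x))"
    by (rule set_integrable_norm_if_power[OF _ _ _ n intDn]) auto
  have siW1: "set_integrable lborel S (\<lambda>x. opnorm (D x))" "set_integrable lborel S (\<lambda>x. norm (D x))"
    if "S \<in> sets borel" "S \<subseteq> cball a R'" for S
  proof -
    have "set_integrable lborel (cball a R') (\<lambda>x. opnorm (D x))" "set_integrable lborel (cball a R') (\<lambda>x. norm (D x))"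
      using iW1 iD1 by (auto simp: set_integrable_def)
    then show "set_integrable lborel S (\<lambda>x. opnorm (D x))" "set_integrable lborel S (\<lambda>x. norm (D x))"
      using that by (auto intro: set_integrable_subset)
  qed
  have s1: "ball a (R + \<delta>) \<subseteq> cball a R'" "ball a R - cball a r \<subseteq> cball a R'" "ball a R - ball a r \<subseteq> cball a R'" "ball a r \<subseteq> cball a R'"
    using r by auto
  obtain \<phi> :: "real^'n \<Rightarrow> real" and G
    where d\<phi>: "\<And>x. (\<phi> has_derivative (\<lambda>v. G x \<bullet> v)) (at x)" and cG: "continuous_on UNIV G"
    and \<phi>: "\<And>x. 0 \<le> \<phi> x" "\<And>x. \<phi> x \<le> 1" "\<And>x. norm (x - a) \<le> r \<Longrightarrow> \<phi> x = 1"
    and \<phi>0: "\<And>x. norm (x - a) \<ge> R \<Longrightarrow> \<phi> x = 0"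
    and G0: "\<And>x. norm (x - a) \<le> r \<Longrightarrow> G x = 0" "\<And>x. norm (x - a) \<ge> R \<Longrightarrow> G x = 0"
    and Gb: "\<And>x. norm (G x) \<le> 8 / (R - r)"
    using cutoff_exists[OF r(1,2), of a] by metis
  have \<phi>1: "\<bar>\<phi> x\<bar> \<le> 1" for x using \<phi>(1,2)[of x] by simp
  note cac = weak_Caccioppoli[OF wd sub r intf intDn d\<phi> cG \<phi>0 \<phi>1 G0 Gb t]
  let ?In = "LINT x:ball a (R + \<delta>)|lborel. opnorm (D x) ^ ?n"
  let ?I1 = "LINT x:ball a (R + \<delta>)|lborel. opnorm (D x)"
  let ?Ia = "LINT x:ball a R - ball a r|lborel. opnorm (D x) ^ ?n"
  have nn: "0 \<le> ?In" "0 \<le> ?I1" "0 \<le> ?Ia"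
    unfolding set_lebesgue_integral_def by (auto intro!: Bochner_Integration.integral_nonneg)
  have "(LINT x:ball a r|lborel. opnorm (D x) ^ ?n) \<le> (LINT x|lborel. K * (\<phi> x * det (D x)))"
    unfolding set_lebesgue_integral_def
  proof (rule integral_mono_AE)
    show "integrable lborel (\<lambda>x. indicator (ball a r) x *\<^sub>R opnorm (D x) ^ ?n)"
      using siW(1)[of "ball a r"] s1(4) by (simp add: set_integrable_def)
    show "integrable lborel (\<lambda>x. K * (\<phi> x * det (D x)))" using cac(1) by simp
    show "AE x in lborel. indicator (ball a r) x *\<^sub>R opnorm (D x) ^ ?n \<le> K * (\<phi> x * det (D x))"
      using qr
    proof eventually_elim
      case (elim x)
      show ?case
      proof (cases "norm (x - a) < R")
        case True
        then have "x \<in> cball a R'" using r by (simp add: dist_norm norm_minus_commute)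
        then have w: "opnorm (D x) ^ ?n \<le> K * det (D x)" using elim sub by auto
        have "indicator (ball a r) x \<le> \<phi> x"
          using \<phi>(1)[of x] \<phi>(3)[of x] by (auto simp: indicator_def dist_norm norm_minus_commute)
        then have "indicator (ball a r) x * opnorm (D x) ^ ?n \<le> \<phi> x * (K * det (D x))"
          using w \<phi>(1) by (intro mult_mono) auto
        then show ?thesis by (simp add: mult_ac)
      next
        case False
        then have "x \<notin> ball a r" using r by (simp add: dist_norm norm_minus_commute)
        then show ?thesis using \<phi>0 False by simp
      qed
    qed
  qed
  also have "\<dots> = K * (LINT x|lborel. \<phi> x * det (D x))" by simp
  also have "\<dots> \<le> K * (fact ?n * (8 / (R - r)) * (2 ^ ?n * (\<delta> ^ ?n * (N ^ ?n * ?In)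
       + measure lborel (ball a R) * (R / measure lborel (ball (0::real^'n) \<delta>) * (N * ?I1)) ^ ?n) / t ^ (?n - 1) + t * (N ^ ?n * ?Ia)))"
  proof (intro mult_left_mono[OF _ K] order_trans[OF cac(2)] mult_left_mono add_mono divide_right_mono power_mono)
    show "(LINT x:ball a (R + \<delta>)|lborel. norm (D x) ^ ?n) \<le> N ^ ?n * ?In"
      unfolding set_integral_mult_right[symmetric] by (intro set_integral_mono set_integrable_mult_right siW len mB s1)
    show "(LINT x:ball a (R + \<delta>)|lborel. norm (D x)) \<le> N * ?I1"
      unfolding set_integral_mult_right[symmetric] by (intro set_integral_mono set_integrable_mult_right siW1 le mB s1)
    \<comment> \<open>Adding the sphere of radius \<open>r\<close> to the annulus turns it into the
      difference of two open balls, the form used for hole filling.\<close>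
    have "(LINT x:ball a R - cball a r|lborel. norm (D x) ^ ?n) \<le> (LINT x:ball a R - cball a r|lborel. N ^ ?n * opnorm (D x) ^ ?n)"
      by (intro set_integral_mono set_integrable_mult_right siW len sets.Diff mB s1)
    also have "\<dots> \<le> (LINT x:ball a R - ball a r|lborel. N ^ ?n * opnorm (D x) ^ ?n)"
      unfolding set_lebesgue_integral_def
    proof (rule integral_mono)
      have "set_integrable lborel (ball a R - ball a r) (\<lambda>x. N ^ ?n * opnorm (D x) ^ ?n)"
        by (intro set_integrable_mult_right siW sets.Diff mB s1)
      then show "integrable lborel (\<lambda>x. indicator (ball a R - ball a r) x *\<^sub>R (N ^ ?n * opnorm (D x) ^ ?n))"
        by (simp add: set_integrable_def)
      have "set_integrable lborel (ball a R - cball a r) (\<lambda>x. N ^ ?n * opnorm (D x) ^ ?n)"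
        by (intro set_integrable_mult_right siW sets.Diff mB s1)
      then show "integrable lborel (\<lambda>x. indicator (ball a R - cball a r) x *\<^sub>R (N ^ ?n * opnorm (D x) ^ ?n))"
        by (simp add: set_integrable_def)
      fix x
      show "indicator (ball a R - cball a r) x *\<^sub>R (N ^ ?n * opnorm (D x) ^ ?n) \<le> indicator (ball a R - ball a r) x *\<^sub>R (N ^ ?n * opnorm (D x) ^ ?n)"
        using N by (intro scaleR_right_mono) (auto simp: indicator_def)
    qed
    finally show "(LINT x:ball a R - cball a r|lborel. norm (D x) ^ ?n) \<le> N ^ ?n * ?Ia" by simp
    show "0 \<le> R / measure lborel (ball (0::real^'n) \<delta>) * (LINT x:ball a (R + \<delta>)|lborel. norm (D x))"
      using r unfolding set_lebesgue_integral_def by (auto intro!: Bochner_Integration.integral_nonneg mult_nonneg_nonneg)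
  qed (use r t in \<open>auto simp: set_lebesgue_integral_def intro!: Bochner_Integration.integral_nonneg\<close>)
  also have "measure lborel (ball a R) * (R / measure lborel (ball (0::real^'n) \<delta>) * (N * ?I1)) ^ ?n =
      (1 / v) ^ (?n - 1) * N ^ ?n * ((R\<^sup>2 / \<delta> ^ ?n) ^ ?n * ?I1 ^ ?n)"
  proof -
    have "measure lborel (ball a R) = v * R ^ ?n" "measure lborel (ball (0::real^'n) \<delta>) = v * \<delta> ^ ?n"
      using measure_ball_scale[of R a] measure_ball_scale[of \<delta> "0::real^'n"] r by (simp_all add: v_def)
    moreover have "v * (1 / v) ^ ?n = (1 / v) ^ (?n - 1)"
      using v by (cases ?n) auto
    moreover have "v * R ^ ?n * (R / (v * \<delta> ^ ?n) * (N * ?I1)) ^ ?n =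
        (v * (1 / v) ^ ?n) * N ^ ?n * ((R * R / \<delta> ^ ?n) ^ ?n * ?I1 ^ ?n)"
      using v r by (simp add: power_mult_distrib power_divide mult_ac)
    ultimately show ?thesis by (simp add: power2_eq_square)
  qed
  also have "K * (fact ?n * (8 / (R - r)) * (2 ^ ?n * (\<delta> ^ ?n * (N ^ ?n * ?In)
       + (1 / v) ^ (?n - 1) * N ^ ?n * ((R\<^sup>2 / \<delta> ^ ?n) ^ ?n * ?I1 ^ ?n)) / t ^ (?n - 1) + t * (N ^ ?n * ?Ia)))
    = K * (fact ?n * 8 * N ^ ?n) / (R - r) * ((2 ^ ?n * (\<delta> ^ ?n * ?In)
       + 2 ^ ?n * (1 / v) ^ (?n - 1) * ((R\<^sup>2 / \<delta> ^ ?n) ^ ?n * ?I1 ^ ?n)) / t ^ (?n - 1) + t * ?Ia)"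
    by (simp add: field_simps)
  also have "\<dots> \<le> K * (fact ?n * 8 * N ^ ?n) / (R - r) * ((2 ^ ?n * (1 + (1 / v) ^ (?n - 1))) * ((\<delta> ^ ?n * ?In
       + (R\<^sup>2 / \<delta> ^ ?n) ^ ?n * ?I1 ^ ?n) / t ^ (?n - 1) + t * ?Ia))"
  proof (rule mult_left_mono)
    let ?c = "2 ^ ?n * (1 + (1 / v) ^ (?n - 1))"
    have c: "2 ^ ?n \<le> ?c" "2 ^ ?n * (1 / v) ^ (?n - 1) \<le> ?c"
      using v by (auto simp: distrib_left)
    have "(1::real) \<le> 2 ^ ?n" by simp
    then have c1: "1 \<le> ?c" using c(1) by linarith
    have p: "0 \<le> \<delta> ^ ?n * ?In" "0 \<le> (R\<^sup>2 / \<delta> ^ ?n) ^ ?n * ?I1 ^ ?n" "0 \<le> t * ?Ia"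
      using nn r t by auto
    have "(2 ^ ?n * (\<delta> ^ ?n * ?In) + 2 ^ ?n * (1 / v) ^ (?n - 1) * ((R\<^sup>2 / \<delta> ^ ?n) ^ ?n * ?I1 ^ ?n)) / t ^ (?n - 1) + t * ?Ia
       \<le> (?c * (\<delta> ^ ?n * ?In) + ?c * ((R\<^sup>2 / \<delta> ^ ?n) ^ ?n * ?I1 ^ ?n)) / t ^ (?n - 1) + ?c * (t * ?Ia)"
      using mult_right_mono[OF c1 p(3)] t p c
      by (intro add_mono divide_right_mono mult_right_mono) auto
    also have "\<dots> = ?c * ((\<delta> ^ ?n * ?In + (R\<^sup>2 / \<delta> ^ ?n) ^ ?n * ?I1 ^ ?n) / t ^ (?n - 1) + t * ?Ia)"
      by (simp only: distrib_left[symmetric] times_divide_eq_right[symmetric])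
    finally show "(2 ^ ?n * (\<delta> ^ ?n * ?In) + 2 ^ ?n * (1 / v) ^ (?n - 1) * ((R\<^sup>2 / \<delta> ^ ?n) ^ ?n * ?I1 ^ ?n)) / t ^ (?n - 1) + t * ?Ia
       \<le> ?c * ((\<delta> ^ ?n * ?In + (R\<^sup>2 / \<delta> ^ ?n) ^ ?n * ?I1 ^ ?n) / t ^ (?n - 1) + t * ?Ia)" .
    show "0 \<le> K * (fact ?n * 8 * N ^ ?n) / (R - r)" using K N r by simp
  qed
  also have "\<dots> = K * caccioppoli_const TYPE('n) / (R - r) *
     ((\<delta> ^ ?n * ?In + (R\<^sup>2 / \<delta> ^ ?n) ^ ?n * ?I1 ^ ?n) / t ^ (?n - 1) + t * ?Ia)"
    by (simp only: caccioppoli_const_def N_def[symmetric] v_def[symmetric] times_divide_eq_left mult.assoc)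
  finally show ?thesis .
qed


section \<open>Hole filling and the reverse Hoelder inequality\<close>

definition ball_int :: "('a::euclidean_space \<Rightarrow> real) \<Rightarrow> 'a \<Rightarrow> real \<Rightarrow> real" where
  "ball_int h a r = (LINT x:ball a r|lborel. h x)"

text \<open>All that is retained of the map: from here on only the scalar function \<open>W\<close>,
  the operator norm of the derivative, is studied. \<delta> and \<open>t\<close> stay quantified
  because the two applications choose them differently, and the annulus appears as a difference so
  that the inner ball can be moved to the left side.\<close>

definition caccioppoli_weight :: "'a::euclidean_space set \<Rightarrow> real \<Rightarrow> ('a \<Rightarrow> real) \<Rightarrow> bool" where
  "caccioppoli_weight U C W \<longleftrightarrow> W \<in> borel_measurable borel \<and> (\<forall>x. 0 \<le> W x) \<and>
     (\<forall>a R. cball a R \<subseteq> U \<longrightarrow> integrable lborel (\<lambda>x. indicator (cball a R) x * W x ^ DIM('a))) \<and>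
     (\<forall>a R' r R \<delta> t. cball a R' \<subseteq> U \<and> 0 < r \<and> r < R \<and> 0 < \<delta> \<and> R + \<delta> < R' \<and> 0 < t \<longrightarrow>
        ball_int (\<lambda>x. W x ^ DIM('a)) a r \<le> C / (R - r) *
          ((\<delta> ^ DIM('a) * ball_int (\<lambda>x. W x ^ DIM('a)) a (R + \<delta>) +
            (R\<^sup>2 / \<delta> ^ DIM('a)) ^ DIM('a) * ball_int W a (R + \<delta>) ^ DIM('a)) / t ^ (DIM('a) - 1) +
           t * (ball_int (\<lambda>x. W x ^ DIM('a)) a R - ball_int (\<lambda>x. W x ^ DIM('a)) a r)))"

lemma powr_le_one_plus_power:
  fixes y :: real
  assumes "0 \<le> y" "0 < q" "q \<le> real n"
  shows "y powr q \<le> 1 + y ^ n"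
proof (cases "y \<le> 1")
  case True
  have "y powr q \<le> 1" using True assms by (intro powr_le1) auto
  then show ?thesis using assms by (simp add: add_increasing2)
next
  case False
  then have "y powr q \<le> y powr real n" using assms by (intro powr_mono) auto
  also have "\<dots> = y ^ n" using False by (simp add: powr_realpow)
  finally show ?thesis by simp
qed

lemma ball_int_nonneg: "(\<And>x. 0 \<le> h x) \<Longrightarrow> 0 \<le> ball_int h a r"
  unfolding ball_int_def set_lebesgue_integral_def by (intro Bochner_Integration.integral_nonneg) auto

lemma ball_int_mono:
  assumes "\<And>x. 0 \<le> h x" "set_integrable lborel (ball a r') h" "r \<le> r'"
  shows "ball_int h a r \<le> ball_int h a r'"
  unfolding ball_int_def set_lebesgue_integral_def
proof (rule integral_mono)
  have "ball a r \<subseteq> ball a r'" using assms(3) by auto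
  then show "indicator (ball a r) x *\<^sub>R h x \<le> indicator (ball a r') x *\<^sub>R h x" for x
    using assms(1) by (auto simp: indicator_def)
  show "integrable lborel (\<lambda>x. indicator (ball a r') x *\<^sub>R h x)" using assms(2) by (simp add: set_integrable_def)
  show "integrable lborel (\<lambda>x. indicator (ball a r) x *\<^sub>R h x)"
    using set_integrable_subset[OF assms(2), of "ball a r"] \<open>ball a r \<subseteq> ball a r'\<close> by (simp add: set_integrable_def)
qed

context
  fixes U :: "'a::euclidean_space set" and C W
  assumes W: "caccioppoli_weight U C W"
begin

lemma weight_measurable[measurable]: "W \<in> borel_measurable borel"
  and weight_nonneg: "0 \<le> W x"
  using W by (auto simp: caccioppoli_weight_def)

lemma weight_power_set_integrable:
  assumes "cball a R \<subseteq> U" "S \<in> sets borel" "S \<subseteq> cball a R"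
  shows "set_integrable lborel S (\<lambda>x. W x ^ DIM('a))"
proof -
  have "set_integrable lborel (cball a R) (\<lambda>x. W x ^ DIM('a))"
    using W assms(1) by (auto simp: caccioppoli_weight_def set_integrable_def)
  then show ?thesis by (rule set_integrable_subset) (use assms in auto)
qed

lemma weight_powr_set_integrable:
  assumes "cball a R \<subseteq> U" "S \<in> sets borel" "S \<subseteq> cball a R" "0 < q" "q \<le> real DIM('a)"
  shows "set_integrable lborel S (\<lambda>x. W x powr q)"
  unfolding set_integrable_def
proof (rule Bochner_Integration.integrable_bound[of _ "\<lambda>x. indicator S x + indicator S x *\<^sub>R W x ^ DIM('a)"])
  have [measurable]: "S \<in> sets borel" by fact
  have bS: "bounded S" using assms(3) bounded_cball bounded_subset by blast
  have "integrable lborel (indicator S :: 'a \<Rightarrow> real)"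
    using emeasure_bounded_finite[OF bS] by (intro integrable_real_indicator) auto
  then show "integrable lborel (\<lambda>x. indicator S x + indicator S x *\<^sub>R W x ^ DIM('a))"
    using weight_power_set_integrable[OF assms(1-3)] by (simp add: set_integrable_def)
  show "(\<lambda>x. indicator S x *\<^sub>R W x powr q) \<in> borel_measurable lborel" by measurable
  show "AE x in lborel. norm (indicator S x *\<^sub>R W x powr q) \<le> norm (indicator S x + indicator S x *\<^sub>R W x ^ DIM('a))"
    using powr_le_one_plus_power[OF weight_nonneg assms(4,5)] weight_nonneg
    by (intro AE_I2) (simp add: indicator_def)
qed

lemma weight_set_integrable:
  assumes "cball a R \<subseteq> U" "S \<in> sets borel" "S \<subseteq> cball a R"
  shows "set_integrable lborel S W"
proof -
  have "(1::real) \<le> real DIM('a)" using DIM_positive[where 'a = 'a] by linarith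
  then show ?thesis
    using weight_powr_set_integrable[OF assms, of 1] weight_nonneg by (simp add: powr_one_gt_zero_iff)
qed

text \<open>With radii measured in units of \<rho> and integrals divided by
  \<open>\<rho> ^ n\<close>, the inequality no longer contains \<rho>. This requires the parameter
  \<open>t * \<rho>\<close> in the original inequality.\<close>

lemma scaled_Caccioppoli:
  fixes a :: 'a and \<rho> :: real
  defines "F \<equiv> \<lambda>s. ball_int (\<lambda>x. W x ^ DIM('a)) a (s * \<rho>) / \<rho> ^ DIM('a)"
    and "l \<equiv> \<lambda>s. ball_int W a (s * \<rho>) / \<rho> ^ DIM('a)"
  assumes \<rho>: "0 < \<rho>" and sub: "cball a (S * \<rho>) \<subseteq> U" and s: "0 < s" "s < s'" "0 < d" "s' + d < S" "0 < t"
  shows "F s \<le> C / (s' - s) * ((d ^ DIM('a) * F (s' + d) + (s'\<^sup>2 / d ^ DIM('a)) ^ DIM('a) * l (s' + d) ^ DIM('a)) / t ^ (DIM('a) - 1)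
      + t * (F s' - F s))"
proof -
  let ?n = "DIM('a)"
  let ?\<Phi> = "\<lambda>s. ball_int (\<lambda>x. W x ^ ?n) a (s * \<rho>)"
  have Pn: "\<rho> ^ ?n > 0" using \<rho> by simp
  have F: "?\<Phi> s = \<rho> ^ ?n * F s" for s using Pn \<rho> by (simp add: F_def)
  have l: "ball_int W a (s * \<rho>) = \<rho> ^ ?n * l s" for s using Pn \<rho> by (simp add: l_def)
  have "(s' + d) * \<rho> < S * \<rho>" using \<rho> s by (intro mult_strict_right_mono) auto
  then have lt: "s' * \<rho> + d * \<rho> < S * \<rho>" by (simp add: distrib_right)
  have "?\<Phi> s \<le> C / (s' * \<rho> - s * \<rho>) * (((d * \<rho>) ^ ?n * ball_int (\<lambda>x. W x ^ ?n) a (s' * \<rho> + d * \<rho>) +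
       ((s' * \<rho>)\<^sup>2 / (d * \<rho>) ^ ?n) ^ ?n * ball_int W a (s' * \<rho> + d * \<rho>) ^ ?n) / (t * \<rho>) ^ (?n - 1) +
       t * \<rho> * (?\<Phi> s' - ?\<Phi> s))"
    using W[unfolded caccioppoli_weight_def, THEN conjunct2, THEN conjunct2, THEN conjunct2, rule_format,
        of a "S * \<rho>" "s * \<rho>" "s' * \<rho>" "d * \<rho>" "t * \<rho>"] sub s \<rho> lt by simp
  also have "s' * \<rho> + d * \<rho> = (s' + d) * \<rho>" by (simp add: distrib_right)
  finally have "\<rho> ^ ?n * F s \<le> C / (s' * \<rho> - s * \<rho>) * (((d * \<rho>) ^ ?n * (\<rho> ^ ?n * F (s' + d)) +
       ((s' * \<rho>)\<^sup>2 / (d * \<rho>) ^ ?n) ^ ?n * (\<rho> ^ ?n * l (s' + d)) ^ ?n) / (t * \<rho>) ^ (?n - 1) +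
       t * \<rho> * (\<rho> ^ ?n * F s' - \<rho> ^ ?n * F s))"
    unfolding F l .
  also have "((s' * \<rho>)\<^sup>2 / (d * \<rho>) ^ ?n) ^ ?n * (\<rho> ^ ?n * l (s' + d)) ^ ?n
      = (s'\<^sup>2 / d ^ ?n) ^ ?n * l (s' + d) ^ ?n * (\<rho> * \<rho>) ^ ?n"
  proof -
    have "(s' * \<rho>)\<^sup>2 / (d * \<rho>) ^ ?n * (\<rho> ^ ?n * l (s' + d)) = (s'\<^sup>2 / d ^ ?n) * l (s' + d) * (\<rho> * \<rho>)"
      using \<rho> by (simp add: power_mult_distrib power2_eq_square)
    then show ?thesis by (simp only: power_mult_distrib[symmetric])
  qed
  also have "(d * \<rho>) ^ ?n * (\<rho> ^ ?n * F (s' + d)) = d ^ ?n * F (s' + d) * (\<rho> * \<rho>) ^ ?n"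
    by (simp add: power_mult_distrib)
  also have "t * \<rho> * (\<rho> ^ ?n * F s' - \<rho> ^ ?n * F s) = t * (F s' - F s) * (\<rho> * \<rho> ^ ?n)"
    by (simp add: algebra_simps)
  also have "(d ^ ?n * F (s' + d) * (\<rho> * \<rho>) ^ ?n + (s'\<^sup>2 / d ^ ?n) ^ ?n * l (s' + d) ^ ?n * (\<rho> * \<rho>) ^ ?n) / (t * \<rho>) ^ (?n - 1)
      = (d ^ ?n * F (s' + d) + (s'\<^sup>2 / d ^ ?n) ^ ?n * l (s' + d) ^ ?n) / t ^ (?n - 1) * (\<rho> * \<rho> ^ ?n)"
  proof -
    have "\<rho> ^ ?n = \<rho> ^ (?n - 1) * \<rho>" by (metis DIM_positive Suc_diff_1 power_Suc2)
    then have "(\<rho> * \<rho>) ^ ?n / \<rho> ^ (?n - 1) = \<rho> * \<rho> ^ ?n" using \<rho> by (simp add: power_mult_distrib)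
    then have *: "X * (\<rho> * \<rho>) ^ ?n / (T * \<rho> ^ (?n - 1)) = X / T * (\<rho> * \<rho> ^ ?n)" for X T :: real
      by (metis times_divide_times_eq)
    show ?thesis by (simp only: distrib_right[symmetric] power_mult_distrib[of t] *)
  qed
  also have "C / (s' * \<rho> - s * \<rho>) * (X * (\<rho> * \<rho> ^ ?n) + Y * (\<rho> * \<rho> ^ ?n)) = \<rho> ^ ?n * (C / (s' - s) * (X + Y))" for X Y
  proof -
    have "s' * \<rho> - s * \<rho> = (s' - s) * \<rho>" by (simp add: left_diff_distrib)
    then show ?thesis using \<rho> s by (simp add: field_simps)
  qed
  finally show ?thesis using Pn by (simp only: mult_le_cancel_left_pos)
qed

text \<open>Jensen's inequality for the uniform measure on the ball. It is how hole filling gets rid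
  of the first-power term.\<close>

lemma ball_int_power_le:
  assumes "cball a r \<subseteq> U" "0 < r"
  shows "ball_int W a r ^ DIM('a) \<le> measure lborel (ball a r) ^ (DIM('a) - 1) * ball_int (\<lambda>x. W x ^ DIM('a)) a r"
proof -
  let ?B = "ball a r" and ?n = "DIM('a)"
  let ?V = "measure lborel ?B"
  have V: "?V > 0" using assms(2) by (rule content_ball_pos)
  interpret prob_space "uniform_measure lborel ?B"
    by (rule prob_space_uniform_measure) (use V emeasure_lborel_ball[of a r] in auto)
  have e: "(\<integral>\<^sup>+x. ennreal (h x) \<partial>uniform_measure lborel ?B) = ennreal (ball_int h a r / ?V)"
    if [measurable]: "h \<in> borel_measurable borel" and h: "\<And>x. 0 \<le> h x" "set_integrable lborel ?B h" for h
  proof -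
    have "(\<integral>\<^sup>+x. ennreal (h x) * indicator ?B x \<partial>lborel) = (\<integral>\<^sup>+x. ennreal (indicator ?B x *\<^sub>R h x) \<partial>lborel)"
      by (intro nn_integral_cong) (auto simp: indicator_def)
    also have "\<dots> = ennreal (ball_int h a r)"
      using nn_integral_eq_integral[OF h(2)[unfolded set_integrable_def]] h(1)
      by (simp add: ball_int_def set_lebesgue_integral_def)
    finally show ?thesis
      using V ball_int_nonneg[of h a r, OF h(1)] by (simp add: nn_integral_uniform_measure emeasure_lborel_ball divide_ennreal)
  qed
  have i: "set_integrable lborel ?B W" "set_integrable lborel ?B (\<lambda>x. W x ^ ?n)"
    using weight_set_integrable[OF assms(1), of ?B] weight_power_set_integrable[OF assms(1), of ?B] by auto
  have "ennreal (ball_int W a r / ?V) ^ ?n \<le> ennreal (ball_int (\<lambda>x. W x ^ ?n) a r / ?V)"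
    using nn_integral_power_le[of W ?n] e[OF _ _ i(1)] e[OF _ _ i(2)] weight_nonneg by simp
  then have "(ball_int W a r / ?V) ^ ?n \<le> ball_int (\<lambda>x. W x ^ ?n) a r / ?V"
    using V ball_int_nonneg[of W a r] ball_int_nonneg[of "\<lambda>x. W x ^ ?n" a r] weight_nonneg
    by (simp add: ennreal_power)
  then have "?V ^ ?n * (ball_int W a r / ?V) ^ ?n \<le> ?V ^ ?n * (ball_int (\<lambda>x. W x ^ ?n) a r / ?V)"
    using V by (intro mult_left_mono) auto
  moreover have "?V ^ ?n = ?V ^ (?n - 1) * ?V" by (metis DIM_positive Suc_diff_1 power_Suc2)
  ultimately show ?thesis using V by (simp add: power_divide)
qed

end

text \<open>The annulus contributes \<open>F 2 - F 1\<close>, whose negative part is moved to the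
  left side with coefficient \<open>C * \<tau>\<close>. The remaining terms amount to at most half
  of \<open>F 3\<close> once \<tau> is large. Comparing coefficients gives \<theta>, which is below
  1 exactly because of this half.\<close>

lemma hole_filling:
  assumes n: "2 \<le> DIM('a::euclidean_space)" and C: "0 < C"
  shows "\<exists>\<theta>>0. \<theta> < 1 \<and> (\<forall>U W (a::'a) \<rho>. caccioppoli_weight U C W \<and> 0 < \<rho> \<and> cball a (4 * \<rho>) \<subseteq> U \<longrightarrow>
     ball_int (\<lambda>x. W x ^ DIM('a)) a \<rho> \<le> \<theta> * ball_int (\<lambda>x. W x ^ DIM('a)) a (3 * \<rho>))"
proof -
  let ?n = "DIM('a)"
  define v where "v = measure lborel (ball (0::'a) 1)"
  \<comment> \<open>The coefficient of \<open>F 3\<close> after Jensen: \<open>4 ^ n\<close> is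
    \<open>(s'\<^sup>2 / d ^ n) ^ n\<close> for \<open>s' = 2\<close> and \<open>d = 1\<close>, and
    \<open>v * 3 ^ n\<close> is the volume of a ball of radius 3.\<close>
  define E where "E = 4 ^ ?n * (v * 3 ^ ?n) ^ (?n - 1)"
  define \<tau> where "\<tau> = 2 * C * (1 + E) + 1"
  have v0: "v > 0" by (simp add: v_def)
  then have E: "E > 0" by (simp add: E_def)
  then have \<tau>: "\<tau> \<ge> 1" using C by (simp add: \<tau>_def)
  define \<theta> where "\<theta> = (1 / 2 + C * \<tau>) / (1 + C * \<tau>)"
  have Ct: "C * \<tau> > 0" using C \<tau> by simp
  have "0 < \<theta>" "\<theta> < 1" using Ct by (auto simp: \<theta>_def)
  moreover have "ball_int (\<lambda>x. W x ^ ?n) a \<rho> \<le> \<theta> * ball_int (\<lambda>x. W x ^ ?n) a (3 * \<rho>)"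
    if W: "caccioppoli_weight U C W" and \<rho>: "0 < \<rho>" and sub: "cball a (4 * \<rho>) \<subseteq> U" for U W and a :: 'a and \<rho>
  proof -
    define F where "F s = ball_int (\<lambda>x. W x ^ ?n) a (s * \<rho>) / \<rho> ^ ?n" for s
    define l where "l s = ball_int W a (s * \<rho>) / \<rho> ^ ?n" for s
    have P: "\<rho> ^ ?n > 0" using \<rho> by simp
    have F0: "F s \<ge> 0" for s unfolding F_def
      using P weight_nonneg[OF W] by (intro divide_nonneg_pos ball_int_nonneg) auto
    have F23: "F 2 \<le> F 3"
      unfolding F_def using P \<rho> weight_nonneg[OF W]
      by (intro divide_right_mono ball_int_mono weight_power_set_integrable[OF W sub]) auto
    \<comment> \<open>Radii 1, 2 and 3 in units of \<rho>; the strict inequality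
      \<open>s' + d < S\<close> asks for room up to 4.\<close>
    have "F 1 \<le> C / (2 - 1) * ((1 ^ ?n * F (2 + 1) + (2\<^sup>2 / 1 ^ ?n) ^ ?n * l (2 + 1) ^ ?n) / \<tau> ^ (?n - 1) + \<tau> * (F 2 - F 1))"
      unfolding F_def l_def by (rule scaled_Caccioppoli[OF W \<rho> sub]) (use \<tau> in auto)
    then have 1: "F 1 \<le> C * ((F 3 + 4 ^ ?n * l 3 ^ ?n) / \<tau> ^ (?n - 1) + \<tau> * (F 2 - F 1))" by simp
    have l3: "l 3 ^ ?n \<le> (v * 3 ^ ?n) ^ (?n - 1) * F 3"
    proof -
      have "cball a (3 * \<rho>) \<subseteq> U" using sub \<rho> by (force simp: subset_iff)
      from ball_int_power_le[OF W this] \<rho>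
      have "ball_int W a (3 * \<rho>) ^ ?n \<le> (v * (3 * \<rho>) ^ ?n) ^ (?n - 1) * ball_int (\<lambda>x. W x ^ ?n) a (3 * \<rho>)"
        using measure_ball_scale[of "3 * \<rho>" a] by (simp add: v_def)
      also have "\<dots> = (v * 3 ^ ?n) ^ (?n - 1) * ((\<rho> ^ ?n) ^ (?n - 1) * \<rho> ^ ?n) * F 3"
        using P \<rho> by (simp add: F_def power_mult_distrib)
      also have "(\<rho> ^ ?n) ^ (?n - 1) * \<rho> ^ ?n = (\<rho> ^ ?n) ^ ?n" by (metis DIM_positive Suc_diff_1 power_Suc2)
      finally have "ball_int W a (3 * \<rho>) ^ ?n / (\<rho> ^ ?n) ^ ?n \<le> (v * 3 ^ ?n) ^ (?n - 1) * F 3"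
        using P by (simp add: divide_le_eq mult_ac)
      then show ?thesis by (simp add: l_def power_divide)
    qed
    \<comment> \<open>This uses that the dimension is at least 2: the exponent \<open>n - 1\<close>
      is then positive.\<close>
    have \<tau>n: "\<tau> \<le> \<tau> ^ (?n - 1)"
      using \<tau> n by (intro self_le_power) auto
    have "(F 3 + 4 ^ ?n * l 3 ^ ?n) / \<tau> ^ (?n - 1) \<le> ((1 + E) * F 3) / \<tau>"
    proof (rule frac_le)
      show "F 3 + 4 ^ ?n * l 3 ^ ?n \<le> (1 + E) * F 3"
        using mult_left_mono[OF l3, of "4 ^ ?n"] by (simp add: E_def algebra_simps)
    qed (use E F0 \<tau> \<tau>n in auto)
    then have "C * ((F 3 + 4 ^ ?n * l 3 ^ ?n) / \<tau> ^ (?n - 1)) \<le> C * (((1 + E) * F 3) / \<tau>)"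
      using C by (intro mult_left_mono) auto
    also have "\<dots> = (C * (1 + E) / \<tau>) * F 3" by simp
    also have "\<dots> \<le> 1 / 2 * F 3"
      using \<tau> F0 by (intro mult_right_mono) (auto simp: \<tau>_def field_simps)
    finally have 2: "C * ((F 3 + 4 ^ ?n * l 3 ^ ?n) / \<tau> ^ (?n - 1)) \<le> 1 / 2 * F 3" .
    have 3: "C * (\<tau> * (F 2 - F 1)) \<le> C * \<tau> * F 3 - C * \<tau> * F 1"
      using mult_left_mono[OF F23, of "C * \<tau>"] Ct by (simp add: algebra_simps)
    have "(1 + C * \<tau>) * F 1 \<le> (1 / 2 + C * \<tau>) * F 3"
      using 1 2 3 by (simp only: distrib_left distrib_right)
    then have "F 1 \<le> \<theta> * F 3" using Ct by (simp add: \<theta>_def field_simps)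
    then have "\<rho> ^ ?n * F 1 \<le> \<rho> ^ ?n * (\<theta> * F 3)" using P by (intro mult_left_mono) auto
    then show ?thesis using P \<rho> by (simp add: F_def)
  qed
  ultimately show ?thesis by blast
qed

section \<open>The reverse Hoelder inequality\<close>

text \<open>Young's inequality with exponents \<open>1 / (1 - q)\<close> and \<open>1 / q\<close>,
  by comparing \<open>8 * X\<close> with \<open>F powr q\<close>; in this form the endpoint
  \<open>q = 1\<close> is included.\<close>

lemma powr_mult_Young:
  fixes F X q :: real
  assumes "0 < F" "0 \<le> X" "0 < q" "q \<le> 1"
  shows "F powr (1 - q) * X \<le> F / 8 + (8 * X) powr (1 / q)"
proof (cases "8 * X \<le> F powr q")
  case True
  have "F powr (1 - q) * X \<le> F powr (1 - q) * (F powr q / 8)" using True by (intro mult_left_mono) auto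
  also have "\<dots> = F / 8" using assms by (simp add: powr_add[symmetric])
  finally show ?thesis by (simp add: add_increasing2)
next
  case False
  then have X: "X > 0" "F powr q < 8 * X" using assms powr_ge_zero[of F q] by linarith+
  have "F = (F powr q) powr (1 / q)" using assms by (simp add: powr_powr)
  also have "\<dots> \<le> (8 * X) powr (1 / q)" using X assms by (intro powr_mono2) auto
  finally have F: "F \<le> (8 * X) powr (1 / q)" .
  have "F powr (1 - q) * X \<le> ((8 * X) powr (1 / q)) powr (1 - q) * (8 * X)"
    using F X assms by (intro mult_mono powr_mono2) auto
  also have "\<dots> = (8 * X) powr (1 / q * (1 - q)) * (8 * X) powr 1" using X by (simp add: powr_powr)
  also have "\<dots> = (8 * X) powr (1 / q * (1 - q) + 1)" by (simp only: powr_add)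
  also have "1 / q * (1 - q) + 1 = 1 / q" using assms by (simp add: field_simps)
  finally show ?thesis using assms by simp
qed

text \<open>The level \<open>M\<close> is free in the hypothesis, and balancing it against
  \<open>F\<close> makes its first term a small multiple of \<open>F\<close> after the n-th power.
  The second term is then a product of \<open>F powr (1 - q)\<close> and a power of
  \<open>Q\<close>, to be separated by Young. The dependence on \<open>b\<close> is explicit because
  \<open>b\<close> will grow like a power of the inverse gap between two radii.\<close>

lemma absorb_lower_exponent:
  fixes F Q l b q :: real
  assumes F: "0 < F" and Q: "0 \<le> Q" and l: "0 \<le> l" and b: "1 \<le> b" and q: "0 < q" "q \<le> 1" and n: "2 \<le> n"
    and le: "\<And>M. 0 < M \<Longrightarrow> l \<le> F / M ^ (n - 1) + M powr (1 - q) * Q"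
  shows "b * l ^ n \<le> F / 4 + (8 * 2 ^ n * b) powr ((2 - q) / q) * Q powr (real n / q)"
proof -
  \<comment> \<open>Chosen so that \<open>b * 2 ^ n * F / B = F / 8\<close>; Young contributes
    another eighth, which together make \<open>F / 4\<close>.\<close>
  define B where "B = 8 * 2 ^ n * b"
  have B: "B \<ge> 1" using b mult_mono[of 1 "2 ^ n" 1 b] unfolding B_def by simp
  \<comment> \<open>With \<open>M ^ n = F * B\<close> the first term \<open>F / M ^ (n - 1)\<close>
    becomes \<open>M / B\<close>, and its n-th power is at most \<open>F / B\<close> because
    \<open>n \<ge> 2\<close>.\<close>
  define M where "M = root n (F * B)"
  have M: "M > 0" using F B n by (simp add: M_def)
  have Mn: "M ^ n = F * B" using F B n by (simp add: M_def real_root_pow_pos2)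
  have FM: "F / M ^ (n - 1) = M / B"
  proof -
    have "M ^ n = M ^ (n - 1) * M" using n by (metis Suc_diff_1 not_numeral_le_zero power_Suc2 zero_less_iff_neq_zero)
    then show ?thesis using Mn M B by (simp add: field_simps)
  qed
  have "l ^ n \<le> 2 ^ n * ((M / B) ^ n + (M powr (1 - q) * Q) ^ n)"
    using le[OF M] M B Q l unfolding FM by (intro power_le_sum_powers) auto
  moreover have "(M / B) ^ n \<le> F / B"
  proof -
    have "B ^ n = B ^ (n - 1) * B" using n by (metis Suc_diff_1 not_numeral_le_zero power_Suc2 zero_less_iff_neq_zero)
    moreover have "B \<le> B ^ (n - 1)" using B n by (intro self_le_power) auto
    ultimately have "B * B \<le> B ^ n" using B by simp
    then have "F * B / B ^ n \<le> F * B / (B * B)" using F B by (intro divide_left_mono) auto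
    then show ?thesis using B by (simp add: power_divide Mn)
  qed
  moreover have "(M powr (1 - q) * Q) ^ n = (F * B) powr (1 - q) * Q ^ n"
  proof -
    have "(M powr (1 - q)) ^ n = (M powr (1 - q)) powr real n" using M by (simp add: powr_realpow)
    also have "\<dots> = (M powr real n) powr (1 - q)" by (simp add: powr_powr mult.commute)
    also have "M powr real n = F * B" using M Mn by (simp add: powr_realpow)
    finally show ?thesis by (simp add: power_mult_distrib)
  qed
  ultimately have "l ^ n \<le> 2 ^ n * (F / B + (F * B) powr (1 - q) * Q ^ n)"
    by (smt (verit) mult_left_mono zero_le_power)
  then have "b * l ^ n \<le> b * (2 ^ n * (F / B + (F * B) powr (1 - q) * Q ^ n))"
    using b by (intro mult_left_mono) auto
  also have "\<dots> = (b * 2 ^ n) * F / B + (b * 2 ^ n) * ((F * B) powr (1 - q) * Q ^ n)" by (simp add: distrib_left)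
  also have "b * 2 ^ n = B / 8" by (simp add: B_def)
  also have "B / 8 * F / B = F / 8" using B by simp
  also have "B / 8 * ((F * B) powr (1 - q) * Q ^ n) = F powr (1 - q) * (B / 8 * B powr (1 - q) * Q ^ n)"
    using F B by (simp add: powr_mult)
  also have "\<dots> \<le> F / 8 + (8 * (B / 8 * B powr (1 - q) * Q ^ n)) powr (1 / q)"
    using F B Q q by (intro powr_mult_Young) auto
  also have "8 * (B / 8 * B powr (1 - q) * Q ^ n) = B powr (2 - q) * Q ^ n"
  proof -
    have "B * B powr (1 - q) = B powr 1 * B powr (1 - q)" using B by simp
    also have "\<dots> = B powr (2 - q)" unfolding powr_add[symmetric] by simp
    finally show ?thesis by simp
  qed
  also have "(B powr (2 - q) * Q ^ n) powr (1 / q) = B powr ((2 - q) / q) * Q powr (real n / q)"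
    using Q B n by (cases "Q = 0") (auto simp: powr_mult powr_powr powr_realpow[symmetric] zero_power)
  finally show ?thesis by (simp add: B_def)
qed

text \<open>The usual iteration along radii \<open>2 - \<tau> ^ i\<close> increasing from 1 to 2.
  Each step halves the weight of the unknown term, while the error grows by a fixed factor because
  the gaps shrink; \<tau> is so close to 1 that the halving prevails. The bound \<open>B\<close>
  makes the remainder tend to 0.\<close>

lemma iterate_absorption:
  fixes F :: "real \<Rightarrow> real"
  assumes F: "\<And>s. s \<in> {1..2} \<Longrightarrow> 0 \<le> F s \<and> F s \<le> B" and X: "0 \<le> X" and k: "0 < k"
    and le: "\<And>s s'. 1 \<le> s \<Longrightarrow> s < s' \<Longrightarrow> s' < 2 \<Longrightarrow> F s \<le> F s' / 2 + X * (1 / (s' - s)) powr k"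
  shows "F 1 \<le> 4 * (1 / (1 - (2 / 3) powr (1 / k))) powr k * X"
proof -
  \<comment> \<open>Then \<open>(1 / \<tau>) powr k = 3 / 2\<close>, and the errors form a geometric
    series with ratio \<open>3 / 4\<close> and sum at most 4.\<close>
  define \<tau> where "\<tau> = (2 / 3::real) powr (1 / k)"
  have \<tau>: "0 < \<tau>" "\<tau> < 1"
    using k powr_less_mono2[of "1 / k" "2 / 3" 1] by (auto simp: \<tau>_def)
  have \<tau>k: "(1 / \<tau>) powr k = 3 / 2"
  proof -
    have "\<tau> powr k = 2 / 3" using k by (simp add: \<tau>_def powr_powr)
    moreover have "(1 / \<tau>) powr k = 1 / \<tau> powr k" using \<tau> by (simp add: powr_divide)
    ultimately have "(1 / \<tau>) powr k = 1 / (2 / 3)" by (simp only:)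
    then show ?thesis by simp
  qed
  define s where "s i = 2 - \<tau> ^ i" for i
  define Y where "Y = X * (1 / (1 - \<tau>)) powr k"
  have Y: "Y \<ge> 0" using X by (simp add: Y_def)
  have s1: "1 \<le> s i" "s i < 2" for i using \<tau> by (auto simp: s_def power_le_one)
  have step: "F (s i) \<le> F (s (Suc i)) / 2 + Y * (3 / 2) ^ i" for i
  proof -
    have d: "s (Suc i) - s i = \<tau> ^ i * (1 - \<tau>)" by (simp add: s_def algebra_simps)
    have "s (Suc i) - s i > 0" unfolding d using \<tau> by simp
    then have "F (s i) \<le> F (s (Suc i)) / 2 + X * (1 / (s (Suc i) - s i)) powr k"
      using s1 by (intro le) auto
    also have "(1 / (s (Suc i) - s i)) powr k = (1 / (1 - \<tau>)) powr k * ((1 / \<tau>) ^ i) powr k"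
      unfolding d using \<tau> by (simp add: powr_mult[symmetric] power_divide mult.commute)
    also have "((1 / \<tau>) ^ i) powr k = ((1 / \<tau>) powr k) ^ i"
      using \<tau> by (simp add: powr_realpow[symmetric] powr_powr mult.commute)
    finally show ?thesis unfolding \<tau>k by (simp add: Y_def mult.assoc)
  qed
  have "F (s 0) \<le> (1 / 2) ^ j * F (s j) + Y * (\<Sum>i<j. (3 / 4) ^ i)" for j
  proof (induction j)
    case (Suc j)
    have "(1 / 2) ^ j * F (s j) \<le> (1 / 2) ^ j * (F (s (Suc j)) / 2 + Y * (3 / 2) ^ j)"
      by (rule mult_left_mono[OF step]) simp
    also have "\<dots> = (1 / 2) ^ Suc j * F (s (Suc j)) + Y * ((1 / 2) ^ j * (3 / 2) ^ j)"
      by (simp add: distrib_left)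
    also have "(1 / 2) ^ j * (3 / 2) ^ j = (3 / 4 :: real) ^ j"
      by (simp add: power_mult_distrib[symmetric])
    finally show ?case using Suc.IH by (simp add: distrib_left)
  qed simp
  moreover have "(\<Sum>i<j. (3 / 4 :: real) ^ i) \<le> 4" for j
    by (subst geometric_sum) (auto simp: divide_le_eq)
  ultimately have bd: "F 1 \<le> (1 / 2) ^ j * B + Y * 4" for j
    using F[of "s j"] s1[of j] mult_left_mono[of "F (s j)" B "(1 / 2) ^ j"] mult_left_mono[of "\<Sum>i<j. (3 / 4 :: real) ^ i" 4 Y] Y
    by (smt (verit) atLeastAtMost_iff power_0 s_def zero_le_power zero_le_divide_1_iff)
  have "(\<lambda>j. (1 / 2) ^ j * B + Y * 4) \<longlonglongrightarrow> 0 * B + Y * 4"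
    by (intro tendsto_intros LIMSEQ_power_zero) auto
  then have "F 1 \<le> 0 * B + Y * 4" using bd by (intro LIMSEQ_le_const) auto
  then show ?thesis by (simp add: Y_def \<tau>_def mult_ac)
qed

text \<open>A pointwise splitting at level \<open>M\<close>: large values are estimated by the n-th
  power, small ones by the power \<open>q\<close>. It provides the hypothesis of
  \<open>absorb_lower_exponent\<close>.\<close>

lemma weight_interpolation:
  fixes W :: "'a::euclidean_space \<Rightarrow> real"
  assumes W: "caccioppoli_weight U C W" and sub: "cball a r \<subseteq> U" and q: "0 < q" "q \<le> 1" and M: "0 < M" and n: "2 \<le> DIM('a)"
  shows "ball_int W a r \<le> ball_int (\<lambda>x. W x ^ DIM('a)) a r / M ^ (DIM('a) - 1) + M powr (1 - q) * ball_int (\<lambda>x. W x powr q) a r"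
proof -
  let ?n = "DIM('a)"
  have qn: "q \<le> real ?n" using q n by linarith
  have i: "set_integrable lborel (ball a r) W" "set_integrable lborel (ball a r) (\<lambda>x. W x ^ ?n)"
    "set_integrable lborel (ball a r) (\<lambda>x. W x powr q)"
    using weight_set_integrable[OF W sub] weight_power_set_integrable[OF W sub] weight_powr_set_integrable[OF W sub _ _ q(1) qn] by auto
  have "ball_int W a r \<le> (LINT x:ball a r|lborel. W x ^ ?n / M ^ (?n - 1) + M powr (1 - q) * W x powr q)"
    unfolding ball_int_def
  proof (rule set_integral_mono[OF i(1)])
    show "set_integrable lborel (ball a r) (\<lambda>x. W x ^ ?n / M ^ (?n - 1) + M powr (1 - q) * W x powr q)"
      by (intro set_integral_add(1) set_integrable_divide set_integrable_mult_right i)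
    fix x
    have w: "W x \<ge> 0" using weight_nonneg[OF W] .
    show "W x \<le> W x ^ ?n / M ^ (?n - 1) + M powr (1 - q) * W x powr q"
    proof (cases "W x \<ge> M")
      case True
      have "1 \<le> (W x / M) ^ (?n - 1)" using True M by (intro one_le_power) simp
      then have "W x * 1 \<le> W x * (W x / M) ^ (?n - 1)" using w by (intro mult_left_mono)
      also have "\<dots> = W x ^ ?n / M ^ (?n - 1)"
        using n by (cases ?n) (auto simp: power_divide)
      finally show ?thesis using M by (simp add: add_increasing2)
    next
      case False
      have "W x = W x powr (1 - q) * W x powr q"
        using w by (cases "W x = 0") (auto simp: powr_add[symmetric])
      also have "\<dots> \<le> M powr (1 - q) * W x powr q"
        using False w q by (intro mult_right_mono powr_mono2) auto
      finally show ?thesis using w M by (simp add: add_increasing)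
    qed
  qed
  also have "\<dots> = ball_int (\<lambda>x. W x ^ ?n) a r / M ^ (?n - 1) + M powr (1 - q) * ball_int (\<lambda>x. W x powr q) a r"
    unfolding ball_int_def using i by (subst set_integral_add(2)) (auto intro: set_integrable_divide set_integrable_mult_right)
  finally show ?thesis .
qed

text \<open>For two radii with gap \<open>h\<close>, the annulus and the top-order Poincare term are
  made at most one eighth of \<open>F s'\<close> each. The first-power term, with a coefficient that
  is a power of \<open>1 / h\<close>, is interpolated down to exponent \<open>q\<close> and costs
  another quarter. What remains is the inequality that \<open>iterate_absorption\<close> needs, with
  factor \<open>1 / 2\<close>.\<close>

lemma reverse_Hoelder_small_exponent:
  assumes n: "2 \<le> DIM('a::euclidean_space)" and C: "0 < C" and q: "0 < q" "q \<le> 1"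
  shows "\<exists>A>0. \<forall>U W (a::'a) \<rho>. caccioppoli_weight U C W \<and> 0 < \<rho> \<and> cball a (2 * \<rho>) \<subseteq> U \<longrightarrow>
     ball_int (\<lambda>x. W x ^ DIM('a)) a \<rho> / \<rho> ^ DIM('a) \<le>
       A * (ball_int (\<lambda>x. W x powr q) a (2 * \<rho>) / \<rho> ^ DIM('a)) powr (real DIM('a) / q)"
proof -
  let ?n = "DIM('a)"
  \<comment> \<open>With \<open>t = \<kappa> * h\<close> the annulus has the coefficient
    \<open>2 * C * \<kappa> = 1 / 8\<close>; the factor 2 stems from the gap \<open>h / 2\<close> of
    the cutoff.\<close>
  define \<kappa> where "\<kappa> = 1 / (16 * C)"
  have \<kappa>: "\<kappa> > 0" using C by (simp add: \<kappa>_def)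
  \<comment> \<open>With averaging radius \<open>\<eta> * h\<close> the top-order term has the
    coefficient \<open>2 * C * \<eta> ^ n / \<kappa> ^ (n - 1)\<close>, at most \<open>1 / 8\<close>
    since \<open>\<eta> \<le> 1\<close>. The bound \<open>1 / 4\<close> keeps all radii below
    \<open>s'\<close>.\<close>
  define \<eta> where "\<eta> = min (1 / 4) (\<kappa> ^ (?n - 1) / (16 * C))"
  have \<eta>: "0 < \<eta>" "\<eta> \<le> 1 / 4" "\<eta> \<le> \<kappa> ^ (?n - 1) / (16 * C)" using C \<kappa> by (auto simp: \<eta>_def)
  define b0 where "b0 = max 1 (2 * C * (4 / \<eta> ^ ?n) ^ ?n / \<kappa> ^ (?n - 1))"
  \<comment> \<open>The power of \<open>1 / h\<close> in the first-power term: \<open>n * n\<close>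
    from \<open>((\<eta> * h) ^ n) ^ n\<close>, one from the cutoff and \<open>n - 1\<close> from
    \<open>(\<kappa> * h) ^ (n - 1)\<close>.\<close>
  define e where "e = ?n * ?n + ?n"
  define p where "p = (2 - q) / q"
  have p: "p > 0" using q by (simp add: p_def)
  have e: "e > 0" by (simp add: e_def)
  define k where "k = real e * p"
  have k: "k > 0" using p e by (simp add: k_def)
  define A0 where "A0 = (8 * 2 ^ ?n * b0) powr p"
  define A where "A = 4 * (1 / (1 - (2 / 3) powr (1 / k))) powr k * A0"
  have b0: "b0 \<ge> 1" by (simp add: b0_def)
  have "(2 / 3 :: real) powr (1 / k) < 1" using k powr_less_mono2[of "1 / k" "2 / 3" 1] by simp
  then have A: "A > 0" using b0 unfolding A_def A0_def by (intro mult_pos_pos) auto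
  moreover have "ball_int (\<lambda>x. W x ^ ?n) a \<rho> / \<rho> ^ ?n \<le> A * (ball_int (\<lambda>x. W x powr q) a (2 * \<rho>) / \<rho> ^ ?n) powr (real ?n / q)"
    if W: "caccioppoli_weight U C W" and \<rho>: "0 < \<rho>" and sub: "cball a (2 * \<rho>) \<subseteq> U" for U W and a :: 'a and \<rho>
  proof -
    define F where "F s = ball_int (\<lambda>x. W x ^ ?n) a (s * \<rho>) / \<rho> ^ ?n" for s
    define l where "l s = ball_int W a (s * \<rho>) / \<rho> ^ ?n" for s
    define Q where "Q = ball_int (\<lambda>x. W x powr q) a (2 * \<rho>) / \<rho> ^ ?n"
    have P: "\<rho> ^ ?n > 0" using \<rho> by simp
    have w: "W x \<ge> 0" for x using weight_nonneg[OF W] .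
    have F0: "F s \<ge> 0" and l0: "l s \<ge> 0" for s
      unfolding F_def l_def using P w by (auto intro!: divide_nonneg_pos ball_int_nonneg)
    have Q0: "Q \<ge> 0" unfolding Q_def using P by (intro divide_nonneg_pos ball_int_nonneg) auto
    have bsub: "ball a (s * \<rho>) \<subseteq> cball a (2 * \<rho>)" if "s \<le> 2" for s
      using mult_right_mono[OF that, of \<rho>] \<rho> by (intro order_trans[OF subset_ball ball_subset_cball]) auto
    have Fmono: "F s \<le> F s'" if "s \<le> s'" "s' \<le> 2" for s s'
      unfolding F_def using that \<rho> w
      by (intro divide_right_mono ball_int_mono weight_power_set_integrable[OF W sub] bsub) auto
    have lmono: "l s \<le> l s'" if "s \<le> s'" "s' \<le> 2" for s s'
      unfolding l_def using that \<rho> w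
      by (intro divide_right_mono ball_int_mono weight_set_integrable[OF W sub] bsub) auto
    have step: "F s \<le> F s' / 2 + A0 * Q powr (real ?n / q) * (1 / (s' - s)) powr k"
      if s: "1 \<le> s" "s < s'" "s' < 2" for s s'
    proof -
      \<comment> \<open>Half of the gap is spent on the cutoff, and at most a quarter on the
        averaging radius \<open>\<eta> * h\<close>.\<close>
      define h where "h = s' - s"
      have h: "0 < h" "h \<le> 1" using s by (auto simp: h_def)
      have hh: "s + h / 2 + \<eta> * h \<le> s'"
      proof -
        have "\<eta> * h \<le> h / 4" using mult_right_mono[OF \<eta>(2), of h] h by simp
        moreover have "s' = s + h" by (simp add: h_def)
        ultimately show ?thesis using h by linarith
      qed
      have half: "s + h / 2 \<le> s'" using h by (simp add: h_def field_simps)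
      have "F s \<le> C / ((s + h / 2) - s) * (((\<eta> * h) ^ ?n * F (s + h / 2 + \<eta> * h) + ((s + h / 2)\<^sup>2 / (\<eta> * h) ^ ?n) ^ ?n * l (s + h / 2 + \<eta> * h) ^ ?n) / (\<kappa> * h) ^ (?n - 1)
          + \<kappa> * h * (F (s + h / 2) - F s))"
        unfolding F_def l_def
        by (rule scaled_Caccioppoli[OF W \<rho> sub]) (use s h hh \<eta> \<kappa> in auto)
      also have "\<dots> \<le> C / ((s + h / 2) - s) * (((\<eta> * h) ^ ?n * F s' + (4 / (\<eta> * h) ^ ?n) ^ ?n * l s' ^ ?n) / (\<kappa> * h) ^ (?n - 1)
          + \<kappa> * h * F s')"
      proof (intro mult_left_mono add_mono divide_right_mono mult_mono power_mono)
        show "F (s + h / 2 + \<eta> * h) \<le> F s'" "l (s + h / 2 + \<eta> * h) \<le> l s'"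
          using hh s by (auto intro: Fmono lmono)
        have "F (s + h / 2) \<le> F s'" using s half by (intro Fmono) auto
        then show "F (s + h / 2) - F s \<le> F s'" using F0[of s] by linarith
        have "s + h / 2 \<le> 2" using s half by linarith
        then show "(s + h / 2)\<^sup>2 \<le> 4" using s h power_mono[of "s + h / 2" 2 2] by simp
      qed (use F0 l0 C \<eta> \<kappa> h s in auto)
      also have "\<dots> = (2 * C * \<eta> ^ ?n / \<kappa> ^ (?n - 1)) * F s' + (2 * C * (4 / \<eta> ^ ?n) ^ ?n / \<kappa> ^ (?n - 1)) / h ^ e * l s' ^ ?n + 2 * C * \<kappa> * F s'"
      proof -
        have hn: "h * h ^ (?n - 1) = h ^ ?n" by (metis DIM_positive Suc_diff_1 power_Suc)
        have he: "(h ^ ?n) ^ ?n * (h * h ^ (?n - 1)) = h ^ e" unfolding hn by (simp add: e_def power_add power_mult)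
        have 1: "C / (s + h / 2 - s) * ((\<eta> * h) ^ ?n * F s' / (\<kappa> * h) ^ (?n - 1)) = (2 * C * \<eta> ^ ?n / \<kappa> ^ (?n - 1)) * F s'"
          using h \<kappa> hn by (simp add: power_mult_distrib field_simps)
        have "C / (s + h / 2 - s) * ((4 / (\<eta> * h) ^ ?n) ^ ?n * l s' ^ ?n / (\<kappa> * h) ^ (?n - 1))
            = 2 * C * (4 / \<eta> ^ ?n) ^ ?n * l s' ^ ?n / (\<kappa> ^ (?n - 1) * ((h ^ ?n) ^ ?n * (h * h ^ (?n - 1))))"
          using h \<kappa> \<eta> by (simp add: power_mult_distrib power_divide field_simps)
        then have 2: "C / (s + h / 2 - s) * ((4 / (\<eta> * h) ^ ?n) ^ ?n * l s' ^ ?n / (\<kappa> * h) ^ (?n - 1))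
            = (2 * C * (4 / \<eta> ^ ?n) ^ ?n / \<kappa> ^ (?n - 1)) / h ^ e * l s' ^ ?n"
          unfolding he by simp
        have 3: "C / (s + h / 2 - s) * (\<kappa> * h * F s') = 2 * C * \<kappa> * F s'" using h by simp
        show ?thesis unfolding add_divide_distrib distrib_left 1 2 3 ..
      qed
      also have "\<dots> \<le> F s' / 8 + b0 / h ^ e * l s' ^ ?n + F s' / 8"
      proof (intro add_mono)
        have "\<eta> ^ ?n \<le> \<eta> ^ 1" using \<eta> by (intro power_decreasing) (auto simp: Suc_leI)
        then have "\<eta> ^ ?n \<le> \<kappa> ^ (?n - 1) / (16 * C)" using \<eta>(3) by simp
        then have "2 * C * \<eta> ^ ?n / \<kappa> ^ (?n - 1) \<le> 1 / 8" using C \<kappa> by (simp add: field_simps)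
        from mult_right_mono[OF this F0[of s']] show "2 * C * \<eta> ^ ?n / \<kappa> ^ (?n - 1) * F s' \<le> F s' / 8" by simp
        show "2 * C * \<kappa> * F s' \<le> F s' / 8" using C by (simp add: \<kappa>_def)
        show "(2 * C * (4 / \<eta> ^ ?n) ^ ?n / \<kappa> ^ (?n - 1)) / h ^ e * l s' ^ ?n \<le> b0 / h ^ e * l s' ^ ?n"
          using h l0 by (intro mult_right_mono divide_right_mono) (auto simp: b0_def)
      qed
      finally have 1: "F s \<le> F s' / 4 + b0 / h ^ e * l s' ^ ?n" by simp
      \<comment> \<open>\<open>absorb_lower_exponent\<close> divides by powers of \<open>F\<close>,
        which may vanish here; it is applied to \<open>F s' + \<epsilon>\<close> instead.\<close>
      have "b0 / h ^ e * l s' ^ ?n \<le> F s' / 4 + (8 * 2 ^ ?n * (b0 / h ^ e)) powr p * Q powr (real ?n / q)"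
      proof (rule field_le_epsilon)
        fix \<epsilon> :: real assume \<epsilon>: "0 < \<epsilon>"
        have "b0 / h ^ e * l s' ^ ?n \<le> (F s' + \<epsilon>) / 4 + (8 * 2 ^ ?n * (b0 / h ^ e)) powr ((2 - q) / q) * Q powr (real ?n / q)"
        proof (rule absorb_lower_exponent[OF _ Q0 l0 _ q n])
          show "0 < F s' + \<epsilon>" using F0[of s'] \<epsilon> by linarith
          have "h ^ e \<le> 1" using h by (simp add: power_le_one)
          then show "1 \<le> b0 / h ^ e" using b0 h by (simp add: le_divide_eq)
          fix M :: real assume M: "0 < M"
          have sub': "cball a (s' * \<rho>) \<subseteq> U"
            using sub mult_right_mono[of s' 2 \<rho>] s \<rho> by (intro order_trans[OF subset_cball sub]) auto
          have "ball_int W a (s' * \<rho>) \<le> ball_int (\<lambda>x. W x ^ ?n) a (s' * \<rho>) / M ^ (?n - 1) + M powr (1 - q) * ball_int (\<lambda>x. W x powr q) a (s' * \<rho>)"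
            by (rule weight_interpolation[OF W sub' q M n])
          also have "ball_int (\<lambda>x. W x powr q) a (s' * \<rho>) \<le> ball_int (\<lambda>x. W x powr q) a (2 * \<rho>)"
            using s \<rho> q n by (intro ball_int_mono weight_powr_set_integrable[OF W sub]) auto
          finally have "ball_int W a (s' * \<rho>) / \<rho> ^ ?n \<le> (ball_int (\<lambda>x. W x ^ ?n) a (s' * \<rho>) / M ^ (?n - 1) + M powr (1 - q) * ball_int (\<lambda>x. W x powr q) a (2 * \<rho>)) / \<rho> ^ ?n"
            using P by (intro divide_right_mono) (auto simp: mult_left_mono)
          also have "\<dots> = F s' / M ^ (?n - 1) + M powr (1 - q) * Q"
            by (simp add: F_def Q_def add_divide_distrib)
          also have "\<dots> \<le> (F s' + \<epsilon>) / M ^ (?n - 1) + M powr (1 - q) * Q"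
            using \<epsilon> M by (intro add_right_mono divide_right_mono) auto
          finally show "l s' \<le> (F s' + \<epsilon>) / M ^ (?n - 1) + M powr (1 - q) * Q" by (simp add: l_def)
        qed
        then show "b0 / h ^ e * l s' ^ ?n \<le> F s' / 4 + (8 * 2 ^ ?n * (b0 / h ^ e)) powr p * Q powr (real ?n / q) + \<epsilon>"
          using \<epsilon> by (simp add: p_def add_divide_distrib)
      qed
      moreover have "(8 * 2 ^ ?n * (b0 / h ^ e)) powr p = A0 * (1 / h) powr k"
      proof -
        have "8 * 2 ^ ?n * (b0 / h ^ e) = (8 * 2 ^ ?n * b0) * (1 / h) powr real e"
          using h by (simp add: powr_realpow power_divide)
        then show ?thesis using h b0 by (simp add: A0_def k_def powr_mult powr_powr)
      qed
      ultimately show ?thesis using 1 by (simp add: h_def mult_ac)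
    qed
    have "F 1 \<le> 4 * (1 / (1 - (2 / 3) powr (1 / k))) powr k * (A0 * Q powr (real ?n / q))"
      by (rule iterate_absorption[where B = "F 2"])
         (use F0 Fmono k step in \<open>auto simp: A0_def mult_ac\<close>)
    then show ?thesis by (simp add: F_def Q_def A_def mult_ac)
  qed
  ultimately show ?thesis by blast
qed

text \<open>Exponents above 1 are reduced to exponent 1 by the power mean inequality. Raising to the
  power \<open>q / n\<close> makes the right side linear in the integral of
  \<open>W x powr q\<close>, and only in this form can Fubini be applied to it later.\<close>

lemma reverse_Hoelder:
  assumes n: "2 \<le> DIM('a::euclidean_space)" and C: "0 < C" and q: "0 < q" "q \<le> real DIM('a)"
  shows "\<exists>A>0. \<forall>U W (a::'a) \<rho>. caccioppoli_weight U C W \<and> 0 < \<rho> \<and> cball a (2 * \<rho>) \<subseteq> U \<longrightarrow>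
     (ball_int (\<lambda>x. W x ^ DIM('a)) a \<rho> / \<rho> ^ DIM('a)) powr (q / real DIM('a)) \<le>
       A * (ball_int (\<lambda>x. W x powr q) a (2 * \<rho>) / \<rho> ^ DIM('a))"
proof -
  let ?n = "DIM('a)"
  define q' where "q' = min q 1"
  have q': "0 < q'" "q' \<le> 1" using q by (auto simp: q'_def)
  obtain A where A: "A > 0" and RH: "\<And>U W (a::'a) \<rho>. caccioppoli_weight U C W \<Longrightarrow> 0 < \<rho> \<Longrightarrow> cball a (2 * \<rho>) \<subseteq> U \<Longrightarrow>
     ball_int (\<lambda>x. W x ^ ?n) a \<rho> / \<rho> ^ ?n \<le> A * (ball_int (\<lambda>x. W x powr q') a (2 * \<rho>) / \<rho> ^ ?n) powr (real ?n / q')"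
    using reverse_Hoelder_small_exponent[OF n C q'] by blast
  define v where "v = measure lborel (ball (0::'a) 1) * 2 ^ ?n"
  have v: "v > 0" by (simp add: v_def)
  define A' where "A' = A powr (q / real ?n) * (v + 1) powr (q / q')"
  have "A' > 0" using A v by (simp add: A'_def)
  moreover have "(ball_int (\<lambda>x. W x ^ ?n) a \<rho> / \<rho> ^ ?n) powr (q / real ?n) \<le> A' * (ball_int (\<lambda>x. W x powr q) a (2 * \<rho>) / \<rho> ^ ?n)"
    if W: "caccioppoli_weight U C W" and \<rho>: "0 < \<rho>" and sub: "cball a (2 * \<rho>) \<subseteq> U" for U W and a :: 'a and \<rho>
  proof -
    let ?B = "ball a (2 * \<rho>)"
    define F where "F = ball_int (\<lambda>x. W x ^ ?n) a \<rho> / \<rho> ^ ?n"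
    define Q where "Q = ball_int (\<lambda>x. W x powr q) a (2 * \<rho>) / \<rho> ^ ?n"
    define Q' where "Q' = ball_int (\<lambda>x. W x powr q') a (2 * \<rho>) / \<rho> ^ ?n"
    have P: "\<rho> ^ ?n > 0" using \<rho> by simp
    have w: "W x \<ge> 0" for x using weight_nonneg[OF W] .
    have F0: "F \<ge> 0" unfolding F_def using P w by (auto intro!: divide_nonneg_pos ball_int_nonneg)
    have Q0: "Q \<ge> 0" "Q' \<ge> 0" unfolding Q_def Q'_def using P by (auto intro!: divide_nonneg_pos ball_int_nonneg)
    have mB: "measure lborel ?B = v * \<rho> ^ ?n"
      using measure_ball_scale[of "2 * \<rho>" a] \<rho> by (simp add: v_def power_mult_distrib)
    have iq: "set_integrable lborel ?B (\<lambda>x. W x powr q)" "set_integrable lborel ?B (\<lambda>x. W x powr q')"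
      using weight_powr_set_integrable[OF W sub _ _ q, of ?B] weight_powr_set_integrable[OF W sub _ _ q'(1), of ?B] q' n by auto
    \<comment> \<open>The power mean inequality with a crude constant, from splitting at level
      \<open>M\<close>. The choice is \<open>M = Q powr (1 / q)\<close>, or arbitrarily small
      \<open>M\<close> if \<open>Q = 0\<close>.\<close>
    have QM: "Q' \<le> M powr q' * v + M powr (q' - q) * Q" if M: "0 < M" for M
    proof -
      have "ball_int (\<lambda>x. W x powr q') a (2 * \<rho>) \<le> (LINT x:?B|lborel. M powr q' * 1 + M powr (q' - q) * W x powr q)"
        unfolding ball_int_def
      proof (rule set_integral_mono[OF iq(2)])
        have i1: "set_integrable lborel ?B (\<lambda>x. 1 :: real)"
          unfolding set_integrable_def using integrable_real_indicator[of ?B lborel] emeasure_lborel_ball_finite[of a "2 * \<rho>"] by simp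
        then show "set_integrable lborel ?B (\<lambda>x. M powr q' * 1 + M powr (q' - q) * W x powr q)"
          by (intro set_integral_add(1) set_integrable_mult_right iq)
        fix x
        show "W x powr q' \<le> M powr q' * 1 + M powr (q' - q) * W x powr q"
        proof (cases "W x \<le> M")
          case True
          then have "W x powr q' \<le> M powr q'" using w q' by (intro powr_mono2) auto
          then show ?thesis by (simp add: add_increasing2)
        next
          case False
          then have W0: "W x > 0" using M by linarith
          have "W x powr q' = W x powr (q' - q) * W x powr q" using W0 by (simp add: powr_add[symmetric])
          also have "\<dots> \<le> M powr (q' - q) * W x powr q"
            using False M W0 by (intro mult_right_mono powr_mono2') (auto simp: q'_def)
          finally show ?thesis by (simp add: add_increasing)
        qed
      qed
      also have "\<dots> = M powr q' * measure lborel ?B + M powr (q' - q) * ball_int (\<lambda>x. W x powr q) a (2 * \<rho>)"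
      proof -
        have i1: "set_integrable lborel ?B (\<lambda>x. M powr q' * 1 :: real)"
          unfolding set_integrable_def using integrable_real_indicator[of ?B lborel] emeasure_lborel_ball_finite[of a "2 * \<rho>"] by simp
        then show ?thesis
          unfolding ball_int_def using iq by (subst set_integral_add(2)) (auto simp: set_lebesgue_integral_def intro: set_integrable_mult_right)
      qed
      finally have "Q' \<le> (M powr q' * (v * \<rho> ^ ?n) + M powr (q' - q) * ball_int (\<lambda>x. W x powr q) a (2 * \<rho>)) / \<rho> ^ ?n"
        unfolding Q'_def mB using P by (intro divide_right_mono) auto
      then show ?thesis using \<rho> by (simp add: Q_def add_divide_distrib)
    qed
    have Q'Q: "Q' \<le> (v + 1) * Q powr (q' / q)"
    proof (cases "Q = 0")
      case True
      have "Q' \<le> 0"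
      proof (rule field_le_epsilon)
        fix \<epsilon> :: real assume \<epsilon>: "\<epsilon> > 0"
        have "Q' \<le> ((\<epsilon> / v) powr (1 / q')) powr q' * v" using QM[of "(\<epsilon> / v) powr (1 / q')"] True \<epsilon> v by simp
        also have "\<dots> = \<epsilon>" using q' \<epsilon> v by (simp add: powr_powr)
        finally show "Q' \<le> 0 + \<epsilon>" by simp
      qed
      then show ?thesis using v by (smt (verit) mult_nonneg_nonneg powr_ge_zero)
    next
      case False
      then have Qp: "Q > 0" using Q0 by simp
      have "Q' \<le> (Q powr (1 / q)) powr q' * v + (Q powr (1 / q)) powr (q' - q) * Q" using QM[of "Q powr (1 / q)"] Qp by simp
      also have "(Q powr (1 / q)) powr (q' - q) * Q = Q powr (q' / q)"
      proof -
        have "(Q powr (1 / q)) powr (q' - q) * Q = Q powr ((q' - q) / q) * Q powr 1" using Qp by (simp add: powr_powr)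
        also have "\<dots> = Q powr ((q' - q) / q + 1)" by (simp only: powr_add)
        also have "(q' - q) / q + 1 = q' / q" using q by (simp add: field_simps)
        finally show ?thesis .
      qed
      also have "(Q powr (1 / q)) powr q' = Q powr (q' / q)" by (simp add: powr_powr)
      finally show ?thesis by (simp add: distrib_right mult.commute)
    qed
    have "F powr (q / real ?n) \<le> (A * Q' powr (real ?n / q')) powr (q / real ?n)"
      unfolding F_def Q'_def using RH[OF W \<rho> sub] F0 q by (intro powr_mono2) (auto simp: F_def)
    also have "\<dots> = A powr (q / real ?n) * Q' powr (q / q')"
      using A Q0 by (simp add: powr_mult powr_powr)
    also have "Q' powr (q / q') \<le> ((v + 1) * Q powr (q' / q)) powr (q / q')"
      using Q'Q Q0 q q' by (intro powr_mono2) auto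
    also have "\<dots> = (v + 1) powr (q / q') * Q"
      using v Q0 q q' by (simp add: powr_mult powr_powr)
    finally show ?thesis using A by (simp add: F_def Q_def A'_def mult.assoc mult_left_mono)
  qed
  ultimately show ?thesis by blast
qed


section \<open>Quasiregular maps\<close>

lemma test_fun_continuous:
  assumes "test_fun U (\<phi> :: 'a::euclidean_space \<Rightarrow> real)"
  shows "continuous_on UNIV \<phi>" and "b \<in> Basis \<Longrightarrow> continuous_on UNIV (\<lambda>x. frechet_derivative \<phi> (at x) b)"
proof -
  show "continuous_on UNIV \<phi>" using assms unfolding test_fun_def by (metis Ck.simps(1))
  have "Ck (Suc 0) \<phi>" using assms unfolding test_fun_def by blast
  then show "b \<in> Basis \<Longrightarrow> continuous_on UNIV (\<lambda>x. frechet_derivative \<phi> (at x) b)" by simp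
qed

lemma borel_matrix_representative:
  fixes D :: "real^'n \<Rightarrow> real^'n^'n"
  assumes D: "D \<in> borel_measurable (lebesgue_on U)" and U: "U \<in> sets borel"
  obtains D' where "D' \<in> borel_measurable borel" "AE x in lborel. x \<in> U \<longrightarrow> D x = D' x"
proof -
  have mU: "U \<in> sets lebesgue" using U by (simp add: sets_completionI_sets)
  have c: "(\<lambda>x. if x \<in> U then D x $ i $ j else 0) \<in> borel_measurable lebesgue" for i j
  proof -
    have "(\<lambda>x. D x $ i $ j) \<in> borel_measurable (lebesgue_on U)" by (rule measurable_entry[OF D])
    then show ?thesis using mU by (simp add: borel_measurable_if)
  qed
  define P where "P i j g \<longleftrightarrow> g \<in> borel_measurable lborel \<and>
    (AE x in lborel. (if x \<in> U then D x $ i $ j else 0) = g x)" for i j and g :: "real^'n \<Rightarrow> real"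
  have "\<exists>g. P i j g" for i j
    using completion_ex_borel_measurable_real[OF c[of i j]] unfolding P_def by blast
  then have "\<exists>d. \<forall>i j. P i j (d i j)" by metis
  then obtain d where P: "\<And>i j. P i j (d i j)" by blast
  have d: "\<And>i j. d i j \<in> borel_measurable borel"
    "\<And>i j. AE x in lborel. (if x \<in> U then D x $ i $ j else 0) = d i j x"
    using P by (simp_all add: P_def)
  define D' where "D' x = (\<chi> i j. d i j x)" for x
  have "(\<lambda>x. D' x \<bullet> axis i (axis j 1)) = d i j" for i j
    by (simp add: fun_eq_iff inner_axis D'_def)
  then have m: "D' \<in> borel_measurable borel"
    using d(1) by (subst borel_measurable_euclidean_space) (auto simp: Basis_vec_def)
  have "AE x in lborel. \<forall>i j. (if x \<in> U then D x $ i $ j else 0) = d i j x"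
    using d(2) by (simp add: AE_all_countable)
  then have "AE x in lborel. x \<in> U \<longrightarrow> D x = D' x"
    by eventually_elim (auto simp: vec_eq_iff D'_def)
  with m show ?thesis using that by blast
qed

lemma set_integral_lebesgue_eq_lborel:
  fixes g h :: "'a::euclidean_space \<Rightarrow> real"
  assumes h: "(\<lambda>x. indicator U x * h x) \<in> borel_measurable borel"
    and g: "g \<in> borel_measurable (lebesgue_on U)" and U: "U \<in> sets borel"
    and ae: "AE x in lborel. x \<in> U \<longrightarrow> g x = h x"
  shows "(LINT x:U|lebesgue. g x) = (LINT x|lborel. indicator U x * h x)"
    and "set_integrable lebesgue U g \<longleftrightarrow> integrable lborel (\<lambda>x. indicator U x * h x)"
proof -
  have mU: "U \<in> sets lebesgue" using U by (simp add: sets_completionI_sets)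
  have "(\<lambda>x. if x \<in> U then g x else 0) \<in> borel_measurable lebesgue"
    using g mU by (simp add: borel_measurable_if)
  moreover have "(\<lambda>x. if x \<in> U then g x else 0) = (\<lambda>x. indicator U x *\<^sub>R g x)" by (auto simp: indicator_def)
  ultimately have mg: "(\<lambda>x. indicator U x *\<^sub>R g x) \<in> borel_measurable lebesgue" by simp
  have mh: "(\<lambda>x. indicator U x * h x) \<in> borel_measurable lebesgue"
    using h by (simp add: measurable_completion)
  have "AE x in lebesgue. x \<in> U \<longrightarrow> g x = h x" using ae by (rule AE_completion)
  then have ae': "AE x in lebesgue. indicator U x *\<^sub>R g x = indicator U x * h x"
    by eventually_elim (auto simp: indicator_def)
  have "(LINT x:U|lebesgue. g x) = (LINT x|lebesgue. indicator U x * h x)"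
    unfolding set_lebesgue_integral_def by (rule integral_cong_AE[OF mg mh ae'])
  also have "\<dots> = (LINT x|lborel. indicator U x * h x)"
    using h by (simp add: integral_completion)
  finally show "(LINT x:U|lebesgue. g x) = (LINT x|lborel. indicator U x * h x)" .
  show "set_integrable lebesgue U g \<longleftrightarrow> integrable lborel (\<lambda>x. indicator U x * h x)"
    unfolding set_integrable_def using integrable_cong_AE[OF mg mh ae'] h by (simp add: integrable_completion)
qed

text \<open>The weak derivative is only Lebesgue measurable and determined almost everywhere; a
  Borel representative \<open>D\<close> of it is fixed once, and \<open>W\<close> is its operator
  norm. All later integrals refer to \<open>W\<close> on \<open>lborel\<close>.\<close>

lemma quasiregular_weight:
  fixes f :: "real^'n \<Rightarrow> real^'n"
  assumes qr: "quasiregular_on K U f" and U: "open U"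
  obtains W where "caccioppoli_weight U (K * caccioppoli_const TYPE('n)) W"
    "AE x in lborel. x \<in> U \<longrightarrow> deriv_opnorm U f x = W x"
    "deriv_opnorm U f \<in> borel_measurable (lebesgue_on U)"
proof -
  let ?n = "CARD('n)"
  define D0 where "D0 = weak_deriv U f"
  have K: "1 \<le> K" and cf: "continuous_on U f" and W1: "W1p_loc (real ?n) U f"
    and ae0: "AE x in lebesgue_on U. deriv_opnorm U f x ^ ?n \<le> K * det (D0 x)"
    using qr by (auto simp: quasiregular_on_def D0_def)
  have wd0: "has_weak_deriv U f D0"
    unfolding D0_def weak_deriv_def using W1 someI_ex[of "has_weak_deriv U f"] unfolding W1p_loc_def by blast
  have L1: "Lp_loc 1 U D0" and Ln: "Lp_loc (real ?n) U D0" using wd0 W1 by (auto simp: has_weak_deriv_def W1p_loc_def D0_def)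
  have mD0: "D0 \<in> borel_measurable (lebesgue_on U)" using L1 by (simp add: Lp_loc_def)
  have bU[measurable]: "U \<in> sets borel" using U by simp
  have lU: "U \<in> sets lebesgue" using bU by (simp add: sets_completionI_sets)
  obtain D where mD[measurable]: "D \<in> borel_measurable borel" and aeD: "AE x in lborel. x \<in> U \<longrightarrow> D0 x = D x"
    using borel_matrix_representative[OF mD0 bU] by blast
  note mDij[measurable] = measurable_entry[OF mD] and mD0ij = measurable_entry[OF mD0]
  have mf: "(\<lambda>x. indicator U x *\<^sub>R f x) \<in> borel_measurable borel"
    by (rule borel_measurable_continuous_on_indicator[OF bU cf])
  have cfi: "continuous_on U (\<lambda>x. f x $ i)" for i by (intro continuous_intros cf)
  have bm_lebU: "h \<in> borel_measurable (lebesgue_on U)" if "continuous_on U h" for h :: "real^'n \<Rightarrow> real"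
    by (rule continuous_imp_measurable_on_sets_lebesgue[OF that lU])
  have wd: "borel_weak_deriv U f D"
    unfolding borel_weak_deriv_def
  proof (intro conjI allI impI mf mD bU)
    fix \<phi> i j assume tf: "test_fun U (\<phi> :: real^'n \<Rightarrow> real)"
    have ax: "axis j 1 \<in> (Basis :: (real^'n) set)" by (simp add: axis_in_Basis_iff)
    have c1: "continuous_on UNIV \<phi>" and c2: "continuous_on UNIV (\<lambda>x. frechet_derivative \<phi> (at x) (axis j 1))"
      using test_fun_continuous[OF tf] ax by auto
    have [measurable]: "\<phi> \<in> borel_measurable borel" using c1 by (rule borel_measurable_continuous_onI)
    have e1: "(LINT x:U|lebesgue. f x $ i * frechet_derivative \<phi> (at x) (axis j 1)) =
        (LINT x|lborel. indicator U x * (f x $ i * frechet_derivative \<phi> (at x) (axis j 1)))"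
    proof (rule set_integral_lebesgue_eq_lborel(1))
      have c3: "continuous_on U (\<lambda>x. f x $ i * frechet_derivative \<phi> (at x) (axis j 1))"
        by (intro continuous_on_mult cfi continuous_on_subset[OF c2]) simp
      show "(\<lambda>x. indicator U x * (f x $ i * frechet_derivative \<phi> (at x) (axis j 1))) \<in> borel_measurable borel"
        using borel_measurable_continuous_on_indicator[OF bU c3] by simp
      show "(\<lambda>x. f x $ i * frechet_derivative \<phi> (at x) (axis j 1)) \<in> borel_measurable (lebesgue_on U)"
        by (rule bm_lebU[OF c3])
    qed (use bU in auto)
    have e2: "(LINT x:U|lebesgue. D0 x $ i $ j * \<phi> x) = (LINT x|lborel. indicator U x * (D x $ i $ j * \<phi> x))"
    proof (rule set_integral_lebesgue_eq_lborel(1))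
      show "(\<lambda>x. D0 x $ i $ j * \<phi> x) \<in> borel_measurable (lebesgue_on U)"
        by (intro borel_measurable_times mD0ij bm_lebU continuous_on_subset[OF c1]) simp
      show "AE x in lborel. x \<in> U \<longrightarrow> D0 x $ i $ j * \<phi> x = D x $ i $ j * \<phi> x"
        using aeD by eventually_elim simp
    qed measurable
    show "(LINT x|lborel. indicator U x * (f x $ i * frechet_derivative \<phi> (at x) (axis j 1))) =
        - (LINT x|lborel. indicator U x * (D x $ i $ j * \<phi> x))"
      using wd0 tf unfolding has_weak_deriv_def e1[symmetric] e2[symmetric] by blast
  qed
  have "AE x in lebesgue. x \<in> U \<longrightarrow> deriv_opnorm U f x ^ ?n \<le> K * det (D0 x)"
    using ae0 lU by (subst (asm) AE_restrict_space_iff) auto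
  then have "AE x in lborel. x \<in> U \<longrightarrow> deriv_opnorm U f x ^ ?n \<le> K * det (D0 x)" by (simp add: AE_completion_iff)
  with aeD have qrD: "AE x in lborel. x \<in> U \<longrightarrow> opnorm (D x) ^ ?n \<le> K * det (D x)"
    by eventually_elim (auto simp: deriv_opnorm_def opnorm_def D0_def)
  have intD: "integrable lborel (\<lambda>x. indicator (cball a R) x * opnorm (D x) ^ ?n)" if sub: "cball a R \<subseteq> U" for a R
  proof -
    have b: "cball a R \<in> sets borel" by simp
    have "set_integrable lebesgue (cball a R) (\<lambda>x. norm (D0 x) powr real ?n)"
      using Ln[unfolded Lp_loc_def, THEN conjunct2, rule_format, of "cball a R"] sub by simp
    moreover have "set_integrable lebesgue (cball a R) (\<lambda>x. norm (D0 x) powr real ?n) \<longleftrightarrow>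
        integrable lborel (\<lambda>x. indicator (cball a R) x * norm (D x) ^ ?n)"
    proof (rule set_integral_lebesgue_eq_lborel(2)[OF _ _ b])
      show "(\<lambda>x. indicator (cball a R) x * norm (D x) ^ ?n) \<in> borel_measurable borel" using b by measurable
      have "(\<lambda>x. norm (D0 x) powr real ?n) \<in> borel_measurable (lebesgue_on U)" using mD0 by measurable
      then show "(\<lambda>x. norm (D0 x) powr real ?n) \<in> borel_measurable (lebesgue_on (cball a R))"
        by (rule measurable_restrict_mono) (use sub in auto)
      show "AE x in lborel. x \<in> cball a R \<longrightarrow> norm (D0 x) powr real ?n = norm (D x) ^ ?n"
        using aeD
      proof eventually_elim
        case (elim x)
        show ?case using elim sub by (cases "D x = 0") (auto simp: powr_realpow subset_iff zero_power)
      qed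
    qed
    ultimately have i: "integrable lborel (\<lambda>x. indicator (cball a R) x * norm (D x) ^ ?n)" by simp
    let ?N = "real ?n * real ?n"
    have le: "opnorm (D x) ^ ?n \<le> ?N ^ ?n * norm (D x) ^ ?n" for x
      using power_mono[OF opnorm_le_norm[of "D x"], of ?n] by (simp add: power_mult_distrib)
    show ?thesis
      by (rule Bochner_Integration.integrable_bound[OF integrable_mult_right[OF i, of "?N ^ ?n"]])
         (use le b in \<open>auto simp: indicator_def abs_mult\<close>)
  qed
  have intf: "integrable lborel (\<lambda>x. indicator (cball a R) x *\<^sub>R f x)" if "cball a R \<subseteq> U" for a R
    by (rule borel_integrable_compact) (use that cf continuous_on_subset in auto)
  define W where "W x = opnorm (D x)" for x
  have "caccioppoli_weight U (K * caccioppoli_const TYPE('n)) W"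
    unfolding caccioppoli_weight_def
  proof (intro conjI allI impI)
    show "W \<in> borel_measurable borel" unfolding W_def by measurable
    show "0 \<le> W x" for x by (simp add: W_def)
    show "integrable lborel (\<lambda>x. indicator (cball a R) x * W x ^ DIM(real^'n))" if "cball a R \<subseteq> U" for a R
      using intD[OF that] by (simp add: W_def)
    fix a :: "real^'n" and R' r R \<delta> t :: real
    assume h: "cball a R' \<subseteq> U \<and> 0 < r \<and> r < R \<and> 0 < \<delta> \<and> R + \<delta> < R' \<and> 0 < t"
    have si: "set_integrable lborel S (\<lambda>x. opnorm (D x) ^ ?n)" if "S \<in> sets borel" "S \<subseteq> cball a R'" for S
    proof -
      have "set_integrable lborel (cball a R') (\<lambda>x. opnorm (D x) ^ ?n)"
        using intD h by (simp add: set_integrable_def)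
      then show ?thesis by (rule set_integrable_subset) (use that in auto)
    qed
    have "ball a r \<subseteq> cball a R'" "ball a R - ball a r \<subseteq> cball a R'" using h by auto
    then have "(LINT x:ball a r \<union> (ball a R - ball a r)|lborel. opnorm (D x) ^ ?n) =
        (LINT x:ball a r|lborel. opnorm (D x) ^ ?n) + (LINT x:ball a R - ball a r|lborel. opnorm (D x) ^ ?n)"
      by (intro set_integral_Un si) auto
    moreover have "ball a r \<union> (ball a R - ball a r) = ball a R" using h by auto
    ultimately have ann: "(LINT x:ball a R - ball a r|lborel. opnorm (D x) ^ ?n) =
        ball_int (\<lambda>x. W x ^ ?n) a R - ball_int (\<lambda>x. W x ^ ?n) a r"
      by (simp add: ball_int_def W_def)
    show "ball_int (\<lambda>x. W x ^ DIM(real^'n)) a r \<le> K * caccioppoli_const TYPE('n) / (R - r) *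
          ((\<delta> ^ DIM(real^'n) * ball_int (\<lambda>x. W x ^ DIM(real^'n)) a (R + \<delta>) +
            (R\<^sup>2 / \<delta> ^ DIM(real^'n)) ^ DIM(real^'n) * ball_int W a (R + \<delta>) ^ DIM(real^'n)) / t ^ (DIM(real^'n) - 1) +
           t * (ball_int (\<lambda>x. W x ^ DIM(real^'n)) a R - ball_int (\<lambda>x. W x ^ DIM(real^'n)) a r))"
      using quasiregular_Caccioppoli[OF wd _ _ qrD _ _ _ _ _ intf intD, of a R' r R \<delta> t] h K
      unfolding ann by (simp add: ball_int_def W_def)
  qed
  moreover have "AE x in lborel. x \<in> U \<longrightarrow> deriv_opnorm U f x = W x"
    using aeD by eventually_elim (simp add: deriv_opnorm_def W_def opnorm_def D0_def)
  moreover have "deriv_opnorm U f \<in> borel_measurable (lebesgue_on U)"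
    using measurable_compose[OF mD0 measurable_opnorm]
    unfolding opnorm_def D0_def deriv_opnorm_def[abs_def] .
  ultimately show ?thesis using that by blast
qed


section \<open>Averages over Whitney balls\<close>

text \<open>\<open>avg_deriv\<close> with \<open>W\<close> in place of the operator norm. For
  \<open>norm x < 1\<close> the denominator is the volume of \<open>wball 2 x\<close>, a ball of
  radius \<open>1 - norm x\<close>.\<close>

definition weight_avg :: "('a::euclidean_space \<Rightarrow> real) \<Rightarrow> real \<Rightarrow> 'a \<Rightarrow> real" where
  "weight_avg W s x = root DIM('a) (ball_int (\<lambda>y. W y ^ DIM('a)) x (s / 2 * (1 - norm x)) /
     (measure lborel (ball (0::'a) 1) * (1 - norm x) ^ DIM('a)))"

lemma measurable_ball_int[measurable (raw)]:
  fixes h :: "'a::euclidean_space \<Rightarrow> real"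
  assumes [measurable]: "h \<in> borel_measurable borel" "r \<in> borel_measurable borel"
  shows "(\<lambda>x. ball_int h x (r x)) \<in> borel_measurable borel"
proof -
  have "(\<lambda>(x, y). if dist x y < r x then h y else 0) \<in> borel_measurable (borel \<Otimes>\<^sub>M lborel)"
    by measurable
  then have "(\<lambda>x. LINT y|lborel. (if dist x y < r x then h y else 0)) \<in> borel_measurable borel"
    by (rule lborel.borel_measurable_lebesgue_integral)
  moreover have "(\<lambda>x. LINT y|lborel. (if dist x y < r x then h y else 0)) = (\<lambda>x. ball_int h x (r x))"
    unfolding ball_int_def set_lebesgue_integral_def
    by (intro ext Bochner_Integration.integral_cong) (auto simp: indicator_def)
  ultimately show ?thesis by simp
qed

lemma measurable_weight_avg[measurable]:
  assumes [measurable]: "W \<in> borel_measurable borel"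
  shows "weight_avg W s \<in> borel_measurable borel"
proof -
  have [measurable]: "root n \<in> borel_measurable borel" for n
    by (intro borel_measurable_continuous_onI continuous_on_real_root continuous_on_id)
  show ?thesis unfolding weight_avg_def[abs_def] by measurable
qed

text \<open>The common scheme of both inequalities: the left integrand is bounded by an average of
  \<open>Y\<close> with kernel \<kappa>, and the integral of \<kappa> in the other variable is
  controlled. The kernel may contain a factor depending on \<open>x\<close> that is estimated only
  after the exchange.\<close>

lemma Fubini_transfer:
  fixes F Y Z :: "'a::euclidean_space \<Rightarrow> ennreal" and \<kappa> :: "'a \<Rightarrow> 'a \<Rightarrow> ennreal"
  assumes \<kappa>: "(\<lambda>(x, y). \<kappa> x y) \<in> borel_measurable (lborel \<Otimes>\<^sub>M lborel)"
    and Y[measurable]: "Y \<in> borel_measurable borel"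
    and F: "AE x in lborel. F x \<le> (\<integral>\<^sup>+y. \<kappa> x y * Y y \<partial>lborel)"
    and Z: "\<And>y. (\<integral>\<^sup>+x. \<kappa> x y \<partial>lborel) * Y y \<le> Z y"
  shows "(\<integral>\<^sup>+x. F x \<partial>lborel) \<le> (\<integral>\<^sup>+y. Z y \<partial>lborel)"
proof -
  note [measurable] = \<kappa>
  have "(\<integral>\<^sup>+x. F x \<partial>lborel) \<le> (\<integral>\<^sup>+x. \<integral>\<^sup>+y. \<kappa> x y * Y y \<partial>lborel \<partial>lborel)"
    by (rule nn_integral_mono_AE[OF F])
  also have "\<dots> = (\<integral>\<^sup>+y. \<integral>\<^sup>+x. \<kappa> x y * Y y \<partial>lborel \<partial>lborel)"
    by (rule nn_integral_swap) (auto intro: sigma_finite_lborel)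
  also have "\<dots> = (\<integral>\<^sup>+y. (\<integral>\<^sup>+x. \<kappa> x y \<partial>lborel) * Y y \<partial>lborel)"
    by (intro nn_integral_cong nn_integral_multc) measurable
  also have "\<dots> \<le> (\<integral>\<^sup>+y. Z y \<partial>lborel)" by (intro nn_integral_mono Z)
  finally show ?thesis .
qed

lemma nn_integral_ball_int:
  assumes "set_integrable lborel (ball a r) h" "\<And>x. 0 \<le> h x"
  shows "(\<integral>\<^sup>+x. indicator (ball a r) x * ennreal (h x) \<partial>lborel) = ennreal (ball_int h a r)"
proof -
  have "(\<integral>\<^sup>+x. indicator (ball a r) x * ennreal (h x) \<partial>lborel) = (\<integral>\<^sup>+x. ennreal (indicator (ball a r) x *\<^sub>R h x) \<partial>lborel)"
    by (intro nn_integral_cong) (auto simp: indicator_def)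
  also have "\<dots> = ennreal (ball_int h a r)"
    using nn_integral_eq_integral[OF assms(1)[unfolded set_integrable_def]] assms(2)
    by (simp add: ball_int_def set_lebesgue_integral_def)
  finally show ?thesis .
qed

lemma whitney_cball_subset:
  fixes y :: "'a::real_normed_vector"
  assumes "norm y < 1" "s < 2"
  shows "cball y (s / 2 * (1 - norm y)) \<subseteq> ball 0 1"
proof
  fix z assume "z \<in> cball y (s / 2 * (1 - norm y))"
  then have "norm (z - y) \<le> s / 2 * (1 - norm y)" by (simp add: dist_norm norm_minus_commute)
  also have "\<dots> < 1 * (1 - norm y)" using assms by (intro mult_strict_right_mono) auto
  finally show "z \<in> ball 0 1" using norm_triangle_ineq[of "z - y" y] by simp
qed

context
  fixes C :: real and W :: "'a::euclidean_space \<Rightarrow> real"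
  assumes W: "caccioppoli_weight (ball 0 1) C W"
begin

lemma weight_avg_nonneg: "norm x < 1 \<Longrightarrow> 0 \<le> weight_avg W s x"
  unfolding weight_avg_def
  by (intro real_root_ge_zero divide_nonneg_nonneg ball_int_nonneg mult_nonneg_nonneg)
     (auto simp: weight_nonneg[OF W])

lemma weight_avg_power:
  assumes "norm x < 1"
  shows "weight_avg W s x ^ DIM('a) = ball_int (\<lambda>y. W y ^ DIM('a)) x (s / 2 * (1 - norm x)) /
     (measure lborel (ball (0::'a) 1) * (1 - norm x) ^ DIM('a))"
  unfolding weight_avg_def
  by (intro real_root_pow_pos2 divide_nonneg_nonneg ball_int_nonneg mult_nonneg_nonneg)
     (use assms in \<open>auto simp: weight_nonneg[OF W]\<close>)

lemma ball_int_subset_mono: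
  assumes "ball x r \<subseteq> ball y r'" "cball y r' \<subseteq> ball 0 1"
  shows "ball_int (\<lambda>y. W y ^ DIM('a)) x r \<le> ball_int (\<lambda>y. W y ^ DIM('a)) y r'"
  unfolding ball_int_def set_lebesgue_integral_def
proof (rule integral_mono)
  have i: "set_integrable lborel (ball y r') (\<lambda>y. W y ^ DIM('a))"
    by (rule weight_power_set_integrable[OF W assms(2)]) auto
  then show "integrable lborel (\<lambda>x. indicator (ball y r') x *\<^sub>R W x ^ DIM('a))" by (simp add: set_integrable_def)
  show "integrable lborel (\<lambda>z. indicator (ball x r) z *\<^sub>R W z ^ DIM('a))"
    using set_integrable_subset[OF i, of "ball x r"] assms(1) by (simp add: set_integrable_def)
  show "indicator (ball x r) z *\<^sub>R W z ^ DIM('a) \<le> indicator (ball y r') z *\<^sub>R W z ^ DIM('a)" for z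
    using assms(1) weight_nonneg[OF W] by (auto simp: indicator_def)
qed

text \<open>A larger ball increases the numerator, and a centre farther from the origin decreases
  the normalising volume. Hence no constant appears, and the comparison can be raised to any
  power.\<close>

lemma weight_avg_mono:
  assumes "ball x (s / 2 * (1 - norm x)) \<subseteq> ball y (s' / 2 * (1 - norm y))" "norm x \<le> norm y" "norm y < 1" "s' < 2"
  shows "weight_avg W s x \<le> weight_avg W s' y"
proof -
  have "weight_avg W s x ^ DIM('a) \<le> weight_avg W s' y ^ DIM('a)"
    unfolding weight_avg_power[OF assms(3)] weight_avg_power[OF le_less_trans[OF assms(2,3)]]
  proof (rule frac_le)
    show "ball_int (\<lambda>y. W y ^ DIM('a)) x (s / 2 * (1 - norm x)) \<le> ball_int (\<lambda>y. W y ^ DIM('a)) y (s' / 2 * (1 - norm y))"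
      by (rule ball_int_subset_mono[OF assms(1) whitney_cball_subset[OF assms(3,4)]])
    show "0 \<le> ball_int (\<lambda>y. W y ^ DIM('a)) y (s' / 2 * (1 - norm y))"
      using weight_nonneg[OF W] by (intro ball_int_nonneg) auto
    show "0 < measure lborel (ball (0::'a) 1) * (1 - norm y) ^ DIM('a)" using assms(3) by simp
    show "measure lborel (ball (0::'a) 1) * (1 - norm y) ^ DIM('a) \<le> measure lborel (ball (0::'a) 1) * (1 - norm x) ^ DIM('a)"
      using assms(2,3) by (intro mult_left_mono power_mono) auto
  qed
  then show ?thesis
    using power_mono_iff[of "weight_avg W s x" "weight_avg W s' y" "DIM('a)"] weight_avg_nonneg assms(2,3) by simp
qed

text \<open>Splitting at the level \<open>M = weight_avg W s y\<close> makes both terms equal,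
  whence the factor 2. If the average vanishes, \<open>M\<close> tends to 0 instead.\<close>

lemma weight_powr_ball_le:
  assumes y: "norm y < 1" and s: "0 < s" "s < 2" and q: "0 < q" "q \<le> real DIM('a)"
  shows "ball_int (\<lambda>x. W x powr q) y (s / 2 * (1 - norm y)) \<le>
    2 * weight_avg W s y powr q * (measure lborel (ball (0::'a) 1) * (1 - norm y) ^ DIM('a))"
proof -
  let ?n = "DIM('a)"
  define r where "r = s / 2 * (1 - norm y)"
  define V where "V = measure lborel (ball (0::'a) 1) * (1 - norm y) ^ ?n"
  define \<Phi> where "\<Phi> = ball_int (\<lambda>x. W x ^ ?n) y r"
  have V: "V > 0" using y by (simp add: V_def)
  have r: "0 < r" "r \<le> 1 - norm y"
    using s y mult_right_mono[of "s / 2" 1 "1 - norm y"] by (auto simp: r_def)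
  have sub: "cball y r \<subseteq> ball 0 1" unfolding r_def by (rule whitney_cball_subset[OF y s(2)])
  have mB: "measure lborel (ball y r) \<le> V"
    using measure_ball_scale[of r y] r by (simp add: V_def mult_left_mono power_mono)
  have i: "set_integrable lborel (ball y r) (\<lambda>x. W x powr q)" "set_integrable lborel (ball y r) (\<lambda>x. W x ^ ?n)"
    using weight_powr_set_integrable[OF W sub _ _ q] weight_power_set_integrable[OF W sub] by auto
  have \<Phi>: "\<Phi> \<ge> 0" unfolding \<Phi>_def using weight_nonneg[OF W] by (intro ball_int_nonneg) auto
  have le: "ball_int (\<lambda>x. W x powr q) y r \<le> M powr q * V + M powr (q - real ?n) * \<Phi>" if M: "0 < M" for M
  proof -
    have i1: "set_integrable lborel (ball y r) (\<lambda>x. M powr q)"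
      unfolding set_integrable_def using integrable_real_indicator[of "ball y r" lborel] emeasure_lborel_ball_finite[of y r] by simp
    have "ball_int (\<lambda>x. W x powr q) y r \<le> (LINT x:ball y r|lborel. M powr q + M powr (q - real ?n) * W x ^ ?n)"
      unfolding ball_int_def
    proof (rule set_integral_mono[OF i(1)])
      show "set_integrable lborel (ball y r) (\<lambda>x. M powr q + M powr (q - real ?n) * W x ^ ?n)"
        by (intro set_integral_add(1) set_integrable_mult_right i i1)
      fix x
      have w: "W x \<ge> 0" using weight_nonneg[OF W] .
      show "W x powr q \<le> M powr q + M powr (q - real ?n) * W x ^ ?n"
      proof (cases "W x \<le> M")
        case True
        then have "W x powr q \<le> M powr q" using w q by (intro powr_mono2) auto
        then show ?thesis using w by (simp add: add_increasing2)
      next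
        case False
        then have W0: "W x > 0" using M by linarith
        have "W x powr q = W x powr (q - real ?n) * W x ^ ?n"
          using W0 by (simp add: powr_realpow[symmetric] powr_add[symmetric])
        also have "\<dots> \<le> M powr (q - real ?n) * W x ^ ?n"
          using False M W0 q by (intro mult_right_mono powr_mono2') auto
        finally show ?thesis by (simp add: add_increasing)
      qed
    qed
    also have "\<dots> = M powr q * measure lborel (ball y r) + M powr (q - real ?n) * \<Phi>"
      unfolding \<Phi>_def ball_int_def using i i1
      by (subst set_integral_add(2)) (auto simp: set_lebesgue_integral_def intro: set_integrable_mult_right)
    also have "\<dots> \<le> M powr q * V + M powr (q - real ?n) * \<Phi>" using mB by (intro add_right_mono mult_left_mono) auto
    finally show ?thesis .
  qed
  define A where "A = weight_avg W s y"
  have An: "A ^ ?n * V = \<Phi>" unfolding A_def weight_avg_power[OF y] \<Phi>_def r_def V_def[symmetric] using V by simp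
  have A0: "A \<ge> 0" unfolding A_def by (rule weight_avg_nonneg[OF y])
  have "ball_int (\<lambda>x. W x powr q) y r \<le> 2 * A powr q * V"
  proof (cases "A = 0")
    case True
    then have "\<Phi> = 0" using An by (simp add: zero_power)
    have "ball_int (\<lambda>x. W x powr q) y r \<le> 0"
    proof (rule field_le_epsilon)
      fix \<epsilon> :: real assume \<epsilon>: "\<epsilon> > 0"
      have "ball_int (\<lambda>x. W x powr q) y r \<le> ((\<epsilon> / V) powr (1 / q)) powr q * V"
        using le[of "(\<epsilon> / V) powr (1 / q)"] \<open>\<Phi> = 0\<close> \<epsilon> V by simp
      also have "\<dots> = \<epsilon>" using q \<epsilon> V by (simp add: powr_powr)
      finally show "ball_int (\<lambda>x. W x powr q) y r \<le> 0 + \<epsilon>" by simp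
    qed
    then show ?thesis using True by simp
  next
    case False
    then have Ap: "A > 0" using A0 by simp
    have "A powr (q - real ?n) * \<Phi> = (A powr (q - real ?n) * A powr real ?n) * V"
      using Ap An by (simp add: powr_realpow mult.assoc)
    also have "\<dots> = A powr q * V" by (simp add: powr_add[symmetric])
    finally show ?thesis using le[OF Ap] by linarith
  qed
  then show ?thesis by (simp add: A_def V_def r_def)
qed

end

section \<open>The two inequalities for weights\<close>

text \<open>Moving \<open>x\<close> radially outwards by
  \<open>\<rho> = \<epsilon> / 2 * (1 - norm x)\<close> yields the centre of a ball of radius \<rho>
  all of whose points are at least as far from the origin as \<open>x\<close>. At the origin any
  direction can be taken.\<close>

lemma emeasure_outer_region_ge:
  fixes x :: "'a::euclidean_space"
  assumes x: "norm x < 1" and e: "0 < \<epsilon>"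
  shows "ennreal (measure lborel (ball (0::'a) 1) * (\<epsilon> / 2) ^ DIM('a) * (1 - norm x) ^ DIM('a)) \<le>
    emeasure lborel {y. norm x \<le> norm y \<and> dist x y < \<epsilon> * (1 - norm x)}"
proof -
  obtain e :: 'a where e: "norm e = 1" "x = norm x *\<^sub>R e"
  proof (cases "x = 0")
    case True
    obtain b :: 'a where "b \<in> Basis" using nonempty_Basis by blast
    then show ?thesis using that[of b] True by simp
  next
    case False
    then show ?thesis using that[of "x /\<^sub>R norm x"] by simp
  qed
  define \<rho> where "\<rho> = \<epsilon> / 2 * (1 - norm x)"
  have \<rho>: "\<rho> > 0" using x assms(2) by (simp add: \<rho>_def)
  have "ball (x + \<rho> *\<^sub>R e) \<rho> \<subseteq> {y. norm x \<le> norm y \<and> dist x y < \<epsilon> * (1 - norm x)}"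
  proof
    fix y assume "y \<in> ball (x + \<rho> *\<^sub>R e) \<rho>"
    then have y: "norm (x + \<rho> *\<^sub>R e - y) < \<rho>" by (simp add: dist_norm)
    have "x + \<rho> *\<^sub>R e = (norm x + \<rho>) *\<^sub>R e" using e(2) by (metis scaleR_left_distrib)
    then have nx: "norm (x + \<rho> *\<^sub>R e) = norm x + \<rho>" using e(1) \<rho> by simp
    have "norm x \<le> norm y" using norm_triangle_ineq2[of "x + \<rho> *\<^sub>R e" y] nx y by linarith
    moreover have "norm (x - y) \<le> norm (x + \<rho> *\<^sub>R e - y) + norm (\<rho> *\<^sub>R e)"
      using norm_triangle_ineq4[of "x + \<rho> *\<^sub>R e - y" "\<rho> *\<^sub>R e"] by (simp add: algebra_simps)
    then have "norm (x - y) < 2 * \<rho>" using y e(1) \<rho> by simp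
    then have "dist x y < \<epsilon> * (1 - norm x)" by (simp add: dist_norm \<rho>_def)
    ultimately show "y \<in> {y. norm x \<le> norm y \<and> dist x y < \<epsilon> * (1 - norm x)}" by simp
  qed
  then have "emeasure lborel (ball (x + \<rho> *\<^sub>R e) \<rho>) \<le> emeasure lborel {y. norm x \<le> norm y \<and> dist x y < \<epsilon> * (1 - norm x)}"
    by (rule emeasure_mono) measurable
  moreover have "measure lborel (ball (0::'a) 1) * (\<epsilon> / 2) ^ DIM('a) * (1 - norm x) ^ DIM('a) = measure lborel (ball (x + \<rho> *\<^sub>R e) \<rho>)"
    using \<rho> by (subst measure_ball_scale) (simp_all only: \<rho>_def power_mult_distrib mult.assoc less_imp_le)
  ultimately show ?thesis by (simp add: emeasure_lborel_ball)
qed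

lemma whitney_comparison:
  fixes x y :: "'a::real_normed_vector"
  assumes "dist x y < \<delta> * (1 - norm x)"
  shows "(1 - \<delta>) * (1 - norm x) \<le> 1 - norm y" "1 - norm y \<le> (1 + \<delta>) * (1 - norm x)"
  using assms norm_triangle_ineq3[of x y] by (auto simp: dist_norm left_diff_distrib distrib_right)

text \<open>Averaging only over points \<open>y\<close> with \<open>norm x \<le> norm y\<close> gives \<open>weight_avg W 1 x \<le> weight_avg W s y\<close>
  without a multiplicative constant, which makes the final constant independent of \<open>p\<close>.\<close>

lemma mixed_le_avg:
  assumes s: "1 < s" "s < 2" and q: "0 < q" "q \<le> real DIM('a::euclidean_space)" and c: "0 < c"
  shows "\<exists>B>0. \<forall>(W :: 'a \<Rightarrow> real) C u N p. caccioppoli_weight (ball 0 1) C W \<and> u \<in> borel_measurable borel \<and>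
     (\<forall>x. 0 \<le> u x) \<and> N \<in> null_sets lborel \<and> (\<forall>x\<in>ball 0 1 - N. \<forall>y\<in>ball x ((1 - norm x) / 4) - N. u x \<le> c * u y) \<and> q \<le> p \<longrightarrow>
     (\<integral>\<^sup>+x. ennreal (W x powr q * weight_avg W 1 x powr (p - q) * u x) * indicator (ball 0 1) x \<partial>lborel) \<le>
     ennreal B * (\<integral>\<^sup>+x. ennreal (weight_avg W s x powr p * u x) * indicator (ball 0 1) x \<partial>lborel)"
proof -
  let ?n = "DIM('a)" and ?U = "ball (0::'a) 1"
  \<comment> \<open>Thus \<open>s = 1 + 4 * \<epsilon>\<close>, which gives
    \<open>\<epsilon> + 1 / 2 \<le> s / 2 * (1 - \<epsilon>)\<close> and the inclusion of the
    Whitney balls below. Also \<open>\<epsilon> < 1 / 4\<close>, as the Harnack inequality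
    demands.\<close>
  define \<epsilon> where "\<epsilon> = (s - 1) / 4"
  have \<epsilon>: "0 < \<epsilon>" "\<epsilon> < 1 / 4" using s by (auto simp: \<epsilon>_def)
  define v where "v = measure lborel ?U"
  have v: "v > 0" by (simp add: v_def)
  define c0 where "c0 = v * (\<epsilon> / 2) ^ ?n"
  have c0: "c0 > 0" using v \<epsilon> by (simp add: c0_def)
  define B where "B = 2 * v / c0 * c"
  have B: "B > 0" using v c0 c by (simp add: B_def)
  have "(\<integral>\<^sup>+x. ennreal (W x powr q * weight_avg W 1 x powr (p - q) * u x) * indicator ?U x \<partial>lborel) \<le>
     ennreal B * (\<integral>\<^sup>+x. ennreal (weight_avg W s x powr p * u x) * indicator ?U x \<partial>lborel)"
    if W: "caccioppoli_weight ?U C W" and mu[measurable]: "u \<in> borel_measurable borel" and u: "\<And>x. 0 \<le> u x"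
      and N: "N \<in> null_sets lborel" and har: "\<And>x y. x \<in> ?U - N \<Longrightarrow> y \<in> ball x ((1 - norm x) / 4) - N \<Longrightarrow> u x \<le> c * u y" and p: "q \<le> p"
    for W C u N p
  proof -
    note weight_measurable[OF W, measurable]
    have w: "0 \<le> W x" for x using weight_nonneg[OF W] .
    have [measurable]: "?U \<in> sets borel" by simp
    \<comment> \<open>\<open>W x powr q\<close> belongs to the kernel: it stays at \<open>x\<close>
      while the average and \<open>u\<close> pass to \<open>y\<close>, and it is integrated over
      \<open>x\<close> afterwards by \<open>weight_powr_ball_le\<close>.\<close>
    define \<kappa> where "\<kappa> x y = (if norm x \<le> norm y \<and> dist x y < \<epsilon> * (1 - norm x) then ennreal (W x powr q / (c0 * (1 - norm x) ^ ?n)) else 0)" for x y :: 'a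
    define Y where "Y y = ennreal (weight_avg W s y powr (p - q) * (c * u y)) * indicator ?U y" for y
    have m\<kappa>: "(\<lambda>(x, y). \<kappa> x y) \<in> borel_measurable (lborel \<Otimes>\<^sub>M lborel)" unfolding \<kappa>_def by measurable
    have mY: "Y \<in> borel_measurable borel" unfolding Y_def by measurable
    have AEN: "AE x in lborel. x \<notin> N" using N by (rule AE_not_in)
    have "(\<integral>\<^sup>+x. ennreal (W x powr q * weight_avg W 1 x powr (p - q) * u x) * indicator ?U x \<partial>lborel) \<le>
        (\<integral>\<^sup>+y. ennreal B * (ennreal (weight_avg W s y powr p * u y) * indicator ?U y) \<partial>lborel)"
    proof (rule Fubini_transfer[OF m\<kappa> mY])
      show "AE x in lborel. ennreal (W x powr q * weight_avg W 1 x powr (p - q) * u x) * indicator ?U x \<le> (\<integral>\<^sup>+y. \<kappa> x y * Y y \<partial>lborel)"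
        using AEN
      proof eventually_elim
        case (elim x)
        show ?case
        proof (cases "x \<in> ?U")
          case True
          then have nx: "norm x < 1" by simp
          define A where "A = {y. norm x \<le> norm y \<and> dist x y < \<epsilon> * (1 - norm x)}"
          define a where "a = W x powr q / (c0 * (1 - norm x) ^ ?n)"
          define L where "L = weight_avg W 1 x powr (p - q) * u x"
          have d: "c0 * (1 - norm x) ^ ?n > 0" using nx c0 by simp
          have a0: "a \<ge> 0" unfolding a_def using d by simp
          have L0: "L \<ge> 0" unfolding L_def using u by simp
          have mA[measurable]: "A \<in> sets borel" unfolding A_def by measurable
          have pt: "ennreal a * ennreal L * indicator A y \<le> \<kappa> x y * Y y" if y: "y \<notin> N" for y
          proof (cases "y \<in> A")
            case yA: True
            then have yA': "norm x \<le> norm y" "dist x y < \<epsilon> * (1 - norm x)" by (auto simp: A_def)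
            have cmp: "(1 - \<epsilon>) * (1 - norm x) \<le> 1 - norm y" by (rule whitney_comparison[OF yA'(2)])
            have "0 < (1 - \<epsilon>) * (1 - norm x)" using \<epsilon> nx by simp
            then have ny: "norm y < 1" using cmp by linarith
            have sub: "ball x (1 / 2 * (1 - norm x)) \<subseteq> ball y (s / 2 * (1 - norm y))"
            proof
              fix z assume "z \<in> ball x (1 / 2 * (1 - norm x))"
              then have "dist x z < 1 / 2 * (1 - norm x)" by (simp only: mem_ball)
              then have "dist y z < \<epsilon> * (1 - norm x) + 1 / 2 * (1 - norm x)"
                using yA'(2) dist_triangle[of y z x] dist_commute[of x y] by linarith
              also have "\<dots> = (\<epsilon> + 1 / 2) * (1 - norm x)" by (simp add: distrib_right)
              also have "\<dots> \<le> (s / 2 * (1 - \<epsilon>)) * (1 - norm x)"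
              proof (rule mult_right_mono)
                have "s / 2 * \<epsilon> \<le> 1 * \<epsilon>" using s \<epsilon> by (intro mult_right_mono) auto
                moreover have "s = 1 + 4 * \<epsilon>" by (simp add: \<epsilon>_def field_simps)
                moreover have "s / 2 * (1 - \<epsilon>) = s / 2 - s / 2 * \<epsilon>" by (simp add: right_diff_distrib)
                ultimately show "\<epsilon> + 1 / 2 \<le> s / 2 * (1 - \<epsilon>)" by linarith
              qed (use nx in simp)
              also have "\<dots> = s / 2 * ((1 - \<epsilon>) * (1 - norm x))" by simp
              also have "\<dots> \<le> s / 2 * (1 - norm y)" using cmp s by (intro mult_left_mono) auto
              finally show "z \<in> ball y (s / 2 * (1 - norm y))" by simp
            qed
            have "weight_avg W 1 x \<le> weight_avg W s y"
              by (rule weight_avg_mono[OF W sub yA'(1) ny s(2)])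
            then have "weight_avg W 1 x powr (p - q) \<le> weight_avg W s y powr (p - q)"
              using weight_avg_nonneg[OF W nx] p by (intro powr_mono2) auto
            moreover have "u x \<le> c * u y"
            proof (rule har)
              have "\<epsilon> * (1 - norm x) \<le> (1 - norm x) / 4" using \<epsilon> nx mult_right_mono[of \<epsilon> "1 / 4" "1 - norm x"] by simp
              then show "y \<in> ball x ((1 - norm x) / 4) - N" using yA' y by simp
            qed (use True elim in simp)
            ultimately have "L \<le> weight_avg W s y powr (p - q) * (c * u y)"
              unfolding L_def using u by (intro mult_mono) auto
            moreover have "\<kappa> x y = ennreal a" using yA' by (simp add: \<kappa>_def a_def)
            ultimately show ?thesis using yA ny by (simp add: Y_def mult_left_mono ennreal_leI)
          qed simp
          have "ennreal (W x powr q * weight_avg W 1 x powr (p - q) * u x) * indicator ?U x = ennreal (a * L * (c0 * (1 - norm x) ^ ?n))"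
          proof -
            have "a * (c0 * (1 - norm x) ^ ?n) = W x powr q"
              unfolding a_def using d by (metis less_irrefl nonzero_eq_divide_eq)
            then have "W x powr q * weight_avg W 1 x powr (p - q) * u x = a * L * (c0 * (1 - norm x) ^ ?n)"
              unfolding L_def by (metis mult.assoc mult.commute)
            then show ?thesis using True by simp
          qed
          also have "\<dots> = ennreal a * ennreal L * ennreal (c0 * (1 - norm x) ^ ?n)"
            using a0 L0 d by (simp add: ennreal_mult)
          also have "\<dots> \<le> ennreal a * ennreal L * emeasure lborel A"
            unfolding A_def c0_def v_def by (intro mult_left_mono emeasure_outer_region_ge nx \<epsilon>) simp
          also have "\<dots> = (\<integral>\<^sup>+y. ennreal a * ennreal L * indicator A y \<partial>lborel)" by (simp add: nn_integral_cmult_indicator)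
          also have "\<dots> \<le> (\<integral>\<^sup>+y. \<kappa> x y * Y y \<partial>lborel)"
          proof (rule nn_integral_mono_AE)
            show "AE y in lborel. ennreal a * ennreal L * indicator A y \<le> \<kappa> x y * Y y" using AEN by eventually_elim (rule pt)
          qed
          finally show ?thesis .
        qed simp
      qed
      fix y :: 'a
      show "(\<integral>\<^sup>+x. \<kappa> x y \<partial>lborel) * Y y \<le> ennreal B * (ennreal (weight_avg W s y powr p * u y) * indicator ?U y)"
      proof (cases "y \<in> ?U")
        case True
        then have ny: "norm y < 1" by simp
        define r where "r = s / 2 * (1 - norm y)"
        define m where "m = (1 - norm y) ^ ?n"
        have m: "m > 0" using ny by (simp add: m_def)
        have sub: "cball y r \<subseteq> ball 0 1" unfolding r_def by (rule whitney_cball_subset[OF ny s(2)])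
        have "\<kappa> x y \<le> ennreal (1 / (c0 * m)) * (indicator (ball y r) x * ennreal (W x powr q))" for x
        proof (cases "norm x \<le> norm y \<and> dist x y < \<epsilon> * (1 - norm x)")
          case xy: True
          have cmp: "(1 - \<epsilon>) * (1 - norm x) \<le> 1 - norm y" using xy whitney_comparison by blast
          have nx: "norm x < 1" using xy ny by linarith
          have "dist x y < \<epsilon> * (1 - norm x)" using xy by simp
          also have "\<dots> \<le> 1 / 2 * ((1 - \<epsilon>) * (1 - norm x))"
            using \<epsilon> nx mult_right_mono[of \<epsilon> "1 / 2 * (1 - \<epsilon>)" "1 - norm x"] by simp
          also have "\<dots> \<le> 1 / 2 * (1 - norm y)" using cmp by simp
          also have "\<dots> \<le> r" unfolding r_def using s ny by (intro mult_right_mono) auto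
          finally have "x \<in> ball y r" by (simp add: dist_commute)
          moreover have "W x powr q / (c0 * (1 - norm x) ^ ?n) \<le> W x powr q / (c0 * m)"
            unfolding m_def using xy ny c0 by (intro divide_left_mono mult_left_mono power_mono mult_pos_pos zero_less_power) auto
          ultimately show ?thesis using xy m c0
            by (simp add: \<kappa>_def ennreal_mult[symmetric] ennreal_leI)
        next
          case False
          show ?thesis unfolding \<kappa>_def if_not_P[OF False] by simp
        qed
        then have "(\<integral>\<^sup>+x. \<kappa> x y \<partial>lborel) \<le> (\<integral>\<^sup>+x. ennreal (1 / (c0 * m)) * (indicator (ball y r) x * ennreal (W x powr q)) \<partial>lborel)"
          by (rule nn_integral_mono)
        also have "\<dots> = ennreal (1 / (c0 * m)) * ennreal (ball_int (\<lambda>x. W x powr q) y r)"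
        proof -
          have [measurable]: "ball y r \<in> sets borel" by simp
          have "(\<lambda>x. indicator (ball y r) x * ennreal (W x powr q)) \<in> borel_measurable lborel" by measurable
          then show ?thesis
            using nn_integral_ball_int[OF weight_powr_set_integrable[OF W sub _ _ q], of y r]
            by (subst nn_integral_cmult) auto
        qed
        also have "\<dots> \<le> ennreal (1 / (c0 * m)) * ennreal (2 * weight_avg W s y powr q * (v * m))"
          unfolding r_def m_def v_def using s by (intro mult_left_mono ennreal_leI weight_powr_ball_le[OF W ny _ _ q]) auto
        also have "\<dots> = ennreal (2 * v / c0 * weight_avg W s y powr q)"
          using m c0 v by (simp add: ennreal_mult[symmetric])
        finally have "(\<integral>\<^sup>+x. \<kappa> x y \<partial>lborel) * Y y \<le> ennreal (2 * v / c0 * weight_avg W s y powr q) * Y y"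
          by (rule mult_right_mono) simp
        also have "\<dots> = ennreal (2 * v / c0 * weight_avg W s y powr q * (weight_avg W s y powr (p - q) * (c * u y)))"
          using True c0 v c u by (simp add: Y_def ennreal_mult[symmetric])
        \<comment> \<open>The powers \<open>q\<close> and \<open>p - q\<close> of the same average
          recombine exactly, also at the value 0, so \<open>B\<close> does not depend on
          \<open>p\<close>.\<close>
        also have "2 * v / c0 * weight_avg W s y powr q * (weight_avg W s y powr (p - q) * (c * u y)) = B * (weight_avg W s y powr p * u y)"
        proof -
          have "weight_avg W s y powr p = weight_avg W s y powr q * weight_avg W s y powr (p - q)"
            unfolding powr_add[symmetric] by simp
          then show ?thesis by (simp add: B_def mult_ac)
        qed
        finally show ?thesis using True B u by (simp add: ennreal_mult)
      qed (simp add: Y_def)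
    qed
    also have "\<dots> = ennreal B * (\<integral>\<^sup>+y. ennreal (weight_avg W s y powr p * u y) * indicator ?U y \<partial>lborel)"
      by (rule nn_integral_cmult) measurable
    finally show ?thesis .
  qed
  note main = this
  show ?thesis
    by (intro exI[of _ B] conjI B allI impI, elim conjE, rule main) (assumption | blast)+
qed

text \<open>Here \<open>y\<close> may be closer to the origin than \<open>x\<close>, and the
  normalising volumes can differ by the factor \<open>(1 + \<delta>) ^ n\<close>. Passing from
  radius \<rho> to \<open>3 * \<rho>\<close> gains the factor \<theta>, which compensates for it, so
  the comparison again has constant 1.\<close>

lemma weight_avg_le_by_hole_filling:
  fixes x y :: "'a::euclidean_space"
  assumes W: "caccioppoli_weight (ball 0 1) C W"
    and hole: "\<And>a \<rho>. 0 < \<rho> \<Longrightarrow> cball a (4 * \<rho>) \<subseteq> ball 0 1 \<Longrightarrow>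
      ball_int (\<lambda>x. W x ^ DIM('a)) a \<rho> \<le> \<theta> * ball_int (\<lambda>x. W x ^ DIM('a)) a (3 * \<rho>)"
    and \<theta>: "0 < \<theta>" and \<delta>: "0 < \<delta>" "\<delta> \<le> 1 / 6" "(1 + \<delta>) ^ DIM('a) * \<theta> \<le> 1"
    and x: "norm x < 1" and xy: "dist x y < \<delta> * (1 - norm x)"
  shows "weight_avg W \<delta> x \<le> weight_avg W 1 y"
proof -
  let ?n = "DIM('a)"
  let ?\<Phi> = "ball_int (\<lambda>x. W x ^ ?n)"
  define v where "v = measure lborel (ball (0::'a) 1)"
  have v: "v > 0" by (simp add: v_def)
  define \<rho> where "\<rho> = \<delta> / 2 * (1 - norm x)"
  have \<rho>: "\<rho> > 0" using \<delta> x by (simp add: \<rho>_def)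
  note cmp = whitney_comparison[OF xy]
  have "0 < (1 - \<delta>) * (1 - norm x)" using \<delta> x by simp
  then have y: "norm y < 1" using cmp(1) by linarith
  have "cball x ((4 * \<delta>) / 2 * (1 - norm x)) \<subseteq> ball 0 1"
    using \<delta> by (intro whitney_cball_subset[OF x]) auto
  then have sub4: "cball x (4 * \<rho>) \<subseteq> ball 0 1" by (simp add: \<rho>_def mult.assoc)
  have sub: "ball x (3 * \<rho>) \<subseteq> ball y (1 / 2 * (1 - norm y))"
  proof
    fix z assume "z \<in> ball x (3 * \<rho>)"
    then have "dist y z < \<delta> * (1 - norm x) + 3 * \<rho>"
      using xy dist_triangle[of y z x] by (simp add: dist_commute)
    also have "\<dots> = (5 / 2 * \<delta>) * (1 - norm x)" by (simp add: \<rho>_def field_simps)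
    \<comment> \<open>\<open>5 / 2 * \<delta> \<le> 1 / 2 * (1 - \<delta>)\<close> is the condition
      \<open>\<delta> \<le> 1 / 6\<close>.\<close>
    also have "\<dots> \<le> (1 / 2 * (1 - \<delta>)) * (1 - norm x)" using \<delta> x by (intro mult_right_mono) auto
    also have "\<dots> \<le> 1 / 2 * (1 - norm y)" using cmp(1) by simp
    finally show "z \<in> ball y (1 / 2 * (1 - norm y))" by simp
  qed
  have \<Phi>: "?\<Phi> y (1 / 2 * (1 - norm y)) \<ge> 0" using weight_nonneg[OF W] by (intro ball_int_nonneg) auto
  have "?\<Phi> x \<rho> \<le> \<theta> * ?\<Phi> x (3 * \<rho>)" by (rule hole[OF \<rho> sub4])
  also have "\<dots> \<le> \<theta> * ?\<Phi> y (1 / 2 * (1 - norm y))"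
    using \<theta> by (intro mult_left_mono ball_int_subset_mono[OF W sub] whitney_cball_subset[OF y]) auto
  finally have "?\<Phi> x \<rho> / (v * (1 - norm x) ^ ?n) \<le> \<theta> * ?\<Phi> y (1 / 2 * (1 - norm y)) / (v * (1 - norm x) ^ ?n)"
    using v x by (intro divide_right_mono) auto
  also have "\<dots> \<le> \<theta> * ?\<Phi> y (1 / 2 * (1 - norm y)) / (v * (\<theta> * (1 - norm y) ^ ?n))"
  proof (rule divide_left_mono)
    have "(1 - norm y) ^ ?n \<le> ((1 + \<delta>) * (1 - norm x)) ^ ?n" using cmp(2) y by (intro power_mono) auto
    then have "\<theta> * (1 - norm y) ^ ?n \<le> \<theta> * ((1 + \<delta>) * (1 - norm x)) ^ ?n" using \<theta> by simp
    also have "\<dots> = ((1 + \<delta>) ^ ?n * \<theta>) * (1 - norm x) ^ ?n" by (simp add: power_mult_distrib)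
    also have "\<dots> \<le> 1 * (1 - norm x) ^ ?n" using \<delta>(3) x by (intro mult_right_mono) auto
    finally show "v * (\<theta> * (1 - norm y) ^ ?n) \<le> v * (1 - norm x) ^ ?n" using v by simp
    show "0 \<le> \<theta> * ?\<Phi> y (1 / 2 * (1 - norm y))" using \<theta> \<Phi> by simp
    show "0 < v * (1 - norm x) ^ ?n * (v * (\<theta> * (1 - norm y) ^ ?n))" using v \<theta> x y by simp
  qed
  also have "\<dots> = ?\<Phi> y (1 / 2 * (1 - norm y)) / (v * (1 - norm y) ^ ?n)" using \<theta> by simp
  finally have "weight_avg W \<delta> x ^ ?n \<le> weight_avg W 1 y ^ ?n"
    unfolding weight_avg_power[OF W x] weight_avg_power[OF W y] v_def[symmetric] \<rho>_def .
  then show ?thesis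
    using power_mono_iff[of "weight_avg W \<delta> x" "weight_avg W 1 y" ?n] weight_avg_nonneg[OF W] x y by simp
qed

lemma avg_le_mixed:
  assumes q: "0 < q" "q \<le> real DIM('a::euclidean_space)" and c: "0 < c"
    and n: "2 \<le> DIM('a)" and C: "0 < C" and \<theta>: "0 < \<theta>" and \<delta>: "0 < \<delta>" "\<delta> \<le> 1 / 6" "(1 + \<delta>) ^ DIM('a) * \<theta> \<le> 1"
    and hole: "\<And>W (a::'a) \<rho>. caccioppoli_weight (ball 0 1) C W \<Longrightarrow> 0 < \<rho> \<Longrightarrow> cball a (4 * \<rho>) \<subseteq> ball 0 1 \<Longrightarrow>
      ball_int (\<lambda>x. W x ^ DIM('a)) a \<rho> \<le> \<theta> * ball_int (\<lambda>x. W x ^ DIM('a)) a (3 * \<rho>)"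
  shows "\<exists>B>0. \<forall>(W :: 'a \<Rightarrow> real) u N p. caccioppoli_weight (ball 0 1) C W \<and> u \<in> borel_measurable borel \<and>
     (\<forall>x. 0 \<le> u x) \<and> N \<in> null_sets lborel \<and> (\<forall>x\<in>ball 0 1 - N. \<forall>y\<in>ball x ((1 - norm x) / 4) - N. u x \<le> c * u y) \<and> q \<le> p \<longrightarrow>
     (\<integral>\<^sup>+x. ennreal (weight_avg W \<delta> x powr p * u x) * indicator (ball 0 1) x \<partial>lborel) \<le>
     ennreal B * (\<integral>\<^sup>+x. ennreal (W x powr q * weight_avg W 1 x powr (p - q) * u x) * indicator (ball 0 1) x \<partial>lborel)"
proof -
  let ?n = "DIM('a)" and ?U = "ball (0::'a) 1"
  obtain A where A: "A > 0" and RH: "\<And>U W (a::'a) \<rho>. caccioppoli_weight U C W \<Longrightarrow> 0 < \<rho> \<Longrightarrow> cball a (2 * \<rho>) \<subseteq> U \<Longrightarrow>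
     (ball_int (\<lambda>x. W x ^ ?n) a \<rho> / \<rho> ^ ?n) powr (q / real ?n) \<le> A * (ball_int (\<lambda>x. W x powr q) a (2 * \<rho>) / \<rho> ^ ?n)"
    using reverse_Hoelder[OF n C q] by blast
  define v where "v = measure lborel ?U"
  have v: "v > 0" by (simp add: v_def)
  \<comment> \<open>The first factor converts the normalisation of \<open>weight_avg\<close> into
    division by \<open>\<rho> ^ n\<close>, \<open>A\<close> is the reverse Hoelder constant, and the
    last division turns \<open>1 / \<rho> ^ n\<close> into
    \<open>1 / (1 - norm x) ^ n\<close>.\<close>
  define c2 where "c2 = ((\<delta> / 2) ^ ?n / v) powr (q / real ?n) * A / (\<delta> / 2) ^ ?n"
  have c2: "c2 > 0" using \<delta> v A by (simp add: c2_def)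
  define B where "B = c2 * (1 + \<delta>) ^ ?n * v * c"
  have B: "B > 0" using c2 \<delta> v c by (simp add: B_def)
  have "(\<integral>\<^sup>+x. ennreal (weight_avg W \<delta> x powr p * u x) * indicator ?U x \<partial>lborel) \<le>
     ennreal B * (\<integral>\<^sup>+x. ennreal (W x powr q * weight_avg W 1 x powr (p - q) * u x) * indicator ?U x \<partial>lborel)"
    if W: "caccioppoli_weight ?U C W" and mu[measurable]: "u \<in> borel_measurable borel" and u: "\<And>x. 0 \<le> u x"
      and N: "N \<in> null_sets lborel" and har: "\<And>x y. x \<in> ?U - N \<Longrightarrow> y \<in> ball x ((1 - norm x) / 4) - N \<Longrightarrow> u x \<le> c * u y" and p: "q \<le> p"
    for W u N p
  proof -
    note weight_measurable[OF W, measurable]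
    have w: "0 \<le> W x" for x using weight_nonneg[OF W] .
    have [measurable]: "?U \<in> sets borel" by simp
    define \<kappa> where "\<kappa> x y = (if dist x y < \<delta> * (1 - norm x) then ennreal (c2 / (1 - norm x) ^ ?n) else 0)" for x y :: 'a
    define Y where "Y y = ennreal (W y powr q * weight_avg W 1 y powr (p - q) * (c * u y)) * indicator ?U y" for y
    have m\<kappa>: "(\<lambda>(x, y). \<kappa> x y) \<in> borel_measurable (lborel \<Otimes>\<^sub>M lborel)" unfolding \<kappa>_def by measurable
    have mY: "Y \<in> borel_measurable borel" unfolding Y_def by measurable
    have AEN: "AE x in lborel. x \<notin> N" using N by (rule AE_not_in)
    have "(\<integral>\<^sup>+x. ennreal (weight_avg W \<delta> x powr p * u x) * indicator ?U x \<partial>lborel) \<le>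
        (\<integral>\<^sup>+y. ennreal B * (ennreal (W y powr q * weight_avg W 1 y powr (p - q) * u y) * indicator ?U y) \<partial>lborel)"
    proof (rule Fubini_transfer[OF m\<kappa> mY])
      show "AE x in lborel. ennreal (weight_avg W \<delta> x powr p * u x) * indicator ?U x \<le> (\<integral>\<^sup>+y. \<kappa> x y * Y y \<partial>lborel)"
        using AEN
      proof eventually_elim
        case (elim x)
        show ?case
        proof (cases "x \<in> ?U")
          case True
          then have nx: "norm x < 1" by simp
          define \<rho> where "\<rho> = \<delta> / 2 * (1 - norm x)"
          have \<rho>: "\<rho> > 0" using \<delta> nx by (simp add: \<rho>_def)
          define E where "E = ball x (2 * \<rho>)"
          have E: "y \<in> E \<longleftrightarrow> dist x y < \<delta> * (1 - norm x)" for y by (simp add: E_def \<rho>_def)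
          have "cball x ((2 * \<delta>) / 2 * (1 - norm x)) \<subseteq> ?U" using \<delta> by (intro whitney_cball_subset[OF nx]) auto
          then have sub: "cball x (2 * \<rho>) \<subseteq> ?U" by (simp add: \<rho>_def)
          define a where "a = weight_avg W \<delta> x"
          have a0: "a \<ge> 0" unfolding a_def by (rule weight_avg_nonneg[OF W nx])
          define I where "I = ball_int (\<lambda>x. W x powr q) x (2 * \<rho>)"
          have I0: "I \<ge> 0" unfolding I_def by (rule ball_int_nonneg) simp
          have aq: "a powr q \<le> c2 / (1 - norm x) ^ ?n * I"
          proof -
            define \<Phi> where "\<Phi> = ball_int (\<lambda>x. W x ^ ?n) x \<rho>"
            have \<Phi>: "\<Phi> \<ge> 0" unfolding \<Phi>_def using w by (intro ball_int_nonneg) auto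
            have "\<rho> ^ ?n = (\<delta> / 2) ^ ?n * (1 - norm x) ^ ?n" by (simp only: \<rho>_def power_mult_distrib)
            then have \<rho>n: "(1 - norm x) ^ ?n = \<rho> ^ ?n / (\<delta> / 2) ^ ?n" using \<delta> by simp
            have "a ^ ?n = (\<delta> / 2) ^ ?n / v * (\<Phi> / \<rho> ^ ?n)"
              unfolding a_def weight_avg_power[OF W nx] \<Phi>_def \<rho>_def[symmetric] v_def[symmetric] \<rho>n by simp
            moreover have "a powr q = (a ^ ?n) powr (q / real ?n)"
              using a0 q by (cases "a = 0") (auto simp: powr_realpow[symmetric] powr_powr zero_power)
            ultimately have "a powr q = ((\<delta> / 2) ^ ?n / v) powr (q / real ?n) * (\<Phi> / \<rho> ^ ?n) powr (q / real ?n)"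
              using \<Phi> \<rho> v \<delta> by (simp only: powr_mult)
            also have "\<dots> \<le> ((\<delta> / 2) ^ ?n / v) powr (q / real ?n) * (A * (I / \<rho> ^ ?n))"
              unfolding \<Phi>_def I_def using RH[OF W \<rho> sub] by (intro mult_left_mono) auto
            also have "\<dots> = c2 / (1 - norm x) ^ ?n * I"
              unfolding \<rho>n c2_def using \<delta> \<rho> by simp
            finally show ?thesis .
          qed
          define L where "L = a powr (p - q) * u x"
          have L0: "L \<ge> 0" unfolding L_def using u by simp
          have pt: "ennreal (c2 / (1 - norm x) ^ ?n) * ennreal L * (indicator E y * ennreal (W y powr q)) \<le> \<kappa> x y * Y y" if y: "y \<notin> N" for y
          proof (cases "y \<in> E")
            case yE: True
            then have xy: "dist x y < \<delta> * (1 - norm x)" by (simp add: E)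
            have "y \<in> cball x (2 * \<rho>)" using yE by (simp add: E_def)
            then have yU: "y \<in> ?U" using sub by blast
            have "a \<le> weight_avg W 1 y"
              unfolding a_def by (rule weight_avg_le_by_hole_filling[OF W hole[OF W] \<theta> \<delta> nx xy])
            then have "a powr (p - q) \<le> weight_avg W 1 y powr (p - q)" using a0 p by (intro powr_mono2) auto
            moreover have "u x \<le> c * u y"
            proof (rule har)
              have "\<delta> * (1 - norm x) \<le> (1 - norm x) / 4" using \<delta> nx mult_right_mono[of \<delta> "1 / 4" "1 - norm x"] by simp
              then show "y \<in> ball x ((1 - norm x) / 4) - N" using xy y by simp
            qed (use True elim in simp)
            ultimately have "L \<le> weight_avg W 1 y powr (p - q) * (c * u y)"
              unfolding L_def using u by (intro mult_mono) auto
            then have "L * W y powr q \<le> (weight_avg W 1 y powr (p - q) * (c * u y)) * W y powr q" by (rule mult_right_mono) simp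
            then have "ennreal L * ennreal (W y powr q) \<le> Y y"
              using yU L0 by (simp add: Y_def ennreal_mult[symmetric] mult_ac ennreal_leI)
            then have "ennreal (c2 / (1 - norm x) ^ ?n) * (ennreal L * ennreal (W y powr q)) \<le> ennreal (c2 / (1 - norm x) ^ ?n) * Y y"
              by (rule mult_left_mono) simp
            then show ?thesis using yE xy by (simp add: \<kappa>_def mult.assoc)
          qed simp
          have "a powr p = a powr q * a powr (p - q)" unfolding powr_add[symmetric] by simp
          then have "ennreal (weight_avg W \<delta> x powr p * u x) * indicator ?U x = ennreal (a powr q * L)"
            using True by (simp add: L_def a_def mult.assoc)
          also have "\<dots> \<le> ennreal (c2 / (1 - norm x) ^ ?n * I * L)"
            using aq L0 by (intro ennreal_leI mult_right_mono)
          also have "\<dots> = ennreal (c2 / (1 - norm x) ^ ?n) * ennreal L * ennreal I"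
            using c2 nx I0 L0 by (simp add: ennreal_mult[symmetric] mult_ac)
          also have "ennreal I = (\<integral>\<^sup>+y. indicator E y * ennreal (W y powr q) \<partial>lborel)"
            unfolding I_def E_def
            using nn_integral_ball_int[OF weight_powr_set_integrable[OF W sub _ _ q], of x "2 * \<rho>"] by auto
          also have "ennreal (c2 / (1 - norm x) ^ ?n) * ennreal L * (\<integral>\<^sup>+y. indicator E y * ennreal (W y powr q) \<partial>lborel) =
              (\<integral>\<^sup>+y. ennreal (c2 / (1 - norm x) ^ ?n) * ennreal L * (indicator E y * ennreal (W y powr q)) \<partial>lborel)"
          proof -
            have [measurable]: "E \<in> sets borel" by (simp add: E_def)
            show ?thesis by (rule nn_integral_cmult[symmetric]) measurable
          qed
          also have "\<dots> \<le> (\<integral>\<^sup>+y. \<kappa> x y * Y y \<partial>lborel)"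
          proof (rule nn_integral_mono_AE)
            show "AE y in lborel. ennreal (c2 / (1 - norm x) ^ ?n) * ennreal L * (indicator E y * ennreal (W y powr q)) \<le> \<kappa> x y * Y y" using AEN by eventually_elim (rule pt)
          qed
          finally show ?thesis .
        qed simp
      qed
      fix y :: 'a
      show "(\<integral>\<^sup>+x. \<kappa> x y \<partial>lborel) * Y y \<le> ennreal B * (ennreal (W y powr q * weight_avg W 1 y powr (p - q) * u y) * indicator ?U y)"
      proof (cases "y \<in> ?U")
        case True
        then have ny: "norm y < 1" by simp
        define m where "m = (1 - norm y) ^ ?n"
        have m: "m > 0" using ny by (simp add: m_def)
        \<comment> \<open>For fixed \<open>y\<close> the kernel lives on a ball of volume
          \<open>v * m\<close>, where \<open>1 - norm x\<close> and \<open>1 - norm y\<close> are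
          comparable; the factor \<open>m\<close> cancels in its integral.\<close>
        have "\<kappa> x y \<le> ennreal (c2 * (1 + \<delta>) ^ ?n / m) * indicator (ball y (1 - norm y)) x" for x
        proof (cases "dist x y < \<delta> * (1 - norm x)")
          case xy: True
          have "0 < \<delta> * (1 - norm x)" using xy zero_le_dist[of x y] by linarith
          then have nx: "norm x < 1" using \<delta> by (simp add: zero_less_mult_iff)
          note cmp = whitney_comparison[OF xy]
          have "\<delta> * (1 - norm x) \<le> (1 - \<delta>) * (1 - norm x)" using \<delta> nx by (intro mult_right_mono) auto
          then have "x \<in> ball y (1 - norm y)" using xy cmp by (simp add: dist_commute)
          moreover have "c2 / (1 - norm x) ^ ?n \<le> c2 * (1 + \<delta>) ^ ?n / m"
          proof -
            have "m \<le> ((1 + \<delta>) * (1 - norm x)) ^ ?n" unfolding m_def using cmp(2) ny by (intro power_mono) auto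
            then have "c2 * m \<le> c2 * ((1 + \<delta>) ^ ?n * (1 - norm x) ^ ?n)" using c2 by (simp add: power_mult_distrib)
            then show ?thesis using m nx by (simp add: field_simps)
          qed
          ultimately show ?thesis using xy by (simp add: \<kappa>_def ennreal_leI)
        qed (simp add: \<kappa>_def)
        then have "(\<integral>\<^sup>+x. \<kappa> x y \<partial>lborel) \<le> (\<integral>\<^sup>+x. ennreal (c2 * (1 + \<delta>) ^ ?n / m) * indicator (ball y (1 - norm y)) x \<partial>lborel)"
          by (rule nn_integral_mono)
        also have "\<dots> = ennreal (c2 * (1 + \<delta>) ^ ?n / m) * emeasure lborel (ball y (1 - norm y))"
          by (rule nn_integral_cmult_indicator) simp
        also have "emeasure lborel (ball y (1 - norm y)) = ennreal (v * m)"
          using measure_ball_scale[of "1 - norm y" y] ny by (simp add: emeasure_lborel_ball v_def m_def)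
        also have "ennreal (c2 * (1 + \<delta>) ^ ?n / m) * ennreal (v * m) = ennreal (c2 * (1 + \<delta>) ^ ?n * v)"
          using m v c2 \<delta> by (simp add: ennreal_mult[symmetric])
        finally have "(\<integral>\<^sup>+x. \<kappa> x y \<partial>lborel) * Y y \<le> ennreal (c2 * (1 + \<delta>) ^ ?n * v) * Y y"
          by (rule mult_right_mono) simp
        also have "\<dots> = ennreal (c2 * (1 + \<delta>) ^ ?n * v * (W y powr q * weight_avg W 1 y powr (p - q) * (c * u y)))"
          using True c2 v c \<delta> u by (simp add: Y_def ennreal_mult)
        also have "c2 * (1 + \<delta>) ^ ?n * v * (W y powr q * weight_avg W 1 y powr (p - q) * (c * u y)) = B * (W y powr q * weight_avg W 1 y powr (p - q) * u y)"
          by (simp add: B_def mult_ac)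
        finally show ?thesis using True B u by (simp add: ennreal_mult)
      qed (simp add: Y_def)
    qed
    also have "\<dots> = ennreal B * (\<integral>\<^sup>+y. ennreal (W y powr q * weight_avg W 1 y powr (p - q) * u y) * indicator ?U y \<partial>lborel)"
      by (rule nn_integral_cmult) measurable
    finally show ?thesis .
  qed
  note main = this
  show ?thesis
    by (intro exI[of _ B] conjI B allI impI, elim conjE, rule main) (assumption | blast)+
qed

section \<open>Return to the Lebesgue integrals and conclusion\<close>

lemma nn_set_integral_lebesgue_eq_lborel:
  fixes g h :: "'a::euclidean_space \<Rightarrow> real"
  assumes h: "h \<in> borel_measurable borel" and U: "U \<in> sets borel" and ae: "AE x in lborel. x \<in> U \<longrightarrow> g x = h x"
  shows "(\<integral>\<^sup>+x\<in>U. ennreal (g x) \<partial>lebesgue) = (\<integral>\<^sup>+x. ennreal (h x) * indicator U x \<partial>lborel)"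
proof -
  have "AE x in lebesgue. x \<in> U \<longrightarrow> g x = h x" using ae by (rule AE_completion)
  then have "(\<integral>\<^sup>+x\<in>U. ennreal (g x) \<partial>lebesgue) = (\<integral>\<^sup>+x. ennreal (h x) * indicator U x \<partial>lebesgue)"
    by (intro nn_integral_cong_AE) (auto elim!: eventually_mono simp: indicator_def)
  also have "\<dots> = (\<integral>\<^sup>+x. ennreal (h x) * indicator U x \<partial>lborel)"
    using h U by (subst nn_integral_completion) auto
  finally show ?thesis .
qed

text \<open>The two integrands agree only almost everywhere, but the averages, being integrals,
  agree at every point of the unit ball.\<close>

lemma avg_deriv_eq_weight_avg:
  fixes f :: "real^'n \<Rightarrow> real^'n"
  assumes W: "W \<in> borel_measurable borel"
    and ae: "AE x in lborel. x \<in> ball 0 1 \<longrightarrow> deriv_opnorm (ball 0 1) f x = W x"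
    and m: "deriv_opnorm (ball 0 1) f \<in> borel_measurable (lebesgue_on (ball 0 1))"
    and x: "norm x < 1" and s: "s < 2"
  shows "avg_deriv f s x = weight_avg W s x"
proof -
  have b: "wball s x \<in> sets borel" by (simp add: wball_def)
  have sub: "wball s x \<subseteq> ball 0 1"
    using whitney_cball_subset[OF x s] ball_subset_cball unfolding wball_def by blast
  have "(LINT y:wball s x|lebesgue. deriv_opnorm (ball 0 1) f y ^ CARD('n)) = (LINT y|lborel. indicator (wball s x) y * W y ^ CARD('n))"
  proof (rule set_integral_lebesgue_eq_lborel(1)[OF _ _ b])
    show "(\<lambda>y. indicator (wball s x) y * W y ^ CARD('n)) \<in> borel_measurable borel" using W b by measurable
    have "deriv_opnorm (ball 0 1) f \<in> borel_measurable (lebesgue_on (wball s x))"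
      by (rule measurable_restrict_mono[OF m sub])
    then show "(\<lambda>y. deriv_opnorm (ball 0 1) f y ^ CARD('n)) \<in> borel_measurable (lebesgue_on (wball s x))" by measurable
    show "AE y in lborel. y \<in> wball s x \<longrightarrow> deriv_opnorm (ball 0 1) f y ^ CARD('n) = W y ^ CARD('n)"
      using ae by eventually_elim (use sub in auto)
  qed
  moreover have "measure lebesgue (wball 2 x) = measure lborel (ball (0::real^'n) 1) * (1 - norm x) ^ CARD('n)"
    using measure_ball_scale[of "1 - norm x" x] x by (simp add: wball_def measure_completion)
  ultimately show ?thesis
    unfolding avg_deriv_def weight_avg_def ball_int_def set_lebesgue_integral_def wball_def by simp
qed

theorem lemma3p9:
  fixes K :: real and u :: "real^'n \<Rightarrow> real"
  assumes "2 \<le> CARD('n)"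
    and "1 \<le> K"
    and "u \<in> borel_measurable (lebesgue_on (ball 0 1))"
    and "\<forall>x\<in>ball 0 1. 0 \<le> u x"
    and "harnack u"
  shows "\<exists>s1\<in>{0<..<1}. \<forall>s2\<in>{1<..<2}. \<forall>q\<in>{0<..real CARD('n)}. \<exists>C>0. \<forall>p\<ge>q.
    \<forall>f :: real^'n \<Rightarrow> real^'n. quasiregular_on K (ball 0 1) f \<longrightarrow>
      mixed_integral u p q f \<le> ennreal C * avg_integral u p s2 f \<and>
      avg_integral u p s1 f \<le> ennreal C * mixed_integral u p q f"
proof -
  let ?U = "ball (0::real^'n) 1"
  have n: "2 \<le> DIM(real^'n)" using assms(1) by simp
  obtain c where c: "c > 0" and har: "\<And>x y. x \<in> ?U \<Longrightarrow> y \<in> wball (1/2) x \<Longrightarrow> u x \<le> c * u y"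
    using assms(5) unfolding harnack_def by blast
  define Cw where "Cw = K * caccioppoli_const TYPE('n)"
  have Cw: "Cw > 0" using assms(2) caccioppoli_const_pos[where 'n = 'n] by (simp add: Cw_def)
  obtain \<theta> where \<theta>: "0 < \<theta>" "\<theta> < 1"
    and hole: "\<And>U W (a::real^'n) \<rho>. caccioppoli_weight U Cw W \<Longrightarrow> 0 < \<rho> \<Longrightarrow> cball a (4 * \<rho>) \<subseteq> U \<Longrightarrow>
     ball_int (\<lambda>x. W x ^ DIM(real^'n)) a \<rho> \<le> \<theta> * ball_int (\<lambda>x. W x ^ DIM(real^'n)) a (3 * \<rho>)"
    using hole_filling[OF n Cw] by blast
  \<comment> \<open>This is the witness for \<open>s1\<close>: at most \<open>1 / 6\<close> for the
    inclusion of balls, and with \<open>(1 + \<delta>) ^ n * \<theta> \<le> 1\<close>. It is fixed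
    before \<open>s2\<close> and \<open>q\<close>.\<close>
  define \<delta> where "\<delta> = min (1 / 6) (root CARD('n) (1 / \<theta>) - 1)"
  have "1 < root CARD('n) (1 / \<theta>)" using \<theta> by simp
  then have \<delta>: "0 < \<delta>" "\<delta> \<le> 1 / 6" "1 + \<delta> \<le> root CARD('n) (1 / \<theta>)" unfolding \<delta>_def by linarith+
  have \<delta>n: "(1 + \<delta>) ^ DIM(real^'n) * \<theta> \<le> 1"
  proof -
    have "(1 + \<delta>) ^ CARD('n) \<le> root CARD('n) (1 / \<theta>) ^ CARD('n)" using \<delta> by (intro power_mono) auto
    also have "\<dots> = 1 / \<theta>" using \<theta> by (simp add: real_root_pow_pos2)
    finally show ?thesis using \<theta> by (simp add: field_simps)
  qed
  have "u \<in> borel_measurable (lebesgue_on ?U) \<longleftrightarrow> (\<lambda>x. if x \<in> ?U then u x else 0) \<in> borel_measurable lebesgue"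
    by (rule borel_measurable_if[symmetric]) simp
  then obtain w where w: "w \<in> borel_measurable lborel" "AE x in lborel. (if x \<in> ?U then u x else 0) = w x"
    using completion_ex_borel_measurable_real assms(3) by blast
  \<comment> \<open>A Borel representative of \<open>u\<close>, made nonnegative everywhere. It
    agrees with \<open>u\<close> on the unit ball off a null set \<open>N\<close>, so the Harnack
    inequality for it holds only between points outside \<open>N\<close>; this is why
    \<open>N\<close> appears in the two inequalities for weights.\<close>
  define u' where "u' x = max 0 (w x)" for x
  have mu[measurable]: "u' \<in> borel_measurable borel" using w(1) unfolding u'_def by measurable
  have u'0: "\<forall>x. 0 \<le> u' x" by (simp add: u'_def)
  have "AE x in lborel. x \<in> ?U \<longrightarrow> u x = u' x"
    using w(2) by eventually_elim (use assms(4) in \<open>force simp: u'_def\<close>)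
  then obtain N where N: "N \<in> null_sets lborel" and uN: "\<And>x. x \<in> ?U - N \<Longrightarrow> u x = u' x"
  proof (rule AE_E)
    fix N assume N: "{x \<in> space lborel. \<not> (x \<in> ?U \<longrightarrow> u x = u' x)} \<subseteq> N" "emeasure lborel N = 0" "N \<in> sets lborel"
    show thesis by (rule that[of N]) (use N in \<open>auto simp: null_sets_def\<close>)
  qed
  have harN: "\<forall>x\<in>?U - N. \<forall>y\<in>ball x ((1 - norm x) / 4) - N. u' x \<le> c * u' y"
  proof (intro ballI)
    fix x y assume x: "x \<in> ?U - N" and y: "y \<in> ball x ((1 - norm x) / 4) - N"
    have "norm x < 1" using x by simp
    from whitney_cball_subset[OF this, of "1 / 2"] y have "y \<in> ?U - N" by (auto simp: subset_iff)
    \<comment> \<open>The radius of \<open>wball (1 / 2) x\<close> is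
      \<open>(1 - norm x) / 4\<close>, the bound used for the Whitney regions.\<close>
    moreover have "y \<in> wball (1 / 2) x" using y by (simp add: wball_def)
    ultimately show "u' x \<le> c * u' y" using har[of x y] uN x by auto
  qed
  have "\<exists>C>0. \<forall>p\<ge>q. \<forall>f :: real^'n \<Rightarrow> real^'n. quasiregular_on K ?U f \<longrightarrow>
      mixed_integral u p q f \<le> ennreal C * avg_integral u p s2 f \<and>
      avg_integral u p \<delta> f \<le> ennreal C * mixed_integral u p q f"
    if s2: "1 < s2" "s2 < 2" and q: "0 < q" "q \<le> real CARD('n)" for s2 q
  proof -
    have q': "q \<le> real DIM(real^'n)" using q by simp
    obtain B1 where B1: "B1 > 0" and le1: "\<And>(W :: real^'n \<Rightarrow> real) C u N p. caccioppoli_weight ?U C W \<Longrightarrow> u \<in> borel_measurable borel \<Longrightarrow>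
       \<forall>x. 0 \<le> u x \<Longrightarrow> N \<in> null_sets lborel \<Longrightarrow> \<forall>x\<in>?U - N. \<forall>y\<in>ball x ((1 - norm x) / 4) - N. u x \<le> c * u y \<Longrightarrow> q \<le> p \<Longrightarrow>
       (\<integral>\<^sup>+x. ennreal (W x powr q * weight_avg W 1 x powr (p - q) * u x) * indicator ?U x \<partial>lborel) \<le>
       ennreal B1 * (\<integral>\<^sup>+x. ennreal (weight_avg W s2 x powr p * u x) * indicator ?U x \<partial>lborel)"
      using mixed_le_avg[OF s2 q(1) q' c] by blast
    obtain B2 where B2: "B2 > 0" and le2: "\<And>(W :: real^'n \<Rightarrow> real) u N p. caccioppoli_weight ?U Cw W \<Longrightarrow> u \<in> borel_measurable borel \<Longrightarrow>
       \<forall>x. 0 \<le> u x \<Longrightarrow> N \<in> null_sets lborel \<Longrightarrow> \<forall>x\<in>?U - N. \<forall>y\<in>ball x ((1 - norm x) / 4) - N. u x \<le> c * u y \<Longrightarrow> q \<le> p \<Longrightarrow>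
       (\<integral>\<^sup>+x. ennreal (weight_avg W \<delta> x powr p * u x) * indicator ?U x \<partial>lborel) \<le>
       ennreal B2 * (\<integral>\<^sup>+x. ennreal (W x powr q * weight_avg W 1 x powr (p - q) * u x) * indicator ?U x \<partial>lborel)"
    proof -
      have "ball_int (\<lambda>x. W x ^ DIM(real^'n)) a \<rho> \<le> \<theta> * ball_int (\<lambda>x. W x ^ DIM(real^'n)) a (3 * \<rho>)"
        if "caccioppoli_weight ?U Cw W" "0 < \<rho>" "cball a (4 * \<rho>) \<subseteq> ?U" for W and a :: "real^'n" and \<rho>
        using hole that by blast
      from avg_le_mixed[OF q(1) q' c n Cw \<theta>(1) \<delta>(1,2) \<delta>n this] show thesis using that by blast
    qed
    define C where "C = max B1 B2"
    have C: "C > 0" using B1 by (simp add: C_def)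
    have "mixed_integral u p q f \<le> ennreal C * avg_integral u p s2 f \<and> avg_integral u p \<delta> f \<le> ennreal C * mixed_integral u p q f"
      if p: "q \<le> p" and f: "quasiregular_on K ?U f" for p f
    proof -
      obtain W where W: "caccioppoli_weight ?U Cw W"
        and ae: "AE x in lborel. x \<in> ?U \<longrightarrow> deriv_opnorm ?U f x = W x"
        and m: "deriv_opnorm ?U f \<in> borel_measurable (lebesgue_on ?U)"
        using quasiregular_weight[OF f open_ball] unfolding Cw_def by blast
      note mW[measurable] = weight_measurable[OF W]
      have av: "avg_deriv f s x = weight_avg W s x" if "x \<in> ?U" "s < 2" for s x
        using that by (intro avg_deriv_eq_weight_avg[OF mW ae m]) auto
      have AEN: "AE x in lborel. x \<notin> N" using N by (rule AE_not_in)
      have bU: "?U \<in> sets borel" by simp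
      have M: "mixed_integral u p q f = (\<integral>\<^sup>+x. ennreal (W x powr q * weight_avg W 1 x powr (p - q) * u' x) * indicator ?U x \<partial>lborel)"
        unfolding mixed_integral_def
      proof (rule nn_set_integral_lebesgue_eq_lborel[OF _ bU])
        show "AE x in lborel. x \<in> ?U \<longrightarrow> deriv_opnorm ?U f x powr q * avg_deriv f 1 x powr (p - q) * u x =
            W x powr q * weight_avg W 1 x powr (p - q) * u' x"
          using ae AEN
        proof eventually_elim
          case (elim x)
          then show ?case using av[of x 1] uN[of x] by auto
        qed
      qed measurable
      have A: "avg_integral u p s f = (\<integral>\<^sup>+x. ennreal (weight_avg W s x powr p * u' x) * indicator ?U x \<partial>lborel)" if "s < 2" for s
        unfolding avg_integral_def
      proof (rule nn_set_integral_lebesgue_eq_lborel[OF _ bU])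
        show "AE x in lborel. x \<in> ?U \<longrightarrow> avg_deriv f s x powr p * u x = weight_avg W s x powr p * u' x"
          using AEN
        proof eventually_elim
          case (elim x)
          then show ?case using av[of x s] uN[of x] that by auto
        qed
      qed measurable
      have "mixed_integral u p q f \<le> ennreal B1 * avg_integral u p s2 f"
        unfolding M A[OF s2(2)] by (rule le1[OF W mu u'0 N harN p])
      also have "\<dots> \<le> ennreal C * avg_integral u p s2 f"
        by (intro mult_right_mono ennreal_leI) (auto simp: C_def)
      finally have 1: "mixed_integral u p q f \<le> ennreal C * avg_integral u p s2 f" .
      have "\<delta> < 2" using \<delta> by simp
      have "avg_integral u p \<delta> f \<le> ennreal B2 * mixed_integral u p q f"
        unfolding M A[OF \<open>\<delta> < 2\<close>] by (rule le2[OF W mu u'0 N harN p])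
      also have "\<dots> \<le> ennreal C * mixed_integral u p q f"
        by (intro mult_right_mono ennreal_leI) (auto simp: C_def)
      finally show ?thesis using 1 by blast
    qed
    with C show ?thesis by blast
  qed
  moreover have "\<delta> \<in> {0<..<1}" using \<delta> by auto
  ultimately show ?thesis by (intro bexI[of _ \<delta>]) auto
qed

end
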